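(* Let $k\ge 3$, $1\le s\le k$, $\mathbf n=(n_1,\dots,n_k)$ positive integers and $r\le\min\{n_1,\dots,n_k\}$. For a generic tensor $\mathcal T\in\mathbb R^{n_1}\otimes\cdots\otimes\mathbb R^{n_k}$, every critical projection of $\mathcal T$ on $P_s(\mathbf n,r)$ lies in $R_s(\mathbf n,r)$.
   Context: $P_s(\mathbf n,r)$ is the set of tensors $\sum_{i=1}^r\sigma_i\mathbf a^{(1)}_i\otimes\cdots\otimes\mathbf a^{(k)}_i$ with $\sigma_i\in\mathbb R$, all $\mathbf a^{(l)}_i\in\mathbb R^{n_l}$ unit vectors, and for each $l\le s$ the vectors $\mathbf a^{(l)}_1,\dots,\mathbf a^{(l)}_r$ pairwise orthogonal; it is a real algebraic subset of the tensor space. $R_s(\mathbf n,r)\subseteq P_s(\mathbf n,r)$ is the set of those tensors admitting such a decomposition in which all $\sigma_i\ne0$ and for each $l=s+1,\dots,k$ the matrix $[\mathbf a^{(l)}_1,\dots,\mathbf a^{(l)}_r]$ has full column rank $r$. For a real algebraic set $Y\subseteq\mathbb R^N$ whose vanishing ideal is generated by $f_1,\dots,f_m$, the Zariski tangent space at $\mathbf y\in Y$ is $T_Y(\mathbf y)=\ker J_{\mathbf y}(f_1,\dots,f_m)$ (kernel of the Jacobian matrix); a point $\mathbf y_0\in Y$ is a critical projection of $\mathbf x\in\mathbb R^N$ to $Y$ if $\langle\mathbf v,\mathbf x-\mathbf y_0\rangle=0$ for all $\mathbf v\in T_Y(\mathbf y_0)$ (with the tensor space identified with $\mathbb R^N$,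 Hilbert–Schmidt inner product). "Generic" means: outside a proper real algebraic subset (in particular outside a Lebesgue-null set). *)

theory Defs
  imports "HOL-Analysis.Analysis"
begin

text \<open>Tensors in R^{n_1} x ... x R^{n_k} (with n = [n_1,...,n_k], modes indexed 0..k-1)
are represented as functions on multi-indices (nat lists), vanishing outside the index box.\<close>

definition idx :: "nat list \<Rightarrow> nat list set" where
  "idx n = {i. length i = length n \<and> (\<forall>l<length n. i ! l < n ! l)}"

definition tspace :: "nat list \<Rightarrow> (nat list \<Rightarrow> real) set" where
  "tspace n = {T. \<forall>i. i \<notin> idx n \<longrightarrow> T i = 0}"

definition tinner :: "nat list \<Rightarrow> (nat list \<Rightarrow> real) \<Rightarrow> (nat list \<Rightarrow> real) \<Rightarrow> real" where
  "tinner n S T = (\<Sum>i\<in>idx n. S i * T i)"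

inductive_set polyfun :: "nat list \<Rightarrow> ((nat list \<Rightarrow> real) \<Rightarrow> real) set" for n where
  const: "(\<lambda>T. c) \<in> polyfun n"
| coord: "i \<in> idx n \<Longrightarrow> (\<lambda>T. T i) \<in> polyfun n"
| add: "f \<in> polyfun n \<Longrightarrow> g \<in> polyfun n \<Longrightarrow> (\<lambda>T. f T + g T) \<in> polyfun n"
| mult: "f \<in> polyfun n \<Longrightarrow> g \<in> polyfun n \<Longrightarrow> (\<lambda>T. f T * g T) \<in> polyfun n"

definition zero_set :: "nat list \<Rightarrow> ((nat list \<Rightarrow> real) \<Rightarrow> real) set \<Rightarrow> (nat list \<Rightarrow> real) set" where
  "zero_set n F = {T \<in> tspace n. \<forall>f\<in>F. f T = 0}"

definition real_algebraic :: "nat list \<Rightarrow> (nat list \<Rightarrow> real) set \<Rightarrow> bool" where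
  "real_algebraic n Y \<longleftrightarrow> (\<exists>F \<subseteq> polyfun n. Y = zero_set n F)"

definition vanishing_ideal :: "nat list \<Rightarrow> (nat list \<Rightarrow> real) set \<Rightarrow> ((nat list \<Rightarrow> real) \<Rightarrow> real) set" where
  "vanishing_ideal n Y = {f \<in> polyfun n. \<forall>y\<in>Y. f y = 0}"

text \<open>Zariski tangent space: common kernel of the differentials at y of all polynomials in
the vanishing ideal (equivalently, kernel of the Jacobian of any generating set).\<close>
definition zariski_tangent :: "nat list \<Rightarrow> (nat list \<Rightarrow> real) set \<Rightarrow> (nat list \<Rightarrow> real) \<Rightarrow> (nat list \<Rightarrow> real) set" where
  "zariski_tangent n Y y = {v \<in> tspace n. \<forall>f \<in> vanishing_ideal n Y.
      ((\<lambda>t. f (\<lambda>i. y i + t * v i)) has_real_derivative 0) (at 0)}"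

definition critical_projection :: "nat list \<Rightarrow> (nat list \<Rightarrow> real) set \<Rightarrow> (nat list \<Rightarrow> real) \<Rightarrow> (nat list \<Rightarrow> real) \<Rightarrow> bool" where
  "critical_projection n Y x y0 \<longleftrightarrow> y0 \<in> Y \<and>
     (\<forall>v \<in> zariski_tangent n Y y0. tinner n v (\<lambda>i. x i - y0 i) = 0)"

definition generic :: "nat list \<Rightarrow> ((nat list \<Rightarrow> real) \<Rightarrow> bool) \<Rightarrow> bool" where
  "generic n P \<longleftrightarrow> (\<exists>Z. real_algebraic n Z \<and> Z \<noteq> tspace n \<and>
       (\<forall>T \<in> tspace n. T \<notin> Z \<longrightarrow> P T))"

definition is_vec :: "nat \<Rightarrow> (nat \<Rightarrow> real) \<Rightarrow> bool" where
  "is_vec m v \<longleftrightarrow> (\<forall>j\<ge>m. v j = 0)"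

definition vinner :: "nat \<Rightarrow> (nat \<Rightarrow> real) \<Rightarrow> (nat \<Rightarrow> real) \<Rightarrow> real" where
  "vinner m v w = (\<Sum>j<m. v j * w j)"

definition unit_vec :: "nat \<Rightarrow> (nat \<Rightarrow> real) \<Rightarrow> bool" where
  "unit_vec m v \<longleftrightarrow> is_vec m v \<and> vinner m v v = 1"

definition outer :: "nat list \<Rightarrow> (nat \<Rightarrow> nat \<Rightarrow> real) \<Rightarrow> (nat list \<Rightarrow> real)" where
  "outer n a = (\<lambda>i. if i \<in> idx n then (\<Prod>l<length n. a l (i ! l)) else 0)"

text \<open>A (term i, mode l) = vector a^(l)_i. Decomposition sum_{i<r} sigma_i a^(1)_i x ... x a^(k)_i
with unit vectors and pairwise orthogonality in modes l < s (paper: modes 1..s).\<close>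
definition orth_decomp :: "nat list \<Rightarrow> nat \<Rightarrow> nat \<Rightarrow> (nat \<Rightarrow> real) \<Rightarrow> (nat \<Rightarrow> nat \<Rightarrow> nat \<Rightarrow> real) \<Rightarrow> bool" where
  "orth_decomp n s r \<sigma> A \<longleftrightarrow>
     (\<forall>i<r. \<forall>l<length n. unit_vec (n ! l) (A i l)) \<and>
     (\<forall>l<s. \<forall>i<r. \<forall>i'<r. i \<noteq> i' \<longrightarrow> vinner (n ! l) (A i l) (A i' l) = 0)"

definition decomp_tensor :: "nat list \<Rightarrow> nat \<Rightarrow> (nat \<Rightarrow> real) \<Rightarrow> (nat \<Rightarrow> nat \<Rightarrow> nat \<Rightarrow> real) \<Rightarrow> (nat list \<Rightarrow> real)" where
  "decomp_tensor n r \<sigma> A = (\<lambda>idx'. \<Sum>i<r. \<sigma> i * outer n (A i) idx')"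

definition Ps :: "nat list \<Rightarrow> nat \<Rightarrow> nat \<Rightarrow> (nat list \<Rightarrow> real) set" where
  "Ps n s r = {T. \<exists>\<sigma> A. orth_decomp n s r \<sigma> A \<and> T = decomp_tensor n r \<sigma> A}"

definition full_col_rank :: "nat \<Rightarrow> nat \<Rightarrow> (nat \<Rightarrow> nat \<Rightarrow> real) \<Rightarrow> bool" where
  "full_col_rank m r M \<longleftrightarrow>
     (\<forall>c :: nat \<Rightarrow> real. (\<forall>j<m. (\<Sum>i<r. c i * M i j) = 0) \<longrightarrow> (\<forall>i<r. c i = 0))"

definition Rs :: "nat list \<Rightarrow> nat \<Rightarrow> nat \<Rightarrow> (nat list \<Rightarrow> real) set" where
  "Rs n s r = {T. \<exists>\<sigma> A. orth_decomp n s r \<sigma> A \<and> T = decomp_tensor n r \<sigma> A \<and>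
      (\<forall>i<r. \<sigma> i \<noteq> 0) \<and>
      (\<forall>l. s \<le> l \<and> l < length n \<longrightarrow> full_col_rank (n ! l) r (\<lambda>i. A i l))}"

end

theory Submission
  imports Defs "HOL-Computational_Algebra.Polynomial" "HOL-Library.Function_Algebras"
begin

text \<open>
  Let \<open>Y = P\<^sub>s(n, r)\<close>, let \<open>N\<close> be the dimension of the tensor space and \<open>m\<close> the number of parameters of
  the decompositions. At every \<open>y \<in> Y\<close> the gradients of the vanishing ideal span a space of dimension
  at most \<open>N - m\<close>: along a polynomial path in \<open>Y\<close> from \<open>y\<close> to a tensor whose vectors are orthonormal
  in all modes, gradients that are independent at \<open>y\<close> stay independent at all but finitely many points,
  and so do \<open>m\<close> explicit tangent vectors, whose independence is visible at the end point.
  Hilbert's basis theorem gives finitely many generators \<open>f\<close>, so a critical projection \<open>y\<close> of \<open>T\<close>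
  satisfies \<open>T = y + \<Sum> c\<^sub>f \<nabla>f(y)\<close> with at most \<open>N - m\<close> summands. The tensors in \<open>Y\<close> outside \<open>R\<^sub>s(n, r)\<close>
  are covered by finitely many polynomial images of \<open>\<real>\<^bsup>m-1\<^esup>\<close>. Hence all bad \<open>T\<close> lie in finitely many
  polynomial images of spaces of dimension at most \<open>N - 1\<close>, and by counting monomials each such image
  satisfies a nontrivial polynomial equation.
\<close>

section \<open>Hilbert's basis theorem for polynomial functions\<close>

text \<open>Semicontinuity shapes the argument. At a singular point of \<open>Y\<close> the Zariski
  tangent space only grows, so the normal space only shrinks; the rank bound \<open>N - m\<close>
  therefore holds at degenerate points too, and at most \<open>m - 1\<close> parameters for such a
  point plus at most \<open>N - m\<close> normal coefficients stay below \<open>N\<close>. The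
  exceptional set must be cut out by one polynomial chosen before \<open>y\<close> is known. Hence
  the gradients have to come from a finite set fixed in advance, and the bad tensors are
  parametrised by explicit polynomial maps in a counted number of variables. Charts of spheres and
  of orthonormal frames are rational. They become polynomial once every vector is prescribed only up
  to a scalar, and the scalars disappear into the coefficients \<open>\<sigma>\<close>. The
  condition \<open>k \<ge> 3\<close> enters through multi-indices \<open>(i,...,i)\<close> with one
  altered entry, which label the tangent directions: with two modes \<open>(i,j)\<close> would label
  two of them, with three or more the unaltered entries reveal \<open>i\<close>.\<close>

definition ideal_on :: "'a::comm_ring_1 set \<Rightarrow> 'a set \<Rightarrow> bool" where
  "ideal_on A K \<longleftrightarrow> 0 \<in> K \<and> (\<forall>f\<in>K. \<forall>g\<in>K. f + g \<in> K) \<and> (\<forall>a\<in>A. \<forall>f\<in>K. a * f \<in> K)"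

definition subring_on :: "'a::comm_ring_1 set \<Rightarrow> bool" where
  "subring_on A \<longleftrightarrow> 0 \<in> A \<and> 1 \<in> A \<and> (\<forall>f\<in>A. - f \<in> A) \<and>
     (\<forall>f\<in>A. \<forall>g\<in>A. f + g \<in> A) \<and> (\<forall>f\<in>A. \<forall>g\<in>A. f * g \<in> A)"

text \<open>That \<open>F\<close> generates \<open>I\<close> is encoded by a universal property:
  every \<open>A\<close>-submodule \<open>K\<close> of the ambient ring that contains
  \<open>F\<close> contains \<open>I\<close>. Applications pick a convenient \<open>K\<close> and
  check the generators only. For this, \<open>ideal_on\<close> leaves open whether \<open>K\<close>
  lies in \<open>A\<close>.\<close>

definition noetherian_on :: "'a::comm_ring_1 set \<Rightarrow> bool" where
  "noetherian_on A \<longleftrightarrow> (\<forall>I. ideal_on A I \<and> I \<subseteq> A \<longrightarrow>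
     (\<exists>F. finite F \<and> F \<subseteq> I \<and> (\<forall>K. ideal_on A K \<and> F \<subseteq> K \<longrightarrow> I \<subseteq> K)))"

text \<open>The image of \<open>A[X]\<close> under evaluation at \<open>x\<close>. Arguing with
  preimages \<open>p\<close> lets the degree argument run even when \<open>x\<close> satisfies
  relations over \<open>A\<close>.\<close>

definition adjoin :: "'a::comm_ring_1 set \<Rightarrow> 'a \<Rightarrow> 'a set" where
  "adjoin A x = {poly p x | p. \<forall>i. coeff p i \<in> A}"

lemma subring_on_sum:
  "subring_on A \<Longrightarrow> (\<And>i. i \<in> S \<Longrightarrow> f i \<in> A) \<Longrightarrow> sum f S \<in> A"
  by (induction S rule: infinite_finite_induct) (auto simp: subring_on_def)

text \<open>Degree at most \<open>d\<close> rather than equal to \<open>d\<close>: this admits the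
  coefficient 0 and makes the set closed under addition, hence an ideal of \<open>A\<close>.\<close>

definition leading_coeffs :: "'a::comm_ring_1 set \<Rightarrow> 'a \<Rightarrow> 'a set \<Rightarrow> nat \<Rightarrow> 'a set" where
  "leading_coeffs A x K d = {coeff q d | q. (\<forall>i. coeff q i \<in> A) \<and> poly q x \<in> K \<and> degree q \<le> d}"

lemma const_in_adjoin:
  assumes "subring_on A" "a \<in> A" shows "a \<in> adjoin A x"
proof -
  have "\<forall>i. coeff [:a:] i \<in> A" using assms
    by (auto simp: subring_on_def coeff_pCons split: nat.splits)
  then show ?thesis unfolding adjoin_def by (auto intro!: exI[of _ "[:a:]"])
qed

lemma power_in_adjoin:
  assumes "subring_on A" shows "x ^ e \<in> adjoin A x"
proof -
  have "\<forall>i. coeff (monom 1 e) i \<in> A" using assms by (auto simp: subring_on_def)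
  then show ?thesis unfolding adjoin_def by (auto intro!: exI[of _ "monom 1 e"] simp: poly_monom)
qed

lemma ideal_on_leading_coeffs:
  assumes A: "subring_on A" and K: "ideal_on (adjoin A x) K"
  shows "ideal_on A (leading_coeffs A x K d)"
  unfolding ideal_on_def
proof (intro conjI ballI)
  show "0 \<in> leading_coeffs A x K d"
    using A K unfolding leading_coeffs_def
    by (auto intro!: exI[of _ 0] simp: subring_on_def ideal_on_def)
next
  fix f g assume "f \<in> leading_coeffs A x K d" "g \<in> leading_coeffs A x K d"
  then obtain p q where
    p: "\<forall>i. coeff p i \<in> A" "poly p x \<in> K" "degree p \<le> d" "f = coeff p d" and
    q: "\<forall>i. coeff q i \<in> A" "poly q x \<in> K" "degree q \<le> d" "g = coeff q d"
    unfolding leading_coeffs_def by blast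
  show "f + g \<in> leading_coeffs A x K d"
    unfolding leading_coeffs_def
  proof (intro CollectI exI conjI)
    show "f + g = coeff (p + q) d" using p q by simp
    show "\<forall>i. coeff (p + q) i \<in> A" using p q A by (auto simp: subring_on_def)
    show "poly (p + q) x \<in> K" using p q K by (auto simp: ideal_on_def)
    show "degree (p + q) \<le> d" using p q by (simp add: degree_add_le)
  qed
next
  fix a f assume a: "a \<in> A" and "f \<in> leading_coeffs A x K d"
  then obtain p where
    p: "\<forall>i. coeff p i \<in> A" "poly p x \<in> K" "degree p \<le> d" "f = coeff p d"
    unfolding leading_coeffs_def by blast
  show "a * f \<in> leading_coeffs A x K d"
    unfolding leading_coeffs_def
  proof (intro CollectI exI conjI)
    show "a * f = coeff (smult a p) d" using p by simp
    show "\<forall>i. coeff (smult a p) i \<in> A" using p a A by (auto simp: subring_on_def)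
    show "poly (smult a p) x \<in> K"
      using p K const_in_adjoin[OF A a] by (auto simp: ideal_on_def)
    show "degree (smult a p) \<le> d" using p degree_smult_le le_trans by blast
  qed
qed

text \<open>Multiplication by \<open>X^(e - d)\<close> shifts the coefficient at \<open>d\<close> to
  \<open>e\<close>. The ascending chain obtained in this way becomes stationary over a Noetherian
  \<open>A\<close>.\<close>

lemma leading_coeffs_mono:
  assumes A: "subring_on A" and K: "ideal_on (adjoin A x) K" and "d \<le> e"
  shows "leading_coeffs A x K d \<subseteq> leading_coeffs A x K e"
proof
  fix f assume "f \<in> leading_coeffs A x K d"
  then obtain p where
    p: "\<forall>i. coeff p i \<in> A" "poly p x \<in> K" "degree p \<le> d" "f = coeff p d"
    unfolding leading_coeffs_def by blast
  let ?q = "monom 1 (e - d) * p"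
  show "f \<in> leading_coeffs A x K e"
    unfolding leading_coeffs_def
  proof (intro CollectI exI conjI)
    show "f = coeff ?q e" using p \<open>d \<le> e\<close> by (simp add: coeff_monom_mult)
    show "\<forall>i. coeff ?q i \<in> A" using p A by (auto simp: subring_on_def coeff_monom_mult)
    show "poly ?q x \<in> K"
      using p K power_in_adjoin[OF A, of x] by (auto simp: ideal_on_def poly_monom)
    have "degree ?q \<le> degree (monom (1::'a) (e - d)) + degree p" by (rule degree_mult_le)
    also have "\<dots> \<le> (e - d) + d" using p by (intro add_mono) (auto simp: degree_monom_le)
    finally show "degree ?q \<le> e" using \<open>d \<le> e\<close> by simp
  qed
qed

text \<open>The chain of leading-coefficient ideals is constant from some \<open>D\<close> on. Lifts
  of generators of the ideals below \<open>D\<close>, together with lifts of generators of the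
  limit, suffice to cancel any leading coefficient, so induction on the degree exhausts
  \<open>I\<close>.\<close>

theorem hilbert_basis:
  assumes A: "subring_on A" and N: "noetherian_on A"
  shows "noetherian_on (adjoin A x)"
  unfolding noetherian_on_def
proof (intro allI impI)
  fix I assume "ideal_on (adjoin A x) I \<and> I \<subseteq> adjoin A x"
  then have I: "ideal_on (adjoin A x) I" and IB: "I \<subseteq> adjoin A x" by auto
  let ?L = "leading_coeffs A x I"
  have L: "ideal_on A (?L d)" for d by (rule ideal_on_leading_coeffs[OF A I])
  have LA: "?L d \<subseteq> A" for d by (auto simp: leading_coeffs_def)
  have mono: "d \<le> e \<Longrightarrow> ?L d \<subseteq> ?L e" for d e by (rule leading_coeffs_mono[OF A I])
  have "ideal_on A (\<Union>d. ?L d)"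
    unfolding ideal_on_def
  proof (intro conjI ballI)
    show "0 \<in> (\<Union>d. ?L d)" using L[of 0] by (auto simp: ideal_on_def)
    fix f g assume "f \<in> (\<Union>d. ?L d)" "g \<in> (\<Union>d. ?L d)"
    then obtain d e where "f \<in> ?L d" "g \<in> ?L e" by auto
    then have "f \<in> ?L (max d e)" "g \<in> ?L (max d e)"
      using mono[of d "max d e"] mono[of e "max d e"] by auto
    then show "f + g \<in> (\<Union>d. ?L d)" using L[of "max d e"] by (auto simp: ideal_on_def)
  next
    fix a f assume "a \<in> A" "f \<in> (\<Union>d. ?L d)"
    then obtain d where "f \<in> ?L d" by auto
    then show "a * f \<in> (\<Union>d. ?L d)" using L[of d] \<open>a \<in> A\<close> unfolding ideal_on_def by blast
  qed
  moreover have "(\<Union>d. ?L d) \<subseteq> A" using LA by auto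
  ultimately obtain F where F: "finite F" "F \<subseteq> (\<Union>d. ?L d)"
      "\<And>K. ideal_on A K \<Longrightarrow> F \<subseteq> K \<Longrightarrow> (\<Union>d. ?L d) \<subseteq> K"
    using N unfolding noetherian_on_def by meson
  have "\<exists>D. F \<subseteq> ?L D" using F(1,2)
  proof (induction F rule: finite_induct)
    case (insert a F)
    then obtain D d where "F \<subseteq> ?L D" "a \<in> ?L d" by auto
    then have "insert a F \<subseteq> ?L (max D d)"
      using mono[of d "max D d"] mono[of D "max D d"] by auto
    then show ?case by blast
  qed auto
  then obtain D where D: "F \<subseteq> ?L D" by blast
  have "\<exists>G. finite G \<and> G \<subseteq> ?L d \<and> (\<forall>K. ideal_on A K \<and> G \<subseteq> K \<longrightarrow> ?L d \<subseteq> K)" for d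
    using N L[of d] LA[of d] unfolding noetherian_on_def by blast
  then obtain G where G: "\<And>d. finite (G d)" "\<And>d. G d \<subseteq> ?L d"
      "\<And>d K. ideal_on A K \<Longrightarrow> G d \<subseteq> K \<Longrightarrow> ?L d \<subseteq> K" by metis
  have "\<exists>q. (\<forall>i. coeff q i \<in> A) \<and> poly q x \<in> I \<and> degree q \<le> d \<and> coeff q d = a"
    if "a \<in> ?L d" for a d using that unfolding leading_coeffs_def by blast
  then obtain Q where Q: "\<And>a d. a \<in> ?L d \<Longrightarrow> (\<forall>i. coeff (Q a d) i \<in> A) \<and>
      poly (Q a d) x \<in> I \<and> degree (Q a d) \<le> d \<and> coeff (Q a d) d = a" by metis
  define H where "H = (\<lambda>a. poly (Q a D) x) ` F \<union> (\<Union>d<D. (\<lambda>a. poly (Q a d) x) ` G d)"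
  have "finite H" unfolding H_def using F G by auto
  moreover have "H \<subseteq> I" unfolding H_def using Q D G(2) by blast
  moreover have "I \<subseteq> K" if K: "ideal_on (adjoin A x) K" and HK: "H \<subseteq> K" for K
  proof -
    \<comment> \<open>Passing to \<open>K \<inter> I\<close> keeps the cancelling polynomial
      \<open>q\<close> inside \<open>I\<close>, so that the induction hypothesis applies to
      \<open>p - q\<close>.\<close>
    have KI: "ideal_on (adjoin A x) (K \<inter> I)" using K I by (auto simp: ideal_on_def)
    let ?M = "leading_coeffs A x (K \<inter> I)"
    have M: "ideal_on A (?M d)" for d by (rule ideal_on_leading_coeffs[OF A KI])
    have LM: "?L d \<subseteq> ?M d" for d
    proof (cases "d < D")
      case True
      have "a \<in> ?M d" if "a \<in> G d" for a
      proof -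
        have "a \<in> ?L d" using that G(2) by auto
        then have q: "(\<forall>i. coeff (Q a d) i \<in> A) \<and>
          poly (Q a d) x \<in> I \<and> degree (Q a d) \<le> d \<and> coeff (Q a d) d = a" by (rule Q)
        moreover have "poly (Q a d) x \<in> K" using that HK True unfolding H_def by blast
        ultimately show ?thesis unfolding leading_coeffs_def by force
      qed
      then show ?thesis using G(3)[OF M] by blast
    next
      case False
      have "a \<in> ?M D" if "a \<in> F" for a
      proof -
        have "a \<in> ?L D" using that D by auto
        then have q: "(\<forall>i. coeff (Q a D) i \<in> A) \<and>
          poly (Q a D) x \<in> I \<and> degree (Q a D) \<le> D \<and> coeff (Q a D) D = a" by (rule Q)
        moreover have "poly (Q a D) x \<in> K" using that HK unfolding H_def by blast
        ultimately show ?thesis unfolding leading_coeffs_def by force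
      qed
      then have "F \<subseteq> ?M d" using leading_coeffs_mono[OF A KI, of D d] False by auto
      then show ?thesis using F(3)[OF M] by blast
    qed
    \<comment> \<open>The bound is stated by vanishing coefficients because \<open>degree\<close>
      does not separate 0 from nonzero constants; here \<open>d = 0\<close> means the zero
      polynomial.\<close>
    have step: "poly p x \<in> K" if "\<forall>i. coeff p i \<in> A" "poly p x \<in> I" "\<And>i. i \<ge> d \<Longrightarrow> coeff p i = 0" for p d
      using that
    proof (induction d arbitrary: p)
      case 0
      then have "p = 0" by (simp add: poly_eqI)
      then show ?case using K by (simp add: ideal_on_def)
    next
      case (Suc d)
      have dp: "degree p \<le> d" using Suc.prems(3) by (intro degree_le) auto
      then have "coeff p d \<in> ?L d" using Suc.prems unfolding leading_coeffs_def by blast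
      then have "coeff p d \<in> ?M d" using LM by blast
      then obtain q where q: "\<forall>i. coeff q i \<in> A" "poly q x \<in> K \<inter> I" "degree q \<le> d" "coeff q d = coeff p d"
        unfolding leading_coeffs_def by force
      have m1: "- 1 \<in> adjoin A x" using A by (intro const_in_adjoin) (auto simp: subring_on_def)
      have "poly (p - q) x \<in> K"
      proof (rule Suc.IH)
        show "\<forall>i. coeff (p - q) i \<in> A" using A q Suc.prems
          unfolding subring_on_def coeff_diff by (metis add_uminus_conv_diff)
        have "- 1 * poly q x \<in> I" using q I m1 unfolding ideal_on_def by blast
        then have "poly p x + - 1 * poly q x \<in> I" using Suc.prems I unfolding ideal_on_def by blast
        then show "poly (p - q) x \<in> I" by simp
        show "coeff (p - q) i = 0" if "d \<le> i" for i
          using that q(3,4) dp coeff_eq_0[of p i] coeff_eq_0[of q i] by (cases "i = d") auto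
      qed
      then have "poly (p - q) x + poly q x \<in> K" using q K unfolding ideal_on_def by blast
      then show ?case by simp
    qed
    show ?thesis
    proof
      fix f assume "f \<in> I"
      then obtain p where p: "f = poly p x" "\<forall>i. coeff p i \<in> A" using IB by (auto simp: adjoin_def)
      show "f \<in> K" unfolding p(1)
        by (rule step[of _ "Suc (degree p)"]) (use p \<open>f \<in> I\<close> in \<open>auto intro: coeff_eq_0\<close>)
    qed
  qed
  ultimately show "\<exists>F. finite F \<and> F \<subseteq> I \<and> (\<forall>K. ideal_on (adjoin A x) K \<and> F \<subseteq> K \<longrightarrow> I \<subseteq> K)"
    by blast
qed

section \<open>The Noetherian ring of polynomial functions in finitely many variables\<close>

inductive_set pf :: "'i set \<Rightarrow> (('i \<Rightarrow> real) \<Rightarrow> real) set" for I where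
  pf_const: "(\<lambda>x. c) \<in> pf I"
| pf_coord: "i \<in> I \<Longrightarrow> (\<lambda>x. x i) \<in> pf I"
| pf_add: "f \<in> pf I \<Longrightarrow> g \<in> pf I \<Longrightarrow> (\<lambda>x. f x + g x) \<in> pf I"
| pf_mult: "f \<in> pf I \<Longrightarrow> g \<in> pf I \<Longrightarrow> (\<lambda>x. f x * g x) \<in> pf I"

lemma polyfun_eq_pf: "polyfun n = pf (idx n)"
proof (intro equalityI subsetI)
  fix f assume "f \<in> polyfun n" then show "f \<in> pf (idx n)"
    by induction (auto intro: pf.intros)
next
  fix f assume "f \<in> pf (idx n)" then show "f \<in> polyfun n"
    by induction (auto intro: polyfun.intros)
qed

lemma pf_uminus: "f \<in> pf I \<Longrightarrow> (\<lambda>x. - f x) \<in> pf I"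
  using pf_mult[OF pf_const[of "-1"], of f I] by simp

lemma pf_sum: "(\<And>s. s \<in> S \<Longrightarrow> f s \<in> pf I) \<Longrightarrow> (\<lambda>x. \<Sum>s\<in>S. f s x) \<in> pf I"
  by (induction S rule: infinite_finite_induct) (auto intro: pf_const pf_add)

lemma pf_prod: "(\<And>s. s \<in> S \<Longrightarrow> f s \<in> pf I) \<Longrightarrow> (\<lambda>x. \<Prod>s\<in>S. f s x) \<in> pf I"
  by (induction S rule: infinite_finite_induct) (auto intro: pf_const pf_mult)

lemma pf_power: "f \<in> pf I \<Longrightarrow> (\<lambda>x. f x ^ e) \<in> pf I"
  by (induction e) (auto intro: pf_const pf_mult)

lemma pf_mono: "f \<in> pf I \<Longrightarrow> I \<subseteq> I' \<Longrightarrow> f \<in> pf I'"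
  by (induction rule: pf.induct) (auto intro: pf.intros)

lemma pf_compose:
  assumes "f \<in> pf I" "\<And>i. i \<in> I \<Longrightarrow> (\<lambda>u. g u i) \<in> pf J"
  shows "(\<lambda>u. f (g u)) \<in> pf J"
  using assms(1) by induction (auto intro: pf.intros assms(2))

lemma pf_cong: "f \<in> pf I \<Longrightarrow> (\<And>i. i \<in> I \<Longrightarrow> x i = y i) \<Longrightarrow> f x = f y"
  by (induction rule: pf.induct) auto

lemma subring_on_pf: "subring_on (pf I)"
  unfolding subring_on_def zero_fun_def one_fun_def plus_fun_def times_fun_def fun_Compl_def
  by (auto intro: pf_const pf_add pf_mult pf_uminus)

text \<open>This lets Hilbert's theorem run one variable at a time. Functions carry the pointwise
  ring operations, so \<open>poly p\<close> evaluated at the new coordinate function is again a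
  function.\<close>

lemma pf_insert: "pf (insert i I) = adjoin (pf I) (\<lambda>x. x i)"
proof (intro equalityI subsetI)
  let ?A = "pf I" and ?X = "\<lambda>x. x i"
  have sub: "subring_on ?A" by (rule subring_on_pf)
  fix f :: "('a \<Rightarrow> real) \<Rightarrow> real" assume "f \<in> pf (insert i I)"
  then show "f \<in> adjoin ?A ?X"
  proof induction
    case (pf_const c) show ?case by (rule const_in_adjoin[OF sub pf.pf_const])
  next
    case (pf_coord j)
    show ?case
    proof (cases "j = i")
      case True then show ?thesis using power_in_adjoin[OF sub, of ?X 1] by simp
    next
      case False
      then show ?thesis using pf_coord by (intro const_in_adjoin[OF sub] pf.pf_coord) auto
    qed
  next
    case (pf_add f g)
    then obtain p q where p: "f = poly p ?X" "\<forall>i. coeff p i \<in> ?A"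
      and q: "g = poly q ?X" "\<forall>i. coeff q i \<in> ?A" unfolding adjoin_def by blast
    have "(\<lambda>x. f x + g x) = poly (p + q) ?X" by (simp add: p(1) q(1) plus_fun_def)
    moreover have "\<forall>i. coeff (p + q) i \<in> ?A" using sub p q by (auto simp: subring_on_def)
    ultimately show ?case unfolding adjoin_def by blast
  next
    case (pf_mult f g)
    then obtain p q where p: "f = poly p ?X" "\<forall>i. coeff p i \<in> ?A"
      and q: "g = poly q ?X" "\<forall>i. coeff q i \<in> ?A" unfolding adjoin_def by blast
    have "(\<lambda>x. f x * g x) = poly (p * q) ?X" by (simp add: p(1) q(1) times_fun_def)
    moreover have "coeff (p * q) j \<in> ?A" for j
      unfolding coeff_mult by (rule subring_on_sum[OF sub]) (use sub p q in \<open>auto simp: subring_on_def\<close>)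
    ultimately show ?case unfolding adjoin_def by blast
  qed
next
  fix f assume "f \<in> adjoin (pf I) (\<lambda>x. x i)"
  then obtain p where f: "f = poly p (\<lambda>x. x i)" and p: "\<forall>j. coeff p j \<in> pf I"
    unfolding adjoin_def by blast
  have s: "subring_on (pf (insert i I))" by (rule subring_on_pf)
  have X: "(\<lambda>x. x i) ^ j \<in> pf (insert i I)" for j
  proof (induction j)
    case 0 show ?case using pf_const[of 1] by simp
  next
    case (Suc j)
    have "(\<lambda>x. x i) \<in> pf (insert i I)" by (rule pf_coord) simp
    then show ?case using s Suc unfolding subring_on_def power_Suc by blast
  qed
  have "coeff p j \<in> pf (insert i I)" for j using p pf_mono[of "coeff p j" I "insert i I"] by auto
  then show "f \<in> pf (insert i I)" unfolding f poly_altdef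
    by (intro subring_on_sum[OF s]) (use s X in \<open>auto simp: subring_on_def\<close>)
qed

lemma pf_empty: "f \<in> pf {} \<Longrightarrow> \<exists>c. f = (\<lambda>x. c)"
  by (induction rule: pf.induct) auto

lemma noetherian_pf: "finite I \<Longrightarrow> noetherian_on (pf I)"
proof (induction I rule: finite_induct)
  case empty
  show ?case unfolding noetherian_on_def
  proof (intro allI impI)
    fix I :: "(('a \<Rightarrow> real) \<Rightarrow> real) set" assume I: "ideal_on (pf {}) I \<and> I \<subseteq> pf {}"
    show "\<exists>F. finite F \<and> F \<subseteq> I \<and> (\<forall>K. ideal_on (pf {}) K \<and> F \<subseteq> K \<longrightarrow> I \<subseteq> K)"
    \<comment> \<open>Without variables only constants remain, and these form a field: any nonzero
      element generates everything.\<close>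
    proof (cases "I \<subseteq> {0}")
      case True then show ?thesis by (intro exI[of _ "{}"]) (auto simp: ideal_on_def)
    next
      case False
      then obtain f where f: "f \<in> I" "f \<noteq> 0" by auto
      then obtain c where c: "f = (\<lambda>x. c)" using I pf_empty by blast
      have "c \<noteq> 0" using f c by (auto simp: zero_fun_def)
      have "I \<subseteq> K" if K: "ideal_on (pf {}) K" "{f} \<subseteq> K" for K
      proof
        fix g assume "g \<in> I"
        then obtain d where d: "g = (\<lambda>x. d)" using I pf_empty by blast
        have "(\<lambda>x. d / c) * f \<in> K" using K pf_const[of "d / c" "{}"] unfolding ideal_on_def by blast
        moreover have "(\<lambda>x. d / c) * f = g" using \<open>c \<noteq> 0\<close> by (simp add: c d times_fun_def)
        ultimately show "g \<in> K" by simp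
      qed
      then show ?thesis using f by (intro exI[of _ "{f}"]) auto
    qed
  qed
next
  case (insert i I)
  then show ?case unfolding pf_insert by (intro hilbert_basis subring_on_pf)
qed

section \<open>Gradients and linear algebra in coordinates\<close>

lemma finite_zeros_real_polynomial_function:
  fixes f :: "real \<Rightarrow> real"
  assumes "real_polynomial_function f" "f u \<noteq> 0"
  shows "finite {t. f t = 0}"
proof -
  obtain a n where f: "f = (\<lambda>x. \<Sum>i\<le>n. a i * x^i)"
    using assms(1) unfolding real_polynomial_function_iff_sum by blast
  have "\<not> (\<forall>i\<le>n. a i = 0)"
  proof
    assume "\<forall>i\<le>n. a i = 0"
    then have "f u = 0" unfolding f by (intro sum.neutral) auto
    then show False using assms(2) by simp
  qed
  then show ?thesis unfolding f using polyfun_finite_roots[of a n] by auto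
qed

lemma real_polynomial_function_pf:
  fixes g :: "real \<Rightarrow> 'i \<Rightarrow> real"
  assumes "f \<in> pf I" "\<And>i. i \<in> I \<Longrightarrow> real_polynomial_function (\<lambda>t. g t i)"
  shows "real_polynomial_function (\<lambda>t. f (g t))"
  using assms(1) by induction (auto intro: assms(2))

lemma real_polynomial_function_line: "real_polynomial_function (\<lambda>t::real. a + t * b)"
  by (intro real_polynomial_function.intros(3) real_polynomial_function.intros(4) real_polynomial_function.intros(2)
      real_polynomial_function.intros(1) bounded_linear_ident)

text \<open>On the line joining \<open>x\<close> to \<open>y\<close> both factors become univariate
  polynomials that are not identically zero, so all but finitely many points of the line
  serve.\<close>

lemma pf_mult_nonzero:
  assumes "f \<in> pf I" "g \<in> pf I" "f x \<noteq> 0" "g y \<noteq> 0"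
  shows "\<exists>z. f z * g z \<noteq> 0"
proof -
  let ?l = "\<lambda>t i. x i + t * (y i - x i)"
  have l: "real_polynomial_function (\<lambda>t. ?l t i)" for i by (rule real_polynomial_function_line)
  have "finite {t. f (?l t) = 0}"
    by (rule finite_zeros_real_polynomial_function[OF real_polynomial_function_pf[OF assms(1) l], where u = 0])
      (use assms in simp)
  moreover have "finite {t. g (?l t) = 0}"
    by (rule finite_zeros_real_polynomial_function[OF real_polynomial_function_pf[OF assms(2) l], where u = 1])
      (use assms in simp)
  ultimately have "finite ({t. f (?l t) = 0} \<union> {t. g (?l t) = 0})" by simp
  then obtain t :: real where "t \<notin> {t. f (?l t) = 0} \<union> {t. g (?l t) = 0}"
    using ex_new_if_finite infinite_UNIV_char_0 by blast
  then show ?thesis by (intro exI[of _ "?l t"]) auto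
qed

lemma pf_prod_nonzero:
  assumes "finite S" "\<And>s. s \<in> S \<Longrightarrow> f s \<in> pf I" "\<And>s. s \<in> S \<Longrightarrow> \<exists>x. f s x \<noteq> 0"
  shows "\<exists>x. (\<Prod>s\<in>S. f s x) \<noteq> 0"
  using assms
proof (induction S rule: finite_induct)
  case (insert a S)
  then obtain x y where "f a x \<noteq> 0" "(\<Prod>s\<in>S. f s y) \<noteq> 0" by blast
  then have "\<exists>z. f a z * (\<Prod>s\<in>S. f s z) \<noteq> 0"
    by (intro pf_mult_nonzero[of _ I _ x y] pf_prod) (use insert in auto)
  then show ?case using insert by simp
qed auto

text \<open>The sum and product rules follow the inductive construction of \<open>f\<close>. That
  the partial derivatives lie in \<open>pf I\<close> again permits composing them later with
  polynomial charts and paths.\<close>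

lemma pf_has_gradient:
  assumes "finite I" "f \<in> pf I"
  shows "\<exists>g. (\<forall>i\<in>I. g i \<in> pf I) \<and>
    (\<forall>y v. ((\<lambda>t. f (\<lambda>i. y i + t * v i)) has_real_derivative (\<Sum>i\<in>I. g i y * v i)) (at 0))"
  using assms(2)
proof induction
  case (pf_const c)
  show ?case by (intro exI[of _ "\<lambda>_ _. 0"]) (auto intro: pf.pf_const)
next
  case (pf_coord j)
  have "((\<lambda>t. y j + t * v j) has_real_derivative (\<Sum>i\<in>I. (if i = j then 1 else 0) * v i)) (at 0)" for y v
  proof -
    have "(\<Sum>i\<in>I. (if i = j then 1 else 0) * v i) = (\<Sum>i\<in>I. if i = j then v i else 0)"
      by (rule sum.cong) auto
    also have "\<dots> = v j" using assms(1) pf_coord by simp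
    finally show ?thesis by (auto intro!: derivative_eq_intros)
  qed
  then show ?case by (intro exI[of _ "\<lambda>i _. if i = j then 1 else 0"]) (auto intro: pf.pf_const)
next
  case (pf_add f1 f2)
  then obtain g1 g2 where g: "\<forall>i\<in>I. g1 i \<in> pf I" "\<forall>i\<in>I. g2 i \<in> pf I"
    "\<forall>y v. ((\<lambda>t. f1 (\<lambda>i. y i + t * v i)) has_real_derivative (\<Sum>i\<in>I. g1 i y * v i)) (at 0)"
    "\<forall>y v. ((\<lambda>t. f2 (\<lambda>i. y i + t * v i)) has_real_derivative (\<Sum>i\<in>I. g2 i y * v i)) (at 0)"
    by blast
  have "((\<lambda>t. f1 (\<lambda>i. y i + t * v i) + f2 (\<lambda>i. y i + t * v i)) has_real_derivative
      (\<Sum>i\<in>I. (g1 i y + g2 i y) * v i)) (at 0)" for y v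
    using DERIV_add[OF g(3)[rule_format, of y v] g(4)[rule_format, of y v]]
    by (simp add: distrib_right sum.distrib)
  then show ?case using g(1,2)
    by (intro exI[of _ "\<lambda>i y. g1 i y + g2 i y"]) (auto intro: pf.pf_add)
next
  case (pf_mult f1 f2)
  then obtain g1 g2 where g: "\<forall>i\<in>I. g1 i \<in> pf I" "\<forall>i\<in>I. g2 i \<in> pf I"
    "\<forall>y v. ((\<lambda>t. f1 (\<lambda>i. y i + t * v i)) has_real_derivative (\<Sum>i\<in>I. g1 i y * v i)) (at 0)"
    "\<forall>y v. ((\<lambda>t. f2 (\<lambda>i. y i + t * v i)) has_real_derivative (\<Sum>i\<in>I. g2 i y * v i)) (at 0)"
    by blast
  have "((\<lambda>t. f1 (\<lambda>i. y i + t * v i) * f2 (\<lambda>i. y i + t * v i)) has_real_derivative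
      (\<Sum>i\<in>I. (g1 i y * f2 y + f1 y * g2 i y) * v i)) (at 0)" for y v
  proof -
    have "(\<Sum>i\<in>I. g1 i y * v i) * f2 y + (\<Sum>i\<in>I. g2 i y * v i) * f1 y =
        (\<Sum>i\<in>I. (g1 i y * f2 y + f1 y * g2 i y) * v i)"
      by (simp add: distrib_left sum.distrib sum_distrib_left mult_ac)
    then show ?thesis
      using DERIV_mult[OF g(3)[rule_format, of y v] g(4)[rule_format, of y v]] by simp
  qed
  then show ?case using g(1,2) pf_mult(1,2)
    by (intro exI[of _ "\<lambda>i y. g1 i y * f2 y + f1 y * g2 i y"] conjI ballI pf.pf_add pf.pf_mult) auto
qed

text \<open>A member of \<open>pf I\<close> is a bare function without a distinguished expression,
  so its partial derivatives are obtained by choice from the existence lemma.\<close>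

definition grad :: "'i set \<Rightarrow> (('i \<Rightarrow> real) \<Rightarrow> real) \<Rightarrow> 'i \<Rightarrow> ('i \<Rightarrow> real) \<Rightarrow> real" where
  "grad I f = (SOME g. (\<forall>i\<in>I. g i \<in> pf I) \<and>
    (\<forall>y v. ((\<lambda>t. f (\<lambda>i. y i + t * v i)) has_real_derivative (\<Sum>i\<in>I. g i y * v i)) (at 0)))"

lemma grad_in_pf: "finite I \<Longrightarrow> f \<in> pf I \<Longrightarrow> i \<in> I \<Longrightarrow> grad I f i \<in> pf I"
  and has_derivative_grad: "finite I \<Longrightarrow> f \<in> pf I \<Longrightarrow>
    ((\<lambda>t. f (\<lambda>i. y i + t * v i)) has_real_derivative (\<Sum>i\<in>I. grad I f i y * v i)) (at 0)"
  using someI_ex[OF pf_has_gradient[of I f]] unfolding grad_def[symmetric] by auto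

section \<open>Linear algebra over finite index sets: independence, generic rank, projection\<close>

lemma nontrivial_solution:
  fixes G :: "'j \<Rightarrow> 'i \<Rightarrow> real"
  assumes "finite I" "finite J" "card I < card J"
  shows "\<exists>c. (\<exists>j\<in>J. c j \<noteq> 0) \<and> (\<forall>i\<in>I. (\<Sum>j\<in>J. c j * G j i) = 0)"
  using assms
proof (induction I arbitrary: J G rule: finite_induct)
  case empty
  then have "J \<noteq> {}" by auto
  then show ?case by (intro exI[of _ "\<lambda>_. 1"]) auto
next
  case (insert a I)
  show ?case
  proof (cases "\<forall>j\<in>J. G j a = 0")
    case True
    have "card I < card J" using insert by simp
    from insert.IH[OF \<open>finite J\<close> this, of G] obtain c where
      c: "\<exists>j\<in>J. c j \<noteq> 0" "\<forall>i\<in>I. (\<Sum>j\<in>J. c j * G j i) = 0" by blast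
    then show ?thesis using True by (intro exI[of _ c]) auto
  next
    case False
    \<comment> \<open>Gaussian elimination: the pivot \<open>j0\<close> clears equation
      \<open>a\<close> from the remaining unknowns. Its own coefficient is then forced by that
      equation and restored in \<open>?c\<close>.\<close>
    then obtain j0 where j0: "j0 \<in> J" "G j0 a \<noteq> 0" by auto
    let ?J = "J - {j0}"
    have "card I < card ?J" using insert j0 by (simp add: card_Diff_singleton)
    from insert.IH[OF _ this, of "\<lambda>j i. G j i - G j a / G j0 a * G j0 i"] \<open>finite J\<close>
    obtain c where c: "\<exists>j\<in>?J. c j \<noteq> 0"
      "\<forall>i\<in>I. (\<Sum>j\<in>?J. c j * (G j i - G j a / G j0 a * G j0 i)) = 0" by auto
    let ?s = "\<Sum>j\<in>?J. c j * G j a"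
    let ?c = "c(j0 := - ?s / G j0 a)"
    have split: "(\<Sum>j\<in>J. ?c j * G j i) = - ?s / G j0 a * G j0 i + (\<Sum>j\<in>?J. c j * G j i)" for i
    proof -
      have "(\<Sum>j\<in>J. ?c j * G j i) = ?c j0 * G j0 i + (\<Sum>j\<in>?J. ?c j * G j i)"
        using \<open>finite J\<close> j0 by (simp add: sum.remove)
      also have "(\<Sum>j\<in>?J. ?c j * G j i) = (\<Sum>j\<in>?J. c j * G j i)" by (rule sum.cong) auto
      finally show ?thesis by simp
    qed
    have "(\<Sum>j\<in>J. ?c j * G j i) = 0" if "i \<in> I" for i
    proof -
      have "(\<Sum>j\<in>?J. c j * G j i) - ?s / G j0 a * G j0 i = (\<Sum>j\<in>?J. c j * (G j i - G j a / G j0 a * G j0 i))"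
        by (simp add: right_diff_distrib sum_subtractf sum_divide_distrib sum_distrib_right mult.assoc)
      also have "\<dots> = 0" using c that by auto
      finally show ?thesis unfolding split by simp
    qed
    moreover have "(\<Sum>j\<in>J. ?c j * G j a) = 0" unfolding split using j0 by simp
    moreover have "\<exists>j\<in>J. ?c j \<noteq> 0" using c(1) by auto
    ultimately show ?thesis by (intro exI[of _ ?c]) auto
  qed
qed

text \<open>A family indexed by \<open>J\<close> rather than a set of vectors, so that two
  polynomials with equal gradients count as dependent.\<close>

definition indep_on :: "'i set \<Rightarrow> 'j set \<Rightarrow> ('j \<Rightarrow> 'i \<Rightarrow> real) \<Rightarrow> bool" where
  "indep_on I J G \<longleftrightarrow> (\<forall>c. (\<forall>i\<in>I. (\<Sum>j\<in>J. c j * G j i) = 0) \<longrightarrow> (\<forall>j\<in>J. c j = 0))"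

lemma indep_on_card_le:
  assumes "finite I" "finite J" "indep_on I J G" shows "card J \<le> card I"
  using nontrivial_solution[OF assms(1,2), of G] assms(3) unfolding indep_on_def by fastforce

text \<open>If a combination \<open>g\<close> of the \<open>G j\<close> and a combination
  \<open>v\<close> of the \<open>V k\<close> add up to 0, orthogonality gives
  \<open>|g|^2 = 0\<close>. The joint family on \<open>J <+> K\<close> is therefore
  independent.\<close>

lemma orthogonal_indep_card_le:
  assumes fin: "finite I" "finite J" "finite K"
    and G: "indep_on I J G" and V: "indep_on I K V"
    and orth: "\<And>j k. j \<in> J \<Longrightarrow> k \<in> K \<Longrightarrow> (\<Sum>i\<in>I. G j i * V k i) = 0"
  shows "card J + card K \<le> card I"
proof -
  have "indep_on I (J <+> K) (case_sum G V)"
    unfolding indep_on_def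
  proof (intro allI impI)
    fix c assume c: "\<forall>i\<in>I. (\<Sum>j\<in>J <+> K. c j * case_sum G V j i) = 0"
    define g where "g i = (\<Sum>j\<in>J. c (Inl j) * G j i)" for i
    define v where "v i = (\<Sum>k\<in>K. c (Inr k) * V k i)" for i
    have gv: "g i + v i = 0" if "i \<in> I" for i
      using c that fin by (simp add: sum.Plus g_def v_def)
    have "(\<Sum>i\<in>I. g i * v i) = (\<Sum>i\<in>I. \<Sum>j\<in>J. \<Sum>k\<in>K. c (Inl j) * c (Inr k) * (G j i * V k i))"
      unfolding g_def v_def sum_product by (simp add: mult_ac)
    also have "\<dots> = (\<Sum>j\<in>J. \<Sum>k\<in>K. \<Sum>i\<in>I. c (Inl j) * c (Inr k) * (G j i * V k i))"
      by (simp add: sum.swap[of _ I])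
    also have "\<dots> = 0" using orth by (simp add: sum_distrib_left[symmetric])
    finally have "(\<Sum>i\<in>I. g i * v i) = 0" .
    moreover have "(\<Sum>i\<in>I. g i * v i) = - (\<Sum>i\<in>I. g i * g i)"
    proof -
      have "g i * v i = - (g i * g i)" if "i \<in> I" for i
      proof -
        have "v i = - g i" using gv[OF that] by linarith
        then show ?thesis by simp
      qed
      then show ?thesis by (simp add: sum_negf)
    qed
    ultimately have "(\<Sum>i\<in>I. g i * g i) = 0" by simp
    then have g0: "\<forall>i\<in>I. g i = 0" using fin by (simp add: sum_nonneg_eq_0_iff)
    then have v0: "\<forall>i\<in>I. v i = 0" using gv by fastforce
    have "\<forall>j\<in>J. c (Inl j) = 0"
      using G[unfolded indep_on_def, rule_format, of "\<lambda>j. c (Inl j)"] g0 unfolding g_def by simp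
    moreover have "\<forall>k\<in>K. c (Inr k) = 0"
      using V[unfolded indep_on_def, rule_format, of "\<lambda>k. c (Inr k)"] v0 unfolding v_def by simp
    ultimately show "\<forall>j\<in>J <+> K. c j = 0" by auto
  qed
  then have "card (J <+> K) \<le> card I" using fin by (intro indep_on_card_le) auto
  then show ?thesis using fin by (simp add: card_Plus)
qed

text \<open>Elimination with a pivot that depends on \<open>t\<close>. Cross-multiplying instead of
  dividing keeps \<open>W\<close> polynomial, and independence can fail only where it fails for
  \<open>W\<close> or where the pivot vanishes.\<close>

lemma indep_on_cofinite:
  fixes V :: "real \<Rightarrow> 'j \<Rightarrow> 'i \<Rightarrow> real"
  assumes "finite J" "\<And>j i. j \<in> J \<Longrightarrow> i \<in> I \<Longrightarrow> real_polynomial_function (\<lambda>t. V t j i)"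
    and "indep_on I J (V t0)"
  shows "finite {t. \<not> indep_on I J (V t)}"
  using assms
proof (induction J arbitrary: V rule: finite_induct)
  case empty then show ?case by (simp add: indep_on_def)
next
  case (insert a J)
  have "\<exists>i\<in>I. V t0 a i \<noteq> 0"
  proof (rule ccontr)
    assume "\<not> ?thesis"
    then have "\<forall>i\<in>I. (\<Sum>j\<in>insert a J. (if j = a then 1 else 0) * V t0 j i) = 0"
      using insert by (intro ballI sum.neutral) auto
    then show False using insert(5) unfolding indep_on_def by fastforce
  qed
  then obtain b where b: "b \<in> I" "V t0 a b \<noteq> 0" by auto
  define W where "W t j i = V t a b * V t j i - V t j b * V t a i" for t j i
  have comb: "(\<Sum>j\<in>J. c j * W t j i) = V t a b * (\<Sum>j\<in>J. c j * V t j i) - (\<Sum>j\<in>J. c j * V t j b) * V t a i" for t c i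
    unfolding W_def by (simp add: sum_subtractf right_diff_distrib sum_distrib_left sum_distrib_right mult_ac)
  have "indep_on I J (W t0)" unfolding indep_on_def
  proof (intro allI impI)
    fix c assume c: "\<forall>i\<in>I. (\<Sum>j\<in>J. c j * W t0 j i) = 0"
    \<comment> \<open>\<open>d\<close> undoes the elimination: it turns a relation among the
      \<open>W t0 j\<close> into one among the \<open>V t0 j\<close>.\<close>
    define d where "d j = (if j = a then - (\<Sum>j\<in>J. c j * V t0 j b) else V t0 a b * c j)" for j
    have "(\<Sum>j\<in>insert a J. d j * V t0 j i) = 0" if "i \<in> I" for i
    proof -
      have "(\<Sum>j\<in>J. d j * V t0 j i) = (\<Sum>j\<in>J. V t0 a b * (c j * V t0 j i))"
        using insert by (intro sum.cong) (auto simp: d_def)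
      then have "(\<Sum>j\<in>insert a J. d j * V t0 j i) = (\<Sum>j\<in>J. c j * W t0 j i)"
        using insert unfolding comb by (simp add: d_def sum_distrib_left)
      then show ?thesis using c that by simp
    qed
    then have "\<forall>j\<in>insert a J. d j = 0" using insert(5) unfolding indep_on_def by blast
    then show "\<forall>j\<in>J. c j = 0" using b insert by (auto simp: d_def split: if_splits)
  qed
  moreover have "real_polynomial_function (\<lambda>t. W t j i)" if "j \<in> J" "i \<in> I" for j i
    unfolding W_def using that b insert
    by (intro real_polynomial_function_diff real_polynomial_function.intros(4) insert.prems(1)) auto
  ultimately have f1: "finite {t. \<not> indep_on I J (W t)}" by (intro insert.IH) auto
  have f2: "finite {t. V t a b = 0}"
    using insert.prems(1)[of a b] b by (intro finite_zeros_real_polynomial_function[where u = t0]) auto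
  have "indep_on I (insert a J) (V t)" if t: "indep_on I J (W t)" "V t a b \<noteq> 0" for t
    unfolding indep_on_def
  proof (intro allI impI)
    fix c assume c: "\<forall>i\<in>I. (\<Sum>j\<in>insert a J. c j * V t j i) = 0"
    have s: "(\<Sum>j\<in>J. c j * V t j i) = - c a * V t a i" if "i \<in> I" for i
      using c that insert by (simp add: add_eq_0_iff2)
    have "\<forall>i\<in>I. (\<Sum>j\<in>J. c j * W t j i) = 0"
      unfolding comb using s b by simp
    then have z: "\<forall>j\<in>J. c j = 0" using t(1) unfolding indep_on_def by blast
    then have "c a * V t a b = 0" using s[OF b(1)] by simp
    then show "\<forall>j\<in>insert a J. c j = 0" using z t by simp
  qed
  then have "{t. \<not> indep_on I (insert a J) (V t)} \<subseteq> {t. \<not> indep_on I J (W t)} \<union> {t. V t a b = 0}"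
    by blast
  then show ?case using f1 f2 by (meson finite_UnI finite_subset)
qed

lemma maximal_indep_subset:
  assumes "finite J"
  shows "\<exists>J'\<subseteq>J. indep_on I J' G \<and> (\<forall>j\<in>J. \<exists>c. \<forall>i\<in>I. G j i = (\<Sum>k\<in>J'. c k * G k i))"
proof -
  let ?P = "\<lambda>K. K \<subseteq> J \<and> indep_on I K G"
  have "?P {}" by (simp add: indep_on_def)
  moreover have "\<forall>K. ?P K \<longrightarrow> card K < Suc (card J)"
    using assms by (simp add: card_mono le_imp_less_Suc)
  ultimately obtain K where K: "?P K" "\<And>K'. ?P K' \<Longrightarrow> card K' \<le> card K"
    using ex_has_greatest_nat[of ?P "{}" card] by (metis less_imp_le)
  have finK: "finite K" using K assms finite_subset by blast
  have "\<exists>c. \<forall>i\<in>I. G j i = (\<Sum>k\<in>K. c k * G k i)" if j: "j \<in> J" for j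
  proof (cases "j \<in> K")
    case True
    have "(\<Sum>k\<in>K. (if k = j then 1 else 0) * G k i) = G j i" for i
    proof -
      have "(\<Sum>k\<in>K. (if k = j then 1 else 0) * G k i) = (\<Sum>k\<in>K. if k = j then G k i else 0)"
        by (rule sum.cong) auto
      then show ?thesis using True finK by simp
    qed
    then show ?thesis by (intro exI[of _ "\<lambda>k. if k = j then 1 else 0"]) simp
  next
    case False
    then have "card (insert j K) > card K" using finK by simp
    then have "\<not> ?P (insert j K)" using K(2)[of "insert j K"] by auto
    then have "\<not> indep_on I (insert j K) G" using K j by auto
    then obtain c where c: "\<forall>i\<in>I. (\<Sum>k\<in>insert j K. c k * G k i) = 0" "\<exists>k\<in>insert j K. c k \<noteq> 0"
      unfolding indep_on_def by blast
    have c1: "c j * G j i + (\<Sum>k\<in>K. c k * G k i) = 0" if "i \<in> I" for i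
      using c(1) that finK False by simp
    have "c j \<noteq> 0"
    proof
      assume "c j = 0"
      then have "\<forall>i\<in>I. (\<Sum>k\<in>K. c k * G k i) = 0" using c1 by simp
      then have "\<forall>k\<in>K. c k = 0" using K unfolding indep_on_def by blast
      then show False using c(2) \<open>c j = 0\<close> by auto
    qed
    have "G j i = (\<Sum>k\<in>K. (- c k / c j) * G k i)" if "i \<in> I" for i
    proof -
      have "(\<Sum>k\<in>K. (- c k / c j) * G k i) = - (\<Sum>k\<in>K. c k * G k i) / c j"
        by (simp add: sum_negf sum_divide_distrib)
      also have "\<dots> = G j i" using c1[OF that] \<open>c j \<noteq> 0\<close> by (simp add: field_simps eq_neg_iff_add_eq_0)
      finally show ?thesis by simp
    qed
    then show ?thesis by (intro exI[of _ "\<lambda>k. - c k / c j"]) simp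
  qed
  then show ?thesis using K(1) by blast
qed

text \<open>Gram-Schmidt without normalisation. The induction hypothesis is used for
  \<open>x\<close> and for the new vector \<open>G a\<close>; the residual \<open>h\<close> of the
  latter is the only new direction along which \<open>x\<close> has to be corrected.\<close>

lemma orthogonal_projection_exists:
  fixes G :: "'j \<Rightarrow> 'i \<Rightarrow> real"
  assumes "finite I" "finite J"
  shows "\<exists>c. \<forall>k\<in>J. (\<Sum>i\<in>I. (x i - (\<Sum>j\<in>J. c j * G j i)) * G k i) = 0"
  using assms(2)
proof (induction J arbitrary: x rule: finite_induct)
  case (insert a J)
  obtain d where d: "\<forall>k\<in>J. (\<Sum>i\<in>I. (G a i - (\<Sum>j\<in>J. d j * G j i)) * G k i) = 0"
    using insert.IH by blast
  obtain c where c: "\<forall>k\<in>J. (\<Sum>i\<in>I. (x i - (\<Sum>j\<in>J. c j * G j i)) * G k i) = 0"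
    using insert.IH by blast
  define h where "h i = G a i - (\<Sum>j\<in>J. d j * G j i)" for i
  define v where "v i = x i - (\<Sum>j\<in>J. c j * G j i)" for i
  \<comment> \<open>If \<open>h\<close> is 0 on \<open>I\<close>, the convention on division makes
    \<open>e = 0\<close>; this is harmless, since then every product with \<open>h\<close>
    vanishes.\<close>
  define e where "e = (\<Sum>i\<in>I. v i * h i) / (\<Sum>i\<in>I. h i * h i)"
  have hk: "(\<Sum>i\<in>I. h i * G k i) = 0" and vk: "(\<Sum>i\<in>I. v i * G k i) = 0" if "k \<in> J" for k
    using c d that by (auto simp: h_def v_def)
  define c' where "c' j = (if j = a then e else c j - e * d j)" for j
  have r: "x i - (\<Sum>j\<in>insert a J. c' j * G j i) = v i - e * h i" for i
  proof -
    have "(\<Sum>j\<in>J. c' j * G j i) = (\<Sum>j\<in>J. (c j - e * d j) * G j i)"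
      using insert by (intro sum.cong) (auto simp: c'_def)
    then show ?thesis using insert
      by (simp add: c'_def v_def h_def left_diff_distrib right_diff_distrib sum_subtractf sum_distrib_left mult.assoc)
  qed
  have eh: "(\<Sum>i\<in>I. (v i - e * h i) * h i) = 0"
  proof (cases "(\<Sum>i\<in>I. h i * h i) = 0")
    case True
    then have "\<forall>i\<in>I. h i = 0" using assms by (simp add: sum_nonneg_eq_0_iff)
    then show ?thesis by simp
  next
    case False
    have "(\<Sum>i\<in>I. (v i - e * h i) * h i) = (\<Sum>i\<in>I. v i * h i) - e * (\<Sum>i\<in>I. h i * h i)"
      by (simp add: left_diff_distrib sum_subtractf sum_distrib_left mult.assoc)
    also have "\<dots> = 0" using False by (simp add: e_def)
    finally show ?thesis .
  qed
  have ek: "(\<Sum>i\<in>I. (v i - e * h i) * G k i) = 0" if "k \<in> J" for k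
    using hk[OF that] vk[OF that]
    by (simp add: left_diff_distrib sum_subtractf sum_distrib_left[symmetric] mult.assoc)
  have "(\<Sum>i\<in>I. (v i - e * h i) * G a i) = 0"
  proof -
    have "G a i = h i + (\<Sum>j\<in>J. d j * G j i)" for i by (simp add: h_def)
    then have "(\<Sum>i\<in>I. (v i - e * h i) * G a i) =
        (\<Sum>i\<in>I. (v i - e * h i) * h i) + (\<Sum>i\<in>I. \<Sum>j\<in>J. d j * ((v i - e * h i) * G j i))"
      by (simp add: distrib_left sum.distrib sum_distrib_left mult_ac)
    also have "(\<Sum>i\<in>I. \<Sum>j\<in>J. d j * ((v i - e * h i) * G j i)) = (\<Sum>j\<in>J. d j * (\<Sum>i\<in>I. (v i - e * h i) * G j i))"
      by (subst sum.swap) (simp add: sum_distrib_left)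
    also have "\<dots> = 0" using ek by simp
    finally show ?thesis using eh by simp
  qed
  then show ?case using ek r by (intro exI[of _ c']) auto
qed auto

text \<open>The double orthogonal complement of a span is the span: the residual of projecting
  \<open>x\<close> is orthogonal to the span, hence by hypothesis to \<open>x\<close>, hence to
  itself.\<close>

lemma in_span_if_orthogonal:
  fixes G :: "'j \<Rightarrow> 'i \<Rightarrow> real"
  assumes "finite I" "finite J"
    and orth: "\<And>v. (\<And>i. i \<notin> I \<Longrightarrow> v i = 0) \<Longrightarrow> (\<And>j. j \<in> J \<Longrightarrow> (\<Sum>i\<in>I. G j i * v i) = 0)
        \<Longrightarrow> (\<Sum>i\<in>I. v i * x i) = 0"
  shows "\<exists>c. \<forall>i\<in>I. x i = (\<Sum>j\<in>J. c j * G j i)"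
proof -
  obtain c where c: "\<forall>k\<in>J. (\<Sum>i\<in>I. (x i - (\<Sum>j\<in>J. c j * G j i)) * G k i) = 0"
    using orthogonal_projection_exists[OF assms(1,2)] by blast
  \<comment> \<open>Cut off outside \<open>I\<close> because the hypothesis speaks only of vectors
    supported in \<open>I\<close>, the shape of elements of \<open>tspace\<close>.\<close>
  define v where "v i = (if i \<in> I then x i - (\<Sum>j\<in>J. c j * G j i) else 0)" for i
  have o: "(\<Sum>i\<in>I. G k i * v i) = 0" if "k \<in> J" for k
  proof -
    have "(\<Sum>i\<in>I. G k i * v i) = (\<Sum>i\<in>I. (x i - (\<Sum>j\<in>J. c j * G j i)) * G k i)"
      by (rule sum.cong) (auto simp: v_def)
    then show ?thesis using c that by simp
  qed
  have vx: "(\<Sum>i\<in>I. v i * x i) = 0" by (rule orth[OF _ o]) (auto simp: v_def)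
  have "(\<Sum>i\<in>I. v i * v i) = (\<Sum>i\<in>I. v i * x i) - (\<Sum>i\<in>I. \<Sum>j\<in>J. c j * (G j i * v i))"
    unfolding sum_subtractf[symmetric]
  proof (rule sum.cong[OF refl])
    fix i assume "i \<in> I"
    then have "v i * v i = v i * (x i - (\<Sum>j\<in>J. c j * G j i))" by (simp add: v_def)
    then show "v i * v i = v i * x i - (\<Sum>j\<in>J. c j * (G j i * v i))"
      by (simp add: right_diff_distrib sum_distrib_left mult_ac)
  qed
  also have "(\<Sum>i\<in>I. \<Sum>j\<in>J. c j * (G j i * v i)) = (\<Sum>j\<in>J. c j * (\<Sum>i\<in>I. G j i * v i))"
    by (subst sum.swap) (simp add: sum_distrib_left)
  also have "\<dots> = 0" using o by simp
  finally have "(\<Sum>i\<in>I. v i * v i) = 0" using vx by simp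
  then have "\<forall>i\<in>I. v i = 0" using assms by (simp add: sum_nonneg_eq_0_iff)
  then show ?thesis by (intro exI[of _ c]) (auto simp: v_def)
qed

section \<open>Algebraic dependence and polynomial covers\<close>

definition expbox :: "'j set \<Rightarrow> nat \<Rightarrow> ('j \<Rightarrow> nat) set" where
  "expbox J d = (\<Pi>\<^sub>E j\<in>J. {..d})"

text \<open>The degree is bounded in each variable separately, so the exponents form a box.
  Extensionality of the exponents in \<open>expbox\<close> makes their number exactly
  \<open>(d + 1)^card J\<close>.\<close>

definition boxpoly :: "'j set \<Rightarrow> nat \<Rightarrow> (('j \<Rightarrow> real) \<Rightarrow> real) set" where
  "boxpoly J d = {f. \<exists>c. f = (\<lambda>u. \<Sum>\<alpha>\<in>expbox J d. c \<alpha> * (\<Prod>j\<in>J. u j ^ \<alpha> j))}"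

lemma finite_expbox: "finite J \<Longrightarrow> finite (expbox J d)"
  unfolding expbox_def by (intro finite_PiE) auto

lemma card_expbox: "finite J \<Longrightarrow> card (expbox J d) = Suc d ^ card J"
  unfolding expbox_def by (simp add: card_PiE)

lemma boxpoly_add:
  assumes "f \<in> boxpoly J d" "g \<in> boxpoly J d" shows "(\<lambda>u. f u + g u) \<in> boxpoly J d"
proof -
  obtain b c where "f = (\<lambda>u. \<Sum>\<alpha>\<in>expbox J d. b \<alpha> * (\<Prod>j\<in>J. u j ^ \<alpha> j))"
    "g = (\<lambda>u. \<Sum>\<alpha>\<in>expbox J d. c \<alpha> * (\<Prod>j\<in>J. u j ^ \<alpha> j))"
    using assms unfolding boxpoly_def by blast
  then show ?thesis unfolding boxpoly_def
    by (intro CollectI exI[of _ "\<lambda>\<alpha>. b \<alpha> + c \<alpha>"]) (simp add: distrib_right sum.distrib)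
qed

lemma boxpoly_zero: "(\<lambda>u. 0) \<in> boxpoly J d"
  unfolding boxpoly_def by (intro CollectI exI[of _ "\<lambda>_. 0"]) simp

lemma boxpoly_sum:
  "(\<And>s. s \<in> S \<Longrightarrow> f s \<in> boxpoly J d) \<Longrightarrow> (\<lambda>u. \<Sum>s\<in>S. f s u) \<in> boxpoly J d"
  by (induction S rule: infinite_finite_induct) (auto intro: boxpoly_zero boxpoly_add)

lemma boxpoly_monomial:
  assumes "finite J" "\<And>j. j \<in> J \<Longrightarrow> \<alpha> j \<le> d"
  shows "(\<lambda>u. c * (\<Prod>j\<in>J. u j ^ \<alpha> j)) \<in> boxpoly J d"
proof -
  let ?\<alpha> = "restrict \<alpha> J"
  have mem: "?\<alpha> \<in> expbox J d" using assms(2) by (auto simp: expbox_def)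
  have "(\<Sum>\<beta>\<in>expbox J d. (if \<beta> = ?\<alpha> then c else 0) * (\<Prod>j\<in>J. u j ^ \<beta> j)) = c * (\<Prod>j\<in>J. u j ^ \<alpha> j)" for u :: "'a \<Rightarrow> real"
  proof -
    have "(\<Sum>\<beta>\<in>expbox J d. (if \<beta> = ?\<alpha> then c else 0) * (\<Prod>j\<in>J. u j ^ \<beta> j)) =
        (\<Sum>\<beta>\<in>expbox J d. if \<beta> = ?\<alpha> then c * (\<Prod>j\<in>J. u j ^ \<beta> j) else 0)"
      by (rule sum.cong) auto
    also have "\<dots> = c * (\<Prod>j\<in>J. u j ^ ?\<alpha> j)"
      using mem finite_expbox[OF assms(1)] by simp
    also have "(\<Prod>j\<in>J. u j ^ ?\<alpha> j) = (\<Prod>j\<in>J. u j ^ \<alpha> j)" by (rule prod.cong) auto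
    finally show ?thesis .
  qed
  then show ?thesis unfolding boxpoly_def
    by (intro CollectI exI[of _ "\<lambda>\<beta>. if \<beta> = ?\<alpha> then c else 0"]) simp
qed

lemma boxpoly_mono:
  assumes "finite J" "d \<le> d'" "f \<in> boxpoly J d" shows "f \<in> boxpoly J d'"
proof -
  obtain c where c: "f = (\<lambda>u. \<Sum>\<alpha>\<in>expbox J d. c \<alpha> * (\<Prod>j\<in>J. u j ^ \<alpha> j))"
    using assms unfolding boxpoly_def by blast
  show ?thesis unfolding c
    by (intro boxpoly_sum boxpoly_monomial assms(1)) (use assms(2) in \<open>force simp: expbox_def PiE_iff\<close>)
qed

lemma boxpoly_mult:
  assumes J: "finite J" and "f \<in> boxpoly J d" "g \<in> boxpoly J d'"
  shows "(\<lambda>u. f u * g u) \<in> boxpoly J (d + d')"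
proof -
  obtain b c where bc: "f = (\<lambda>u. \<Sum>\<alpha>\<in>expbox J d. b \<alpha> * (\<Prod>j\<in>J. u j ^ \<alpha> j))"
    "g = (\<lambda>u. \<Sum>\<alpha>\<in>expbox J d'. c \<alpha> * (\<Prod>j\<in>J. u j ^ \<alpha> j))"
    using assms unfolding boxpoly_def by blast
  have eq: "(\<lambda>u. f u * g u) = (\<lambda>u. \<Sum>\<alpha>\<in>expbox J d. \<Sum>\<beta>\<in>expbox J d'. (b \<alpha> * c \<beta>) * (\<Prod>j\<in>J. u j ^ (\<alpha> j + \<beta> j)))"
    unfolding bc sum_product by (simp add: power_add prod.distrib mult_ac)
  show ?thesis unfolding eq
    by (intro boxpoly_sum boxpoly_monomial J) (force simp: expbox_def PiE_iff intro: add_mono)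
qed

lemma boxpoly_const: "finite J \<Longrightarrow> (\<lambda>u. c) \<in> boxpoly J d"
  using boxpoly_monomial[of J "\<lambda>_. 0" d c] by simp

lemma boxpoly_power:
  "finite J \<Longrightarrow> f \<in> boxpoly J d \<Longrightarrow> (\<lambda>u. f u ^ e) \<in> boxpoly J (e * d)"
  by (induction e) (auto intro: boxpoly_const boxpoly_mult)

lemma boxpoly_prod:
  assumes "finite J" "finite S" "\<And>s. s \<in> S \<Longrightarrow> f s \<in> boxpoly J (d s)"
  shows "(\<lambda>u. \<Prod>s\<in>S. f s u) \<in> boxpoly J (\<Sum>s\<in>S. d s)"
  using assms(2,3) by (induction S rule: finite_induct) (auto intro: boxpoly_const boxpoly_mult assms(1))

lemma pf_in_boxpoly:
  assumes J: "finite J" and "f \<in> pf J" shows "\<exists>d. f \<in> boxpoly J d"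
  using assms(2)
proof induction
  case (pf_const c) show ?case using boxpoly_const[OF J] by blast
next
  case (pf_coord i)
  have "(\<Prod>j\<in>J. u j ^ (if j = i then 1 else 0)) = u i" for u :: "'a \<Rightarrow> real"
  proof -
    have "(\<Prod>j\<in>J. u j ^ (if j = i then 1 else 0)) = (\<Prod>j\<in>J. if j = i then u j else 1)"
      by (rule prod.cong) auto
    then show ?thesis using J pf_coord by simp
  qed
  then show ?case using boxpoly_monomial[OF J, of "\<lambda>j. if j = i then 1 else 0" 1 1]
    by (intro exI[of _ 1]) auto
next
  case (pf_add f g)
  then obtain d d' where "f \<in> boxpoly J d" "g \<in> boxpoly J d'" by blast
  then have "f \<in> boxpoly J (max d d')" "g \<in> boxpoly J (max d d')"
    using boxpoly_mono[OF J] by (meson max.cobounded1 max.cobounded2)+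
  then show ?case using boxpoly_add by blast
next
  case (pf_mult f g) then show ?case using boxpoly_mult[OF J] by blast
qed

text \<open>With the other variables frozen, the sum is a univariate polynomial in
  \<open>x a\<close> that vanishes everywhere; its coefficients are sums of the same shape in fewer
  variables.\<close>

lemma monomials_independent:
  assumes "finite I" "\<And>x. (\<Sum>\<beta>\<in>expbox I D. c \<beta> * (\<Prod>i\<in>I. x i ^ \<beta> i)) = (0::real)" "\<beta> \<in> expbox I D"
  shows "c \<beta> = 0"
  using assms
proof (induction I arbitrary: c \<beta> rule: finite_induct)
  case empty
  then show ?case by (simp add: expbox_def)
next
  case (insert a I)
  let ?h = "\<lambda>(y, g). g(a := y)"
  have expbox: "expbox (insert a I) D = ?h ` ({..D} \<times> expbox I D)"
    unfolding expbox_def by (rule PiE_insert_eq)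
  have inj: "inj_on ?h ({..D} \<times> expbox I D)"
    unfolding expbox_def by (rule inj_combinator[OF insert.hyps(2)])
  have expand: "(\<Sum>y\<le>D. (\<Sum>g\<in>expbox I D. c (g(a := y)) * (\<Prod>i\<in>I. x i ^ g i)) * t ^ y) = 0"
    for x :: "'a \<Rightarrow> real" and t
  proof -
    have "0 = (\<Sum>\<beta>\<in>expbox (insert a I) D. c \<beta> * (\<Prod>i\<in>insert a I. (x(a := t)) i ^ \<beta> i))"
      using insert.prems(1) by simp
    also have "\<dots> = (\<Sum>(y,g)\<in>{..D} \<times> expbox I D. c (g(a := y)) * (\<Prod>i\<in>insert a I. (x(a := t)) i ^ (g(a := y)) i))"
      unfolding expbox by (subst sum.reindex[OF inj]) (auto intro: sum.cong)
    also have "\<dots> = (\<Sum>(y,g)\<in>{..D} \<times> expbox I D. c (g(a := y)) * (\<Prod>i\<in>I. x i ^ g i) * t ^ y)"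
    proof (rule sum.cong[OF refl])
      fix p assume "p \<in> {..D} \<times> expbox I D"
      obtain y g where p: "p = (y, g)" by (cases p)
      have "(\<Prod>i\<in>I. (x(a := t)) i ^ (g(a := y)) i) = (\<Prod>i\<in>I. x i ^ g i)"
        using insert by (intro prod.cong) auto
      then show "(case p of (y, g) \<Rightarrow> c (g(a := y)) * (\<Prod>i\<in>insert a I. (x(a := t)) i ^ (g(a := y)) i)) =
          (case p of (y, g) \<Rightarrow> c (g(a := y)) * (\<Prod>i\<in>I. x i ^ g i) * t ^ y)"
        using insert unfolding p by simp
    qed
    also have "\<dots> = (\<Sum>y\<le>D. \<Sum>g\<in>expbox I D. c (g(a := y)) * (\<Prod>i\<in>I. x i ^ g i) * t ^ y)"
      by (simp add: sum.cartesian_product)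
    finally show ?thesis by (simp add: sum_distrib_right)
  qed
  obtain y g where yg: "y \<le> D" "g \<in> expbox I D" "\<beta> = g(a := y)" using insert.prems(2) expbox by auto
  have "(\<Sum>g\<in>expbox I D. c (g(a := y)) * (\<Prod>i\<in>I. x i ^ g i)) = 0" for x :: "'a \<Rightarrow> real"
    using expand[of x] polyfun_eq_0[of "\<lambda>y. (\<Sum>g\<in>expbox I D. c (g(a := y)) * (\<Prod>i\<in>I. x i ^ g i))" D] yg by blast
  then show ?case unfolding yg(3) using insert.IH[of "\<lambda>g. c (g(a := y))" g] yg(2) by blast
qed

text \<open>Pigeonhole on monomials. Those with exponents up to \<open>D\<close> number
  \<open>(D + 1)^card I\<close>, but after substituting \<open>\<psi>\<close> they lie in a space
  whose dimension grows only like \<open>D^card J\<close>. For large \<open>D\<close> some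
  nontrivial combination becomes zero.\<close>

theorem algebraic_dependence:
  fixes \<psi> :: "('j \<Rightarrow> real) \<Rightarrow> 'i \<Rightarrow> real"
  assumes I: "finite I" and J: "finite J" and less: "card J < card I"
    and \<psi>: "\<And>i. i \<in> I \<Longrightarrow> (\<lambda>u. \<psi> u i) \<in> pf J"
  shows "\<exists>F\<in>pf I. (\<exists>x. F x \<noteq> 0) \<and> (\<forall>u. F (\<psi> u) = 0)"
proof -
  have "\<forall>i\<in>I. \<exists>d. (\<lambda>u. \<psi> u i) \<in> boxpoly J d" using pf_in_boxpoly[OF J \<psi>] by blast
  then obtain d0 where d0: "\<And>i. i \<in> I \<Longrightarrow> (\<lambda>u. \<psi> u i) \<in> boxpoly J (d0 i)" by metis
  define d where "d = (\<Sum>i\<in>I. d0 i)"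
  have d: "(\<lambda>u. \<psi> u i) \<in> boxpoly J d" if "i \<in> I" for i
    using boxpoly_mono[OF J _ d0[OF that]] that I unfolding d_def by (simp add: member_le_sum)
  define N where "N = card I"
  \<comment> \<open>Chosen so that \<open>(E + 1)^card J \<le> ((d * N + 1) * (D + 1))^card J = D *
    (D + 1)^card J\<close>, which is less than \<open>(D + 1)^card I\<close>.\<close>
  define D where "D = Suc (d * N) ^ card J"
  define E where "E = N * (D * d)"
  have "\<exists>c. (\<lambda>u. \<Prod>i\<in>I. \<psi> u i ^ \<beta> i) = (\<lambda>u. \<Sum>\<alpha>\<in>expbox J E. c \<alpha> * (\<Prod>j\<in>J. u j ^ \<alpha> j))"
    if "\<beta> \<in> expbox I D" for \<beta>
  proof -
    have 1: "(\<lambda>u. \<Prod>i\<in>I. \<psi> u i ^ \<beta> i) \<in> boxpoly J (\<Sum>i\<in>I. \<beta> i * d)"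
      by (intro boxpoly_prod boxpoly_power I J d)
    have "(\<Sum>i\<in>I. \<beta> i * d) \<le> (\<Sum>i\<in>I. D * d)"
      using that by (intro sum_mono mult_right_mono) (auto simp: expbox_def PiE_iff)
    then have 2: "(\<Sum>i\<in>I. \<beta> i * d) \<le> E" unfolding E_def N_def by simp
    show ?thesis using boxpoly_mono[OF J 2 1] unfolding boxpoly_def by blast
  qed
  then have "\<forall>\<beta>\<in>expbox I D. \<exists>c. (\<lambda>u. \<Prod>i\<in>I. \<psi> u i ^ \<beta> i) =
      (\<lambda>u. \<Sum>\<alpha>\<in>expbox J E. c \<alpha> * (\<Prod>j\<in>J. u j ^ \<alpha> j))" by blast
  from bchoice[OF this] obtain C where C: "\<And>\<beta>. \<beta> \<in> expbox I D \<Longrightarrow>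
      (\<lambda>u. \<Prod>i\<in>I. \<psi> u i ^ \<beta> i) = (\<lambda>u. \<Sum>\<alpha>\<in>expbox J E. C \<beta> \<alpha> * (\<Prod>j\<in>J. u j ^ \<alpha> j))" by blast
  have "card (expbox J E) < card (expbox I D)"
  proof -
    have "Suc E \<le> Suc (d * N) * Suc D" unfolding E_def by (simp add: algebra_simps)
    then have "Suc E ^ card J \<le> (Suc (d * N) * Suc D) ^ card J" by (rule power_mono) simp
    also have "\<dots> = D * Suc D ^ card J" by (subst power_mult_distrib) (simp only: D_def)
    also have "\<dots> < Suc D ^ Suc (card J)" by simp
    also have "\<dots> \<le> Suc D ^ card I" using less by (intro power_increasing) auto
    finally show ?thesis using I J by (simp add: card_expbox)
  qed
  then obtain c where c: "\<exists>\<beta>\<in>expbox I D. c \<beta> \<noteq> 0" "\<forall>\<alpha>\<in>expbox J E. (\<Sum>\<beta>\<in>expbox I D. c \<beta> * C \<beta> \<alpha>) = 0"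
    using nontrivial_solution[OF finite_expbox[OF J] finite_expbox[OF I]] by blast
  define F where "F x = (\<Sum>\<beta>\<in>expbox I D. c \<beta> * (\<Prod>i\<in>I. x i ^ \<beta> i))" for x :: "'i \<Rightarrow> real"
  have "F \<in> pf I" unfolding F_def by (intro pf_sum pf_mult pf_const pf_prod pf_power pf_coord)
  moreover have "\<exists>x. F x \<noteq> 0" using monomials_independent[OF I, of c D] c(1) unfolding F_def by blast
  moreover have "F (\<psi> u) = 0" for u
  proof -
    have "F (\<psi> u) = (\<Sum>\<beta>\<in>expbox I D. c \<beta> * (\<Sum>\<alpha>\<in>expbox J E. C \<beta> \<alpha> * (\<Prod>j\<in>J. u j ^ \<alpha> j)))"
      unfolding F_def using fun_cong[OF C] by (intro sum.cong refl) simp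
    also have "\<dots> = (\<Sum>\<alpha>\<in>expbox J E. (\<Sum>\<beta>\<in>expbox I D. c \<beta> * C \<beta> \<alpha>) * (\<Prod>j\<in>J. u j ^ \<alpha> j))"
      unfolding sum_distrib_left sum_distrib_right by (subst sum.swap) (simp add: mult.assoc)
    also have "\<dots> = 0" using c(2) by simp
    finally show ?thesis .
  qed
  ultimately show ?thesis by blast
qed

section \<open>Sets covered by finitely many polynomial images of a coordinate space\<close>

definition poly_cover :: "nat \<Rightarrow> ('i \<Rightarrow> real) set \<Rightarrow> bool" where
  "poly_cover e S \<longleftrightarrow> (\<exists>\<Psi>. finite \<Psi> \<and> (\<forall>\<psi>\<in>\<Psi>. \<forall>i. (\<lambda>u. \<psi> u i) \<in> pf {..<e}) \<and> S \<subseteq> (\<Union>\<psi>\<in>\<Psi>. range \<psi>))"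

lemma poly_cover_mono:
  assumes "poly_cover e S" "e \<le> e'" "S' \<subseteq> S" shows "poly_cover e' S'"
proof -
  obtain \<Psi> where P: "finite \<Psi>" "\<And>\<psi> i. \<psi> \<in> \<Psi> \<Longrightarrow> (\<lambda>u. \<psi> u i) \<in> pf {..<e}" "S \<subseteq> (\<Union>\<psi>\<in>\<Psi>. range \<psi>)"
    using assms unfolding poly_cover_def by blast
  have "(\<lambda>u. \<psi> u i) \<in> pf {..<e'}" if "\<psi> \<in> \<Psi>" for \<psi> i
    using pf_mono[OF P(2)[OF that]] assms(2) by (meson lessThan_subset_iff)
  then show ?thesis unfolding poly_cover_def using P assms(3) by (intro exI[of _ \<Psi>]) blast
qed

lemma poly_cover_image:
  assumes "poly_cover e S" "\<And>j. (\<lambda>x. G x j) \<in> pf UNIV" shows "poly_cover e (G ` S)"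
proof -
  obtain \<Psi> where P: "finite \<Psi>" "\<And>\<psi> i. \<psi> \<in> \<Psi> \<Longrightarrow> (\<lambda>u. \<psi> u i) \<in> pf {..<e}" "S \<subseteq> (\<Union>\<psi>\<in>\<Psi>. range \<psi>)"
    using assms unfolding poly_cover_def by blast
  show ?thesis unfolding poly_cover_def
  proof (intro exI[of _ "(\<lambda>\<psi> u. G (\<psi> u)) ` \<Psi>"] conjI ballI allI)
    show "finite ((\<lambda>\<psi> u. G (\<psi> u)) ` \<Psi>)" using P(1) by simp
    fix \<phi> j assume "\<phi> \<in> (\<lambda>\<psi> u. G (\<psi> u)) ` \<Psi>"
    then obtain \<psi> where \<psi>: "\<psi> \<in> \<Psi>" "\<phi> = (\<lambda>u. G (\<psi> u))" by auto
    show "(\<lambda>u. \<phi> u j) \<in> pf {..<e}" unfolding \<psi>(2)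
      by (rule pf_compose[OF assms(2)]) (rule P(2)[OF \<psi>(1)])
  next
    show "G ` S \<subseteq> (\<Union>\<psi>\<in>(\<lambda>\<psi> u. G (\<psi> u)) ` \<Psi>. range \<psi>)"
    proof
      fix y assume "y \<in> G ` S"
      then obtain x where x: "x \<in> S" "y = G x" by blast
      then obtain \<psi> u where "\<psi> \<in> \<Psi>" "x = \<psi> u" using P(3) by blast
      then show "y \<in> (\<Union>\<psi>\<in>(\<lambda>\<psi> u. G (\<psi> u)) ` \<Psi>. range \<psi>)" using x(2) by blast
    qed
  qed
qed

lemma poly_cover_UN:
  assumes "finite X" "\<And>x. x \<in> X \<Longrightarrow> poly_cover e (S x)" shows "poly_cover e (\<Union>x\<in>X. S x)"
proof -
  have "\<forall>x\<in>X. \<exists>\<Psi>. finite \<Psi> \<and> (\<forall>\<psi>\<in>\<Psi>. \<forall>i. (\<lambda>u. \<psi> u i) \<in> pf {..<e}) \<and> S x \<subseteq> (\<Union>\<psi>\<in>\<Psi>. range \<psi>)"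
    using assms unfolding poly_cover_def by blast
  from bchoice[OF this] obtain \<Psi> where P: "\<forall>x\<in>X. finite (\<Psi> x) \<and> (\<forall>\<psi>\<in>\<Psi> x. \<forall>i. (\<lambda>u. \<psi> u i) \<in> pf {..<e}) \<and> S x \<subseteq> (\<Union>\<psi>\<in>\<Psi> x. range \<psi>)"
    by blast
  show ?thesis unfolding poly_cover_def
  proof (intro exI[of _ "\<Union>x\<in>X. \<Psi> x"] conjI ballI allI)
    show "finite (\<Union>x\<in>X. \<Psi> x)" using assms(1) P by simp
    show "(\<lambda>u. \<psi> u i) \<in> pf {..<e}" if "\<psi> \<in> (\<Union>x\<in>X. \<Psi> x)" for \<psi> i using that P by auto
    show "(\<Union>x\<in>X. S x) \<subseteq> (\<Union>\<psi>\<in>(\<Union>x\<in>X. \<Psi> x). range \<psi>)"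
    proof
      fix y assume "y \<in> (\<Union>x\<in>X. S x)"
      then obtain x where x: "x \<in> X" "y \<in> S x" by blast
      then obtain \<psi> u where "\<psi> \<in> \<Psi> x" "y = \<psi> u" using P by blast
      then show "y \<in> (\<Union>\<psi>\<in>(\<Union>x\<in>X. \<Psi> x). range \<psi>)" using x(1) by blast
    qed
  qed
qed

lemma poly_cover_Un: "poly_cover e S \<Longrightarrow> poly_cover e S' \<Longrightarrow> poly_cover e (S \<union> S')"
  using poly_cover_UN[of "{True, False}" e "\<lambda>b. if b then S else S'"] by (simp add: Un_commute)

lemma poly_cover_coordinates: "poly_cover q {x :: nat \<Rightarrow> real. \<forall>i\<ge>q. x i = 0}"
  unfolding poly_cover_def
proof (intro exI[of _ "{\<lambda>u i. if i < q then u i else 0}"] conjI ballI allI)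
  fix \<psi> i assume "\<psi> \<in> {\<lambda>u i. if i < q then u i else (0::real)}"
  then show "(\<lambda>u. \<psi> u i) \<in> pf {..<q}" by (cases "i < q") (auto intro: pf_const pf_coord)
next
  show "{x. \<forall>i\<ge>q. x i = 0} \<subseteq> (\<Union>\<psi>\<in>{\<lambda>u i. if i < q then u i else (0::real)}. range \<psi>)"
  proof
    fix x assume "x \<in> {x :: nat \<Rightarrow> real. \<forall>i\<ge>q. x i = 0}"
    then have "x = (\<lambda>i. if i < q then x i else 0)" by auto
    then show "x \<in> (\<Union>\<psi>\<in>{\<lambda>u i. if i < q then u i else (0::real)}. range \<psi>)" by blast
  qed
qed simp

text \<open>Both charts read one parameter sequence, the second one shifted by \<open>e1\<close>.
  The common parameter type \<open>nat \<Rightarrow> real\<close> for all dimensions makes this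
  possible.\<close>

lemma poly_cover_prod:
  fixes S1 :: "('i \<Rightarrow> real) set" and S2 :: "('j \<Rightarrow> real) set"
  assumes "poly_cover e1 S1" "poly_cover e2 S2"
  shows "poly_cover (e1 + e2) {z :: 'i + 'j \<Rightarrow> real. (\<lambda>i. z (Inl i)) \<in> S1 \<and> (\<lambda>j. z (Inr j)) \<in> S2}"
proof -
  obtain P1 where P1: "finite P1" "\<And>\<psi> i. \<psi> \<in> P1 \<Longrightarrow> (\<lambda>u. \<psi> u i) \<in> pf {..<e1}" "S1 \<subseteq> (\<Union>\<psi>\<in>P1. range \<psi>)"
    using assms(1) unfolding poly_cover_def by blast
  obtain P2 where P2: "finite P2" "\<And>\<psi> i. \<psi> \<in> P2 \<Longrightarrow> (\<lambda>u. \<psi> u i) \<in> pf {..<e2}" "S2 \<subseteq> (\<Union>\<psi>\<in>P2. range \<psi>)"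
    using assms(2) unfolding poly_cover_def by blast
  define G where "G = (\<lambda>(\<psi>1, \<psi>2) (u :: nat \<Rightarrow> real). case_sum (\<psi>1 u :: 'i \<Rightarrow> real) (\<psi>2 (\<lambda>k. u (k + e1)) :: 'j \<Rightarrow> real))"
  show ?thesis unfolding poly_cover_def
  proof (intro exI[of _ "G ` (P1 \<times> P2)"] conjI ballI allI)
    show "finite (G ` (P1 \<times> P2))" using P1 P2 by simp
    fix \<psi> i assume "\<psi> \<in> G ` (P1 \<times> P2)"
    then obtain \<psi>1 \<psi>2 where p: "\<psi>1 \<in> P1" "\<psi>2 \<in> P2" "\<psi> = G (\<psi>1, \<psi>2)" by auto
    show "(\<lambda>u. \<psi> u i) \<in> pf {..<e1 + e2}"
    proof (cases i)
      case (Inl a)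
      have "(\<lambda>u. \<psi>1 u a) \<in> pf {..<e1 + e2}" by (rule pf_mono[OF P1(2)[OF p(1)]]) auto
      then show ?thesis by (simp add: p(3) G_def Inl)
    next
      case (Inr b)
      have "(\<lambda>u. \<psi>2 (\<lambda>k. u (k + e1)) b) \<in> pf {..<e1 + e2}"
        by (rule pf_compose[OF P2(2)[OF p(2)]]) (auto intro: pf_coord)
      then show ?thesis by (simp add: p(3) G_def Inr)
    qed
  next
    show "{z. (\<lambda>i. z (Inl i)) \<in> S1 \<and> (\<lambda>j. z (Inr j)) \<in> S2} \<subseteq> (\<Union>\<psi>\<in>G ` (P1 \<times> P2). range \<psi>)"
    proof clarify
      fix z :: "'i + 'j \<Rightarrow> real" assume "(\<lambda>i. z (Inl i)) \<in> S1" "(\<lambda>j. z (Inr j)) \<in> S2"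
      then obtain \<psi>1 u1 \<psi>2 u2 where z: "\<psi>1 \<in> P1" "(\<lambda>i. z (Inl i)) = \<psi>1 u1" "\<psi>2 \<in> P2" "(\<lambda>j. z (Inr j)) = \<psi>2 u2"
        using P1(3) P2(3) by blast
      define u where "u k = (if k < e1 then u1 k else u2 (k - e1))" for k
      have "\<psi>1 u i = \<psi>1 u1 i" for i
        by (rule pf_cong[OF P1(2)[OF z(1)]]) (simp add: u_def)
      moreover have "(\<lambda>k. u (k + e1)) = u2" by (simp add: u_def)
      ultimately have "z = G (\<psi>1, \<psi>2) u"
        using z(2,4) unfolding G_def by (auto simp: fun_eq_iff split: sum.splits)
      then show "z \<in> (\<Union>\<psi>\<in>G ` (P1 \<times> P2). range \<psi>)" using z by blast
    qed
  qed
qed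

lemma poly_cover_singleton: "poly_cover 0 {x}"
  unfolding poly_cover_def by (intro exI[of _ "{\<lambda>u. x}"]) (auto intro: pf_const)

text \<open>Coordinates outside \<open>X\<close> are fixed to 0 so that the empty product is a
  single point, covered with no parameters.\<close>

lemma poly_cover_family:
  fixes S :: "'x \<Rightarrow> ('i \<Rightarrow> real) set"
  assumes "finite X" "\<And>x. x \<in> X \<Longrightarrow> poly_cover (e x) (S x)"
  shows "poly_cover (\<Sum>x\<in>X. e x)
    {z :: 'x \<times> 'i \<Rightarrow> real. (\<forall>x\<in>X. (\<lambda>i. z (x, i)) \<in> S x) \<and> (\<forall>x i. x \<notin> X \<longrightarrow> z (x, i) = 0)}"
  using assms
proof (induction X rule: finite_induct)
  case empty
  have "{z :: 'x \<times> 'i \<Rightarrow> real. (\<forall>x\<in>{}. (\<lambda>i. z (x, i)) \<in> S x) \<and> (\<forall>x i. x \<notin> {} \<longrightarrow> z (x, i) = 0)} \<subseteq> {\<lambda>_. 0}"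
    by auto
  then show ?case using poly_cover_mono[OF poly_cover_singleton, of 0] by simp
next
  case (insert a X)
  let ?S = "\<lambda>X. {z :: 'x \<times> 'i \<Rightarrow> real. (\<forall>x\<in>X. (\<lambda>i. z (x, i)) \<in> S x) \<and> (\<forall>x i. x \<notin> X \<longrightarrow> z (x, i) = 0)}"
  define G where "G w = (\<lambda>(x, i). if x = a then w (Inl i) else w (Inr (x, i)))" for w :: "'i + 'x \<times> 'i \<Rightarrow> real"
  let ?Q = "{z :: 'i + 'x \<times> 'i \<Rightarrow> real. (\<lambda>i. z (Inl i)) \<in> S a \<and> (\<lambda>j. z (Inr j)) \<in> ?S X}"
  have "poly_cover (e a + (\<Sum>x\<in>X. e x)) ?Q" using insert by (intro poly_cover_prod) auto
  moreover have "(\<lambda>w. G w j) \<in> pf UNIV" for j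
    by (cases j; cases "fst j = a") (auto simp: G_def intro: pf_coord)
  ultimately have "poly_cover (e a + (\<Sum>x\<in>X. e x)) (G ` ?Q)" by (rule poly_cover_image)
  moreover have "?S (insert a X) \<subseteq> G ` ?Q"
  proof
    fix z assume z: "z \<in> ?S (insert a X)"
    define w where "w = case_sum (\<lambda>i. z (a, i)) (\<lambda>(x, i). if x = a then 0 else z (x, i))"
    have "z = G w" by (auto simp: G_def w_def fun_eq_iff)
    moreover have "w \<in> ?Q"
    proof -
      have "(\<lambda>i. w (Inr (x, i))) = (\<lambda>i. z (x, i))" if "x \<in> X" for x
        using that insert by (auto simp: w_def)
      then show ?thesis using z insert by (auto simp: w_def)
    qed
    ultimately show "z \<in> G ` ?Q" by blast
  qed
  ultimately have "poly_cover (e a + (\<Sum>x\<in>X. e x)) (?S (insert a X))" using poly_cover_mono by blast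
  then show ?case using insert by simp
qed

text \<open>For each chart and each small \<open>F'\<close> the points \<open>T\<close> form a
  polynomial image in \<open>e + card F'\<close> parameters, fewer than \<open>card I\<close>, and
  satisfy an equation by \<open>algebraic_dependence\<close>. There are finitely many such pairs, so
  the product of their equations serves all of them.\<close>

theorem normal_family_in_hypersurface:
  fixes B :: "('i \<Rightarrow> real) set"
  assumes I: "finite I" and F: "finite F" "F \<subseteq> pf I" and B: "poly_cover e B"
  shows "\<exists>P\<in>pf I. (\<exists>x. P x \<noteq> 0) \<and> (\<forall>y\<in>B. \<forall>F'\<subseteq>F. \<forall>c T. card F' + e < card I \<longrightarrow>
    (\<forall>i\<in>I. T i = y i + (\<Sum>f\<in>F'. c f * grad I f i y)) \<longrightarrow> P T = 0)"
proof -
  obtain \<Psi> where P: "finite \<Psi>" "\<And>\<psi> i. \<psi> \<in> \<Psi> \<Longrightarrow> (\<lambda>u. \<psi> u i) \<in> pf {..<e}" "B \<subseteq> (\<Union>\<psi>\<in>\<Psi>. range \<psi>)"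
    using B unfolding poly_cover_def by blast
  let ?X = "\<Psi> \<times> {F'. F' \<subseteq> F \<and> card F' + e < card I}"
  have "\<exists>Q\<in>pf I. (\<exists>x. Q x \<noteq> 0) \<and> (\<forall>u c T. (\<forall>i\<in>I. T i = \<psi> u i + (\<Sum>f\<in>F'. c f * grad I f i (\<psi> u))) \<longrightarrow> Q T = 0)"
    if \<psi>: "\<psi> \<in> \<Psi>" and F': "F' \<subseteq> F" "card F' + e < card I" for \<psi> F'
  proof -
    have fin: "finite F'" using F F' finite_subset by blast
    obtain h where h: "bij_betw h F' {0..<card F'}" using ex_bij_betw_finite_nat[OF fin] by blast
    \<comment> \<open>Parameters below \<open>e\<close> feed the chart; those from \<open>e\<close>
      on are the coefficients of the gradients, numbered by \<open>h\<close>.\<close>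
    define \<phi> where "\<phi> u i = \<psi> u i + (\<Sum>f\<in>F'. u (e + h f) * grad I f i (\<psi> u))" for u i
    have "(\<lambda>u. \<phi> u i) \<in> pf {..<e + card F'}" if "i \<in> I" for i
      unfolding \<phi>_def
    proof (intro pf_add pf_sum pf_mult)
      show "(\<lambda>u. \<psi> u i) \<in> pf {..<e + card F'}" by (rule pf_mono[OF P(2)[OF \<psi>]]) auto
      fix f assume f: "f \<in> F'"
      have "h f < card F'" using h f by (auto simp: bij_betw_def)
      then show "(\<lambda>u. u (e + h f)) \<in> pf {..<e + card F'}" by (intro pf_coord) simp
      show "(\<lambda>u. grad I f i (\<psi> u)) \<in> pf {..<e + card F'}"
      proof (rule pf_compose[of "grad I f i" I \<psi>])
        show "grad I f i \<in> pf I" using f F F' that I by (intro grad_in_pf) auto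
        show "(\<lambda>u. \<psi> u j) \<in> pf {..<e + card F'}" for j by (rule pf_mono[OF P(2)[OF \<psi>]]) auto
      qed
    qed
    then obtain Q where Q: "Q \<in> pf I" "\<exists>x. Q x \<noteq> 0" "\<And>u. Q (\<phi> u) = 0"
      using algebraic_dependence[OF I, of "{..<e + card F'}" \<phi>] F' by auto
    have "Q T = 0" if T: "\<forall>i\<in>I. T i = \<psi> u i + (\<Sum>f\<in>F'. c f * grad I f i (\<psi> u))" for u c T
    proof -
      define w where "w k = (if k < e then u k else c (the_inv_into F' h (k - e)))" for k
      have wu: "\<psi> w = \<psi> u"
      proof
        show "\<psi> w i = \<psi> u i" for i by (rule pf_cong[OF P(2)[OF \<psi>]]) (simp add: w_def)
      qed
      have "w (e + h f) = c f" if "f \<in> F'" for f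
        using h that by (simp add: w_def the_inv_into_f_f bij_betw_def)
      then have "T i = \<phi> w i" if "i \<in> I" for i
        using T that unfolding \<phi>_def wu by simp
      then have "Q T = Q (\<phi> w)" using pf_cong[OF Q(1)] by blast
      then show ?thesis using Q(3) by simp
    qed
    then show ?thesis using Q by blast
  qed
  then have "\<forall>x\<in>?X. \<exists>Q. Q \<in> pf I \<and> (\<exists>x. Q x \<noteq> 0) \<and>
      (\<forall>u c T. (\<forall>i\<in>I. T i = fst x u i + (\<Sum>f\<in>snd x. c f * grad I f i (fst x u))) \<longrightarrow> Q T = 0)"
    by (simp add: Ball_def Bex_def)
  from bchoice[OF this] obtain Q where Q: "\<forall>x\<in>?X. Q x \<in> pf I \<and> (\<exists>z. Q x z \<noteq> 0) \<and>
      (\<forall>u c T. (\<forall>i\<in>I. T i = fst x u i + (\<Sum>f\<in>snd x. c f * grad I f i (fst x u))) \<longrightarrow> Q x T = 0)"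
    by blast
  have finX: "finite ?X" using P(1) F(1) by auto
  define R where "R T = (\<Prod>x\<in>?X. Q x T)" for T
  have "R \<in> pf I" unfolding R_def using Q by (intro pf_prod) blast
  moreover have "\<exists>x. R x \<noteq> 0" unfolding R_def using Q finX by (intro pf_prod_nonzero[of _ _ I]) blast+
  moreover have "R T = 0" if "y \<in> B" "F' \<subseteq> F" "card F' + e < card I"
      "\<forall>i\<in>I. T i = y i + (\<Sum>f\<in>F'. c f * grad I f i y)" for y F' c T
  proof -
    obtain \<psi> u where y: "\<psi> \<in> \<Psi>" "y = \<psi> u" using P(3) \<open>y \<in> B\<close> by blast
    then have X: "(\<psi>, F') \<in> ?X" using that by simp
    have "\<forall>i\<in>I. T i = fst (\<psi>, F') u i + (\<Sum>f\<in>snd (\<psi>, F'). c f * grad I f i (fst (\<psi>, F') u))"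
      using that(4) y(2) by simp
    with bspec[OF Q X] have "Q (\<psi>, F') T = 0" by blast
    then show ?thesis unfolding R_def using finX X by (intro prod_zero) blast+
  qed
  ultimately show ?thesis by blast
qed

section \<open>Tangent vectors to the set of decomposable tensors\<close>

lemma idx_Cons: "idx (m # n) = (\<lambda>(j, i). j # i) ` ({..<m} \<times> idx n)"
proof (intro equalityI subsetI)
  fix x assume x: "x \<in> idx (m # n)"
  then obtain j i where ji: "x = j # i" by (cases x) (auto simp: idx_def)
  have "j < m" using x ji by (auto simp: idx_def)
  moreover have "i \<in> idx n" using x ji by (force simp: idx_def)
  ultimately show "x \<in> (\<lambda>(j, i). j # i) ` ({..<m} \<times> idx n)" using ji by auto
next
  fix x assume "x \<in> (\<lambda>(j, i). j # i) ` ({..<m} \<times> idx n)"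
  then show "x \<in> idx (m # n)" by (auto simp: idx_def nth_Cons split: nat.splits)
qed

lemma finite_idx: "finite (idx n)"
proof (induction n)
  case Nil show ?case by (rule finite_subset[of _ "{[]}"]) (auto simp: idx_def)
next
  case (Cons m n) then show ?case by (simp add: idx_Cons)
qed

text \<open>The distributive law, one mode at a time. It makes the inner product of rank-one tensors
  multiplicative over the modes.\<close>

lemma sum_idx_prod:
  "(\<Sum>i\<in>idx n. \<Prod>l<length n. f l (i ! l)) = (\<Prod>l<length n. \<Sum>j<n ! l. (f l j :: real))"
proof (induction n arbitrary: f)
  case Nil
  have "idx [] = {[]}" by (auto simp: idx_def)
  then show ?case by simp
next
  case (Cons m n)
  have inj: "inj_on (\<lambda>(j, i). j # i) ({..<m} \<times> idx n)" by (auto simp: inj_on_def)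
  have "(\<Sum>i\<in>idx (m # n). \<Prod>l<length (m # n). f l (i ! l)) =
      (\<Sum>(j, i)\<in>{..<m} \<times> idx n. f 0 j * (\<Prod>l<length n. f (Suc l) (i ! l)))"
    unfolding idx_Cons sum.reindex[OF inj]
    by (intro sum.cong) (auto simp: prod.lessThan_Suc_shift simp del: prod.lessThan_Suc)
  also have "\<dots> = (\<Sum>j<m. f 0 j) * (\<Sum>i\<in>idx n. \<Prod>l<length n. f (Suc l) (i ! l))"
    by (simp add: sum.cartesian_product[symmetric] sum_product)
  also have "\<dots> = (\<Prod>l<length (m # n). \<Sum>j<(m # n) ! l. f l j)"
    unfolding Cons.IH[of "\<lambda>l. f (Suc l)"] by (simp add: prod.lessThan_Suc_shift del: prod.lessThan_Suc)
  finally show ?case .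
qed

lemma outer_cong: "(\<And>l. l < length n \<Longrightarrow> a l = b l) \<Longrightarrow> outer n a = outer n b"
  unfolding outer_def by (intro ext if_cong prod.cong) auto

lemma outer_scale:
  "outer n (\<lambda>l x. c l * a l x) \<alpha> = (\<Prod>l<length n. c l) * outer n a \<alpha>"
  unfolding outer_def by (simp add: prod.distrib)

lemma outer_fun_upd:
  assumes "l < length n" "\<alpha> \<in> idx n"
  shows "outer n (a(l := u)) \<alpha> = u (\<alpha> ! l) * (\<Prod>m\<in>{..<length n} - {l}. a m (\<alpha> ! m))"
proof -
  have "outer n (a(l := u)) \<alpha> = (\<Prod>m<length n. (a(l := u)) m (\<alpha> ! m))"
    using assms by (simp add: outer_def)
  also have "\<dots> = u (\<alpha> ! l) * (\<Prod>m\<in>{..<length n} - {l}. (a(l := u)) m (\<alpha> ! m))"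
    using assms by (subst prod.remove[of _ l]) auto
  also have "(\<Prod>m\<in>{..<length n} - {l}. (a(l := u)) m (\<alpha> ! m)) = (\<Prod>m\<in>{..<length n} - {l}. a m (\<alpha> ! m))"
    by (rule prod.cong) auto
  finally show ?thesis .
qed

lemma outer_linear:
  assumes "l < length n"
  shows "outer n (a(l := \<lambda>x. u x + t * v x)) \<alpha> = outer n (a(l := u)) \<alpha> + t * outer n (a(l := v)) \<alpha>"
proof (cases "\<alpha> \<in> idx n")
  case True then show ?thesis using assms by (simp add: outer_fun_upd distrib_right mult.assoc del: fun_upd_apply)
next
  case False then show ?thesis by (simp add: outer_def)
qed

lemma tinner_outer: "tinner n (outer n a) (outer n b) = (\<Prod>l<length n. vinner (n ! l) (a l) (b l))"
proof -
  have "tinner n (outer n a) (outer n b) = (\<Sum>i\<in>idx n. \<Prod>l<length n. a l (i ! l) * b l (i ! l))"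
    unfolding tinner_def by (rule sum.cong) (auto simp: outer_def prod.distrib)
  also have "\<dots> = (\<Prod>l<length n. vinner (n ! l) (a l) (b l))"
    unfolding vinner_def by (rule sum_idx_prod[of "\<lambda>l j. a l j * b l j"])
  finally show ?thesis .
qed

lemma vinner_commute: "vinner m v w = vinner m w v"
  by (simp add: vinner_def mult.commute)

lemma vinner_linear_left: "vinner m (\<lambda>x. u x + t * v x) w = vinner m u w + t * vinner m v w"
  by (simp add: vinner_def distrib_right sum.distrib sum_distrib_left mult.assoc)

lemma vinner_linear_right: "vinner m w (\<lambda>x. u x + t * v x) = vinner m w u + t * vinner m w v"
  using vinner_linear_left vinner_commute by metis

lemma vinner_scale_left: "vinner m (\<lambda>x. c * u x) w = c * vinner m u w"
  by (simp add: vinner_def sum_distrib_left mult.assoc)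

lemma vinner_scale_right: "vinner m w (\<lambda>x. c * u x) = c * vinner m w u"
  using vinner_scale_left vinner_commute by metis

lemma vinner_self_nonneg: "0 \<le> vinner m v v"
  by (simp add: vinner_def sum_nonneg)

lemma is_vec_linear: "is_vec m u \<Longrightarrow> is_vec m v \<Longrightarrow> is_vec m (\<lambda>x. u x + t * v x)"
  by (simp add: is_vec_def)

lemma is_vec_scale: "is_vec m u \<Longrightarrow> is_vec m (\<lambda>x. c * u x)"
  by (simp add: is_vec_def)

text \<open>Lengths are moved into the coefficients. Curves in \<open>Ps\<close> can then be written
  with nonzero vectors that are affine in the parameter, without square roots.\<close>

lemma in_PsI:
  assumes s: "s \<le> length n"
    and B: "\<And>i l. i < r \<Longrightarrow> l < length n \<Longrightarrow> is_vec (n ! l) (B i l) \<and> vinner (n ! l) (B i l) (B i l) \<noteq> 0"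
    and orth: "\<And>i j l. i < r \<Longrightarrow> j < r \<Longrightarrow> i \<noteq> j \<Longrightarrow> l < s \<Longrightarrow> vinner (n ! l) (B i l) (B j l) = 0"
    and T: "\<And>\<alpha>. T \<alpha> = (\<Sum>i<r. \<sigma> i * outer n (B i) \<alpha>)"
  shows "T \<in> Ps n s r"
proof -
  define c where "c i l = sqrt (vinner (n ! l) (B i l) (B i l))" for i l
  define A where "A i l = (\<lambda>x. inverse (c i l) * B i l x)" for i l
  have c: "c i l \<noteq> 0" "c i l * c i l = vinner (n ! l) (B i l) (B i l)" if "i < r" "l < length n" for i l
    using B[OF that] vinner_self_nonneg[of "n ! l" "B i l"] by (auto simp: c_def)
  have "orth_decomp n s r (\<lambda>i. \<sigma> i * (\<Prod>l<length n. c i l)) A"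
    unfolding orth_decomp_def
  proof (intro conjI allI impI)
    fix i l assume il: "i < r" "l < length n"
    have "vinner (n ! l) (A i l) (A i l) = 1"
      using c(1)[OF il] unfolding A_def vinner_scale_left vinner_scale_right c(2)[OF il, symmetric]
      by (simp add: field_simps)
    then show "unit_vec (n ! l) (A i l)"
      using B[OF il] unfolding unit_vec_def A_def by (simp add: is_vec_scale)
  next
    fix l i j assume "l < s" "i < r" "j < r" "i \<noteq> j"
    then show "vinner (n ! l) (A i l) (A j l) = 0"
      using orth unfolding A_def vinner_scale_left vinner_scale_right by simp
  qed
  moreover have "T = decomp_tensor n r (\<lambda>i. \<sigma> i * (\<Prod>l<length n. c i l)) A"
    unfolding decomp_tensor_def
  proof
    fix \<alpha>
    have eq: "\<sigma> i * (\<Prod>l<length n. c i l) * outer n (A i) \<alpha> = \<sigma> i * outer n (B i) \<alpha>" if "i < r" for i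
    proof -
      have "(\<Prod>l<length n. c i l) * (\<Prod>l<length n. inverse (c i l)) = 1"
        unfolding prod.distrib[symmetric] using c(1)[OF that] by (intro prod.neutral) simp
      then show ?thesis unfolding A_def outer_scale by (simp add: mult.assoc[symmetric])
    qed
    show "T \<alpha> = (\<Sum>i<r. \<sigma> i * (\<Prod>l<length n. c i l) * outer n (A i) \<alpha>)"
      unfolding T by (rule sum.cong) (simp_all only: eq lessThan_iff)
  qed
  ultimately show ?thesis unfolding Ps_def by blast
qed

text \<open>While \<open>r < m\<close>, the \<open>r\<close> orthogonality conditions on
  \<open>m\<close> unknowns have a nonzero solution, which is normalised and appended.\<close>

lemma extend_orthonormal:
  assumes "r \<le> m"
    and "\<And>i. i < r \<Longrightarrow> is_vec m (a i)"
    and "\<And>i j. i < r \<Longrightarrow> j < r \<Longrightarrow> vinner m (a i) (a j) = (if i = j then 1 else 0)"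
  shows "\<exists>q. (\<forall>i<r. q i = a i) \<and> (\<forall>i<m. is_vec m (q i)) \<and>
    (\<forall>i<m. \<forall>j<m. vinner m (q i) (q j) = (if i = j then 1 else 0))"
  using assms
proof (induction "m - r" arbitrary: r a)
  case 0
  then show ?case by (intro exI[of _ a]) auto
next
  case (Suc d)
  then have "r < m" by simp
  then obtain c where c: "\<exists>j\<in>{..<m}. c j \<noteq> 0" "\<forall>i\<in>{..<r}. (\<Sum>j\<in>{..<m}. c j * a i j) = 0"
    using nontrivial_solution[of "{..<r}" "{..<m}" "\<lambda>j i. a i j"] by auto
  define w where "w j = (if j < m then c j else 0)" for j
  have w: "is_vec m w" by (simp add: w_def is_vec_def)
  have wa: "vinner m w (a i) = 0" if "i < r" for i
    using c(2) that by (simp add: vinner_def w_def)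
  have ww: "vinner m w w > 0"
  proof -
    obtain j where "j < m" "c j \<noteq> 0" using c(1) by auto
    then have "vinner m w w \<noteq> 0" unfolding vinner_def w_def by (subst sum_nonneg_eq_0_iff) auto
    then show ?thesis using vinner_self_nonneg[of m w] by simp
  qed
  define v where "v = (\<lambda>x. inverse (sqrt (vinner m w w)) * w x)"
  have "inverse (sqrt (vinner m w w)) * (inverse (sqrt (vinner m w w)) * vinner m w w) = 1"
  proof -
    define q where "q = sqrt (vinner m w w)"
    have q: "q \<noteq> 0" "vinner m w w = q * q" using ww by (simp_all add: q_def)
    show ?thesis unfolding q_def[symmetric] unfolding q(2) using q(1) by (simp add: field_simps)
  qed
  then have vv: "vinner m v v = 1" unfolding v_def vinner_scale_left vinner_scale_right .
  have va: "vinner m v (a i) = 0" "vinner m (a i) v = 0" if "i < r" for i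
    using wa[OF that] by (simp_all add: v_def vinner_scale_left vinner_commute[of m "a i"])
  let ?a = "a(r := v)"
  have "\<exists>q. (\<forall>i<Suc r. q i = ?a i) \<and> (\<forall>i<m. is_vec m (q i)) \<and>
    (\<forall>i<m. \<forall>j<m. vinner m (q i) (q j) = (if i = j then 1 else 0))"
  proof (rule Suc.hyps(1))
    show "d = m - Suc r" "Suc r \<le> m" using Suc.hyps(2) \<open>r < m\<close> by auto
    show "is_vec m (?a i)" if "i < Suc r" for i
      using that Suc.prems(2)[of i] is_vec_scale[OF w] by (auto simp: v_def less_Suc_eq)
    show "vinner m (?a i) (?a j) = (if i = j then 1 else 0)" if "i < Suc r" "j < Suc r" for i j
      using that Suc.prems(3)[of i j] vv va by (auto simp: less_Suc_eq)
  qed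
  then obtain q where q: "\<forall>i<Suc r. q i = ?a i" "\<forall>i<m. is_vec m (q i)"
    "\<forall>i<m. \<forall>j<m. vinner m (q i) (q j) = (if i = j then 1 else 0)" by blast
  have "\<forall>i<r. q i = a i" using q(1) by (simp add: less_Suc_eq)
  then show ?case using q by blast
qed

lemma standard_basis:
  fixes m :: nat
  defines "e \<equiv> \<lambda>(i::nat) (x::nat). if x = i then 1 else (0::real)"
  shows "i < m \<Longrightarrow> is_vec m (e i)"
    and "i < m \<Longrightarrow> j < m \<Longrightarrow> vinner m (e i) (e j) = (if i = j then 1 else 0)"
proof -
  show "i < m \<Longrightarrow> is_vec m (e i)" by (auto simp: is_vec_def e_def)
  assume "i < m" "j < m"
  have "vinner m (e i) (e j) = (\<Sum>x<m. if x = i then (if i = j then 1 else 0) else 0)"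
    unfolding vinner_def e_def by (rule sum.cong) auto
  then show "vinner m (e i) (e j) = (if i = j then 1 else 0)" using \<open>i < m\<close> by simp
qed

text \<open>Only a short segment of the line has to lie in \<open>Y\<close>; this is all that is
  available when a vector of a decomposition might vanish further out.\<close>

lemma grad_orthogonal_to_line:
  assumes f: "f \<in> vanishing_ideal n Y"
    and line: "\<forall>\<^sub>F \<tau> in nhds 0. (\<lambda>\<alpha>. y \<alpha> + \<tau> * V \<alpha>) \<in> Y"
  shows "(\<Sum>\<alpha>\<in>idx n. grad (idx n) f \<alpha> y * V \<alpha>) = 0"
proof -
  have "f \<in> pf (idx n)" using f by (simp add: vanishing_ideal_def polyfun_eq_pf)
  then have D: "((\<lambda>t. f (\<lambda>i. y i + t * V i)) has_real_derivative (\<Sum>i\<in>idx n. grad (idx n) f i y * V i)) (at 0)"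
    by (rule has_derivative_grad[OF finite_idx])
  have "\<forall>\<^sub>F t in nhds 0. f (\<lambda>i. y i + t * V i) = 0"
    using line by eventually_elim (use f in \<open>auto simp: vanishing_ideal_def\<close>)
  then have "((\<lambda>t. f (\<lambda>i. y i + t * V i)) has_real_derivative 0) (at 0)"
    by (subst DERIV_cong_ev[OF refl _ refl, where g = "\<lambda>_. 0"]) auto
  then show ?thesis using D DERIV_unique by blast
qed

text \<open>Index set for a basis of the tangent space at a generic point. The triple \<open>(i, 0, i)\<close> stands
  for the direction of \<open>\<sigma>\<^sub>i\<close>, the triple \<open>(i, l, j)\<close> with \<open>j \<noteq> i\<close> for moving the \<open>i\<close>-th vector of
  mode \<open>l\<close> towards the \<open>j\<close>-th basis vector.\<close>

definition tangent_idx :: "nat list \<Rightarrow> nat \<Rightarrow> nat \<Rightarrow> (nat \<times> nat \<times> nat) set" where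
  "tangent_idx n s r = {(i, l, j). i < r \<and> l < length n \<and> j < n ! l \<and>
     (l = 0 \<and> j = i \<or> l < s \<and> i < j \<or> s \<le> l \<and> j \<noteq> i)}"

lemma finite_tangent_idx: "finite (tangent_idx n s r)"
proof (rule finite_subset)
  show "tangent_idx n s r \<subseteq> {..<r} \<times> {..<length n} \<times> (\<Union>l<length n. {..<n ! l})"
    by (auto simp: tangent_idx_def)
qed auto

text \<open>With at least three modes some mode \<open>m\<close> avoids both \<open>l\<close> and
  \<open>l'\<close> and shows the common entry. With two modes \<open>[i, j]\<close> arises from
  \<open>[i, i]\<close> as well as from \<open>[j, j]\<close>.\<close>

lemma replicate_update_inj:
  assumes "(replicate k i)[l := j] = (replicate k i')[l' := j']" "k \<ge> 3" "l < k" "l' < k"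
  shows "i = i' \<and> j = j' \<and> (l = l' \<or> j = i)"
proof -
  have nth: "(replicate k i)[l := j] ! m = (replicate k i')[l' := j'] ! m" for m using assms by simp
  have "card {l, l'} < card {..<k}" using assms(2) card_insert_le_m1[of 2 "{l'}" l] by simp
  then have "\<not> {..<k} \<subseteq> {l, l'}" using card_mono[of "{l, l'}" "{..<k}"] by auto
  then obtain m where m: "m < k" "m \<noteq> l" "m \<noteq> l'" by auto
  have "i = i'" using nth[of m] m by simp
  then show ?thesis using nth[of l] nth[of l'] assms(3,4) by (cases "l = l'") auto
qed

text \<open>\<open>Q l\<close> is an orthonormal basis of mode \<open>l\<close>, extending the given
  vectors in the modes below \<open>s\<close>. In those modes the path stands still, so
  orthogonality holds for every \<open>t\<close>; the other modes move affinely to orthonormal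
  vectors and the coefficients to 1.\<close>

locale decomposition_path =
  fixes n :: "nat list" and s r :: nat and \<sigma> :: "nat \<Rightarrow> real"
    and A :: "nat \<Rightarrow> nat \<Rightarrow> nat \<Rightarrow> real" and Q :: "nat \<Rightarrow> nat \<Rightarrow> nat \<Rightarrow> real"
  assumes k: "length n \<ge> 3" and s: "1 \<le> s" "s \<le> length n"
    and r: "\<And>l. l < length n \<Longrightarrow> r \<le> n ! l"
    and A: "\<And>i l. i < r \<Longrightarrow> l < length n \<Longrightarrow> is_vec (n ! l) (A i l)"
    and QA: "\<And>i l. i < r \<Longrightarrow> l < s \<Longrightarrow> Q l i = A i l"
    and Qvec: "\<And>i l. l < length n \<Longrightarrow> i < n ! l \<Longrightarrow> is_vec (n ! l) (Q l i)"
    and Qorth: "\<And>i j l. l < length n \<Longrightarrow> i < n ! l \<Longrightarrow> j < n ! l \<Longrightarrow>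
        vinner (n ! l) (Q l i) (Q l j) = (if i = j then 1 else 0)"
begin

definition C :: "real \<Rightarrow> nat \<Rightarrow> nat \<Rightarrow> nat \<Rightarrow> real" where
  "C t i l = (if l < s then Q l i else (\<lambda>x. A i l x + t * (Q l i x - A i l x)))"

definition S :: "real \<Rightarrow> nat \<Rightarrow> real" where
  "S t i = \<sigma> i + t * (1 - \<sigma> i)"

definition y :: "real \<Rightarrow> nat list \<Rightarrow> real" where
  "y t \<alpha> = (\<Sum>i<r. S t i * outer n (C t i) \<alpha>)"

text \<open>Derivatives of \<open>y t\<close> in the parameters of the decomposition. In an
  orthogonal mode with \<open>j < r\<close>, moving vector \<open>i\<close> towards vector
  \<open>j\<close> forces vector \<open>j\<close> towards minus vector \<open>i\<close>; the
  subtracted term records this rotation.\<close>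

definition V :: "real \<Rightarrow> nat \<times> nat \<times> nat \<Rightarrow> nat list \<Rightarrow> real" where
  "V t = (\<lambda>(i, l, j) \<alpha>. if j = i then outer n (C t i) \<alpha>
     else S t i * outer n ((C t i)(l := Q l j)) \<alpha> -
       (if l < s \<and> j < r then S t j * outer n ((C t j)(l := Q l i)) \<alpha> else 0))"

lemma y_0: "y 0 = decomp_tensor n r \<sigma> A"
proof
  fix \<alpha>
  have "outer n (C 0 i) = outer n (A i)" if "i < r" for i
    by (rule outer_cong) (use that QA in \<open>auto simp: C_def\<close>)
  then show "y 0 \<alpha> = decomp_tensor n r \<sigma> A \<alpha>" by (simp add: y_def decomp_tensor_def S_def)
qed

lemma C_is_vec: "i < r \<Longrightarrow> l < length n \<Longrightarrow> is_vec (n ! l) (C t i l)"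
  using A[of i l] Qvec[of l i] r[of l] by (auto simp: C_def is_vec_def)

lemma polynomial_C: "real_polynomial_function (\<lambda>t. C t i l x)"
  by (cases "l < s") (simp_all add: C_def real_polynomial_function.intros(2) real_polynomial_function_line)

text \<open>At these \<open>t\<close> some vector of a mode from \<open>s\<close> on is zero and
  cannot be normalised. At \<open>t = 1\<close> all vectors have length 1, so no squared length is
  the zero polynomial.\<close>

lemma finite_degenerate:
  "finite {t. \<exists>i<r. \<exists>l<length n. vinner (n ! l) (C t i l) (C t i l) = 0}"
proof -
  have "finite {t. vinner (n ! l) (C t i l) (C t i l) = 0}" if "i < r" "l < length n" for i l
  proof (rule finite_zeros_real_polynomial_function)
    show "real_polynomial_function (\<lambda>t. vinner (n ! l) (C t i l) (C t i l))"
      unfolding vinner_def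
      by (intro real_polynomial_function_sum real_polynomial_function.intros(4) polynomial_C) auto
    have "C 1 i l = Q l i" by (auto simp: C_def)
    then show "vinner (n ! l) (C 1 i l) (C 1 i l) \<noteq> 0" using Qorth[of l i i] r[OF that(2)] that by simp
  qed
  then have "finite (\<Union>i<r. \<Union>l<length n. {t. vinner (n ! l) (C t i l) (C t i l) = 0})" by simp
  moreover have "{t. \<exists>i<r. \<exists>l<length n. vinner (n ! l) (C t i l) (C t i l) = 0} =
      (\<Union>i<r. \<Union>l<length n. {t. vinner (n ! l) (C t i l) (C t i l) = 0})" by auto
  ultimately show ?thesis by simp
qed

lemma polynomial_outer:
  assumes "\<And>l x. real_polynomial_function (\<lambda>t. a t l x)"
  shows "real_polynomial_function (\<lambda>t::real. outer n (a t) \<alpha>)"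
  by (cases "\<alpha> \<in> idx n") (auto simp: outer_def intro!: assms real_polynomial_function.intros(2))

lemma polynomial_C_upd: "real_polynomial_function (\<lambda>t. ((C t i)(l := q)) m x)"
  by (cases "m = l") (simp_all add: polynomial_C real_polynomial_function.intros(2))

lemma polynomial_S: "real_polynomial_function (\<lambda>t. S t i)"
  unfolding S_def by (rule real_polynomial_function_line)

lemma polynomial_y: "real_polynomial_function (\<lambda>t. y t \<alpha>)"
  unfolding y_def
  by (intro real_polynomial_function_sum real_polynomial_function.intros(4) polynomial_S polynomial_outer polynomial_C) auto

lemma polynomial_V: "real_polynomial_function (\<lambda>t. V t p \<alpha>)"
proof -
  obtain i l j where p: "p = (i, l, j)" by (cases p)
  have 1: "real_polynomial_function (\<lambda>t. outer n (C t i) \<alpha>)"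
    by (intro polynomial_outer polynomial_C)
  have 2: "real_polynomial_function (\<lambda>t. S t i * outer n ((C t i)(l := q)) \<alpha>)" for i q
    by (rule real_polynomial_function.intros(4)[OF polynomial_S polynomial_outer[OF polynomial_C_upd]])
  show ?thesis
  proof (cases "j = i")
    case True then show ?thesis using 1 by (simp add: p V_def)
  next
    case False
    then show ?thesis
      using real_polynomial_function_diff[OF 2[of i "Q l j"] 2[of j "Q l i"]] 2[of i "Q l j"]
      by (cases "l < s"; cases "j < r") (simp_all add: p V_def)
  qed
qed

text \<open>The directions are realised by genuine segments in \<open>Ps\<close>: each term changes
  in a single mode, where \<open>outer\<close> is linear. First-order rotations suffice, because
  \<open>q_i + \<tau> q_j\<close> and \<open>q_j - \<tau> q_i\<close> are exactly
  orthogonal.\<close>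

lemma tangent_line:
  assumes good: "\<forall>i<r. \<forall>l<length n. vinner (n ! l) (C t i l) (C t i l) \<noteq> 0"
    and p: "p \<in> tangent_idx n s r"
  shows "\<forall>\<^sub>F \<tau> in nhds 0. (\<lambda>\<alpha>. y t \<alpha> + \<tau> * V t p \<alpha>) \<in> Ps n s r"
proof -
  obtain i l j where pp: "p = (i, l, j)" by (cases p)
  have il: "i < r" "l < length n" "j < n ! l" "i < n ! l"
    and cases: "l = 0 \<and> j = i \<or> l < s \<and> i < j \<or> s \<le> l \<and> j \<noteq> i"
    using p pp r[of l] by (auto simp: tangent_idx_def)
  have orth: "vinner (n ! m) (C t a m) (C t b m) = (if a = b then 1 else 0)" if "a < r" "b < r" "m < s" for a b m
    using that Qorth[of m a b] r[of m] s by (simp add: C_def)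
  have basic: "is_vec (n ! m) (C t a m) \<and> vinner (n ! m) (C t a m) (C t a m) \<noteq> 0" if "a < r" "m < length n" for a m
    using that good C_is_vec by auto
  have iter: "(\<Sum>a<r. f a + (if a = i then g else 0)) = (\<Sum>a<r. f a) + (g::real)" for f g
    using il by (simp add: sum.distrib)
  \<comment> \<open>The four motions: changing a coefficient; rotating two vectors of an orthogonal
    mode into each other; tilting one vector of such a mode out of the span of all \<open>r\<close>;
    moving a vector in a mode without orthogonality.\<close>
  consider (scale) "j = i" | (rot) "l < s" "i < j" "j < r" | (free) "l < s" "r \<le> j" | (late) "s \<le> l" "j \<noteq> i"
    using cases by force
  then show ?thesis
  proof cases
    case scale
    have "(\<lambda>\<alpha>. y t \<alpha> + \<tau> * V t p \<alpha>) \<in> Ps n s r" for \<tau>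
    proof (rule in_PsI[OF s(2), where B = "C t" and \<sigma> = "(S t)(i := S t i + \<tau>)"])
      show "vinner (n ! m) (C t a m) (C t b m) = 0" if "a < r" "b < r" "a \<noteq> b" "m < s" for a b m
        using orth that by simp
      fix \<alpha>
      have "((S t)(i := S t i + \<tau>)) a * outer n (C t a) \<alpha> =
          S t a * outer n (C t a) \<alpha> + (if a = i then \<tau> * outer n (C t i) \<alpha> else 0)" for a
        by (simp add: distrib_right)
      then show "y t \<alpha> + \<tau> * V t p \<alpha> = (\<Sum>a<r. ((S t)(i := S t i + \<tau>)) a * outer n (C t a) \<alpha>)"
        unfolding pp V_def using scale by (simp add: iter y_def del: fun_upd_apply)
    qed (use basic in blast)
    then show ?thesis by simp
  next
    case rot
    have ij: "j \<noteq> i" using rot by simp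
    have Cl: "C t i l = Q l i" "C t j l = Q l j" using rot by (simp_all add: C_def)
    define B where "B \<tau> = (C t)(i := (C t i)(l := \<lambda>x. Q l i x + \<tau> * Q l j x),
        j := (C t j)(l := \<lambda>x. Q l j x + (- \<tau>) * Q l i x))" for \<tau>
    have Bm: "B \<tau> a m = C t a m" if "m \<noteq> l \<or> a \<noteq> i \<and> a \<noteq> j" for \<tau> a m
      using that by (auto simp: B_def)
    have Bl: "B \<tau> i l = (\<lambda>x. Q l i x + \<tau> * Q l j x)" "B \<tau> j l = (\<lambda>x. Q l j x + (- \<tau>) * Q l i x)" for \<tau>
      using ij by (auto simp: B_def)
    have Qa: "vinner (n ! l) (Q l a) (Q l b) = (if a = b then 1 else 0)" if "a < r" "b < r" for a b
      using Qorth[of l a b] r[of l] il that by auto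
    have Ca: "C t a l = Q l a" for a using rot by (simp add: C_def)
    have "(\<lambda>\<alpha>. y t \<alpha> + \<tau> * V t p \<alpha>) \<in> Ps n s r" for \<tau>
    proof (rule in_PsI[OF s(2), where B = "B \<tau>" and \<sigma> = "S t"])
      fix a m assume am: "a < r" "m < length n"
      show "is_vec (n ! m) (B \<tau> a m) \<and> vinner (n ! m) (B \<tau> a m) (B \<tau> a m) \<noteq> 0"
      proof (cases "m \<noteq> l \<or> a \<noteq> i \<and> a \<noteq> j")
        case True then show ?thesis using basic[OF am] Bm by simp
      next
        case False
        \<comment> \<open>\<open>1 + \<tau> * \<tau>\<close> is the squared length of either rotated
          vector, so no \<open>\<tau>\<close> has to be excluded.\<close>
        have pos: "1 + \<tau> * \<tau> \<noteq> 0" by (metis add_pos_nonneg less_irrefl zero_le_square zero_less_one)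
        have v: "is_vec (n ! l) (Q l i)" "is_vec (n ! l) (Q l j)" using Qvec il by auto
        show ?thesis
        proof (cases "a = i")
          case True
          then show ?thesis using False pos v Qa il rot
            by (simp add: Bl is_vec_linear vinner_linear_left vinner_linear_right)
        next
          case f: False
          have "is_vec (n ! l) (\<lambda>x. Q l j x + (- \<tau>) * Q l i x)" by (rule is_vec_linear[OF v(2,1)])
          moreover have "vinner (n ! l) (\<lambda>x. Q l j x + (- \<tau>) * Q l i x) (\<lambda>x. Q l j x + (- \<tau>) * Q l i x) = 1 + \<tau> * \<tau>"
            unfolding vinner_linear_left vinner_linear_right using Qa il rot by simp
          moreover have "a = j" "m = l" using False f by auto
          ultimately show ?thesis using pos Bl by simp
        qed
      qed
    next
      fix a b m assume ab: "a < r" "b < r" "a \<noteq> b" "m < s"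
      show "vinner (n ! m) (B \<tau> a m) (B \<tau> b m) = 0"
      proof (cases "m = l")
        case True
        have Bo: "B \<tau> c l = Q l c" if "c \<noteq> i" "c \<noteq> j" for c using Bm[of l c \<tau>] that Ca by simp
        have "vinner (n ! l) (B \<tau> a l) (B \<tau> b l) = 0"
          using ab ij rot il Qa
          by (cases "a = i"; cases "a = j"; cases "b = i"; cases "b = j")
            (simp_all only: Bl Bo vinner_linear_left vinner_linear_right, auto)
        then show ?thesis using True by simp
      next
        case False then show ?thesis using orth[of a b m] ab Bm by simp
      qed
    next
      fix \<alpha>
      have "S t a * outer n (B \<tau> a) \<alpha> = S t a * outer n (C t a) \<alpha> + (if a = i then \<tau> * (S t i * outer n ((C t i)(l := Q l j)) \<alpha>) else 0)
          + (if a = j then \<tau> * (- S t j * outer n ((C t j)(l := Q l i)) \<alpha>) else 0)" for a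
      proof -
        have o1: "outer n ((C t i)(l := \<lambda>x. Q l i x + \<tau> * Q l j x)) \<alpha> = outer n (C t i) \<alpha> + \<tau> * outer n ((C t i)(l := Q l j)) \<alpha>"
          using outer_linear[OF il(2), of "C t i" "C t i l" \<tau> "Q l j" \<alpha>] unfolding fun_upd_triv unfolding Cl .
        have o2: "outer n ((C t j)(l := \<lambda>x. Q l j x + (- \<tau>) * Q l i x)) \<alpha> = outer n (C t j) \<alpha> + (- \<tau>) * outer n ((C t j)(l := Q l i)) \<alpha>"
          using outer_linear[OF il(2), of "C t j" "C t j l" "- \<tau>" "Q l i" \<alpha>] unfolding fun_upd_triv unfolding Cl .
        have b: "B \<tau> i = (C t i)(l := \<lambda>x. Q l i x + \<tau> * Q l j x)"
          "B \<tau> j = (C t j)(l := \<lambda>x. Q l j x + (- \<tau>) * Q l i x)"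
          "a \<noteq> i \<Longrightarrow> a \<noteq> j \<Longrightarrow> B \<tau> a = C t a"
          using ij unfolding B_def by simp_all
        consider "a = i" | "a = j" | "a \<noteq> i" "a \<noteq> j" by blast
        then show ?thesis
        proof cases
          case 1
          have "outer n (B \<tau> a) \<alpha> = outer n (C t i) \<alpha> + \<tau> * outer n ((C t i)(l := Q l j)) \<alpha>"
            unfolding 1 b(1) by (rule o1)
          then show ?thesis using 1 ij by (simp add: algebra_simps del: fun_upd_apply)
        next
          case 2
          have e: "outer n (B \<tau> a) \<alpha> = outer n (C t j) \<alpha> + (- \<tau>) * outer n ((C t j)(l := Q l i)) \<alpha>"
            unfolding 2 b(2) by (rule o2)
          show ?thesis unfolding e using 2 ij by (simp add: algebra_simps del: fun_upd_apply)
        next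
          case 3 then show ?thesis using b(3) by simp
        qed
      qed
      moreover have "(\<Sum>a<r. f a + (if a = i then g else 0) + (if a = j then h else 0)) = (\<Sum>a<r. f a) + g + (h::real)" for f g h
        using il rot by (simp add: sum.distrib)
      ultimately show "y t \<alpha> + \<tau> * V t p \<alpha> = (\<Sum>a<r. S t a * outer n (B \<tau> a) \<alpha>)"
        unfolding pp V_def using ij rot by (simp add: y_def right_diff_distrib del: fun_upd_apply)
    qed
    then show ?thesis by simp
  next
    case free
    have ij: "j \<noteq> i" "\<not> (l < s \<and> j < r)" using free il by auto
    define B where "B \<tau> = (C t)(i := (C t i)(l := \<lambda>x. C t i l x + \<tau> * Q l j x))" for \<tau>
    have Bm: "B \<tau> a m = C t a m" if "m \<noteq> l \<or> a \<noteq> i" for \<tau> a m using that by (auto simp: B_def)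
    have Bl: "B \<tau> i l = (\<lambda>x. Q l i x + \<tau> * Q l j x)" for \<tau> using free by (auto simp: B_def C_def)
    have Ca: "C t a l = Q l a" for a using free by (simp add: C_def)
    have Qa: "vinner (n ! l) (Q l a) (Q l b) = (if a = b then 1 else 0)" if "a < n ! l" "b < n ! l" for a b
      using Qorth[of l a b] il that by auto
    have "(\<lambda>\<alpha>. y t \<alpha> + \<tau> * V t p \<alpha>) \<in> Ps n s r" for \<tau>
    proof (rule in_PsI[OF s(2), where B = "B \<tau>" and \<sigma> = "S t"])
      fix a m assume am: "a < r" "m < length n"
      show "is_vec (n ! m) (B \<tau> a m) \<and> vinner (n ! m) (B \<tau> a m) (B \<tau> a m) \<noteq> 0"
      proof (cases "m \<noteq> l \<or> a \<noteq> i")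
        case True then show ?thesis using basic[OF am] Bm by simp
      next
        case False
        have pos: "1 + \<tau> * \<tau> \<noteq> 0" by (metis add_pos_nonneg less_irrefl zero_le_square zero_less_one)
        have v: "is_vec (n ! l) (Q l i)" "is_vec (n ! l) (Q l j)" using Qvec il by auto
        show ?thesis using False pos v Qa il ij
          by (simp add: Bl is_vec_linear vinner_linear_left vinner_linear_right)
      qed
    next
      fix a b m assume ab: "a < r" "b < r" "a \<noteq> b" "m < s"
      have less: "a < n ! l" "b < n ! l" using ab r[OF il(2)] by auto
      have jab: "j \<noteq> a" "j \<noteq> b" using ab free by auto
      show "vinner (n ! m) (B \<tau> a m) (B \<tau> b m) = 0"
      proof (cases "m = l")
        case True
        have Bo: "B \<tau> c l = Q l c" if "c \<noteq> i" for c using Bm[of l c \<tau>] that Ca by simp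
        have "vinner (n ! l) (B \<tau> a l) (B \<tau> b l) = 0"
          using ab jab less il Qa
          by (cases "a = i"; cases "b = i")
            (simp_all only: Bl Bo vinner_linear_left vinner_linear_right, auto)
        then show ?thesis using True by simp
      next
        case False then show ?thesis using orth[of a b m] ab Bm by simp
      qed
    next
      fix \<alpha>
      have "B \<tau> i = (C t i)(l := \<lambda>x. C t i l x + \<tau> * Q l j x)" by (simp add: B_def)
      then have e: "outer n (B \<tau> i) \<alpha> = outer n (C t i) \<alpha> + \<tau> * outer n ((C t i)(l := Q l j)) \<alpha>"
        using outer_linear[OF il(2), of "C t i" "C t i l" \<tau> "Q l j" \<alpha>] unfolding fun_upd_triv by simp
      have "B \<tau> a = C t a" if "a \<noteq> i" for a using that by (simp add: B_def)
      then have "S t a * outer n (B \<tau> a) \<alpha> = S t a * outer n (C t a) \<alpha> +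
          (if a = i then \<tau> * (S t i * outer n ((C t i)(l := Q l j)) \<alpha>) else 0)" for a
        using e by (cases "a = i") (simp_all add: distrib_left del: fun_upd_apply)
      then show "y t \<alpha> + \<tau> * V t p \<alpha> = (\<Sum>a<r. S t a * outer n (B \<tau> a) \<alpha>)"
        unfolding pp V_def using ij by (auto simp add: y_def iter simp del: fun_upd_apply)
    qed
    then show ?thesis by simp
  next
    case late
    have ij: "j \<noteq> i" "\<not> (l < s \<and> j < r)" using late by auto
    define B where "B \<tau> = (C t)(i := (C t i)(l := \<lambda>x. C t i l x + \<tau> * Q l j x))" for \<tau>
    have Bm: "B \<tau> a m = C t a m" if "m \<noteq> l \<or> a \<noteq> i" for \<tau> a m using that by (auto simp: B_def)
    have Bl: "B \<tau> i l = (\<lambda>x. C t i l x + \<tau> * Q l j x)" for \<tau> by (auto simp: B_def)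
    \<comment> \<open>The moved vector may become zero for some \<open>\<tau>\<close>, but by
      continuity not near 0; this is why the lemma asserts only an eventual property.\<close>
    define g where "g \<tau> = vinner (n ! l) (B \<tau> i l) (B \<tau> i l)" for \<tau>
    have "isCont g 0"
      unfolding g_def Bl vinner_linear_left vinner_linear_right by (intro continuous_intros)
    then have "(g \<longlongrightarrow> g 0) (nhds 0)" by (simp add: isCont_def tendsto_at_iff_tendsto_nhds)
    moreover have "g 0 \<noteq> 0" using good il unfolding g_def Bl by simp
    ultimately have "\<forall>\<^sub>F \<tau> in nhds 0. g \<tau> \<noteq> 0" by (rule tendsto_imp_eventually_ne)
    then show ?thesis
    proof eventually_elim
      case (elim \<tau>)
      show ?case
      proof (rule in_PsI[OF s(2), where B = "B \<tau>" and \<sigma> = "S t"])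
        fix a m assume am: "a < r" "m < length n"
        show "is_vec (n ! m) (B \<tau> a m) \<and> vinner (n ! m) (B \<tau> a m) (B \<tau> a m) \<noteq> 0"
        proof (cases "m \<noteq> l \<or> a \<noteq> i")
          case True then show ?thesis using basic[OF am] Bm by simp
        next
          case False
          then show ?thesis using elim Qvec il C_is_vec unfolding g_def by (auto simp: Bl is_vec_linear)
        qed
      next
        fix a b m assume ab: "a < r" "b < r" "a \<noteq> b" "m < s"
        then have "m \<noteq> l" using late by auto
        then show "vinner (n ! m) (B \<tau> a m) (B \<tau> b m) = 0" using orth[of a b m] ab Bm by simp
      next
        fix \<alpha>
        have "B \<tau> i = (C t i)(l := \<lambda>x. C t i l x + \<tau> * Q l j x)" by (simp add: B_def)
        then have e: "outer n (B \<tau> i) \<alpha> = outer n (C t i) \<alpha> + \<tau> * outer n ((C t i)(l := Q l j)) \<alpha>"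
          using outer_linear[OF il(2), of "C t i" "C t i l" \<tau> "Q l j" \<alpha>] unfolding fun_upd_triv by simp
        have "B \<tau> a = C t a" if "a \<noteq> i" for a using that by (simp add: B_def)
        then have "S t a * outer n (B \<tau> a) \<alpha> = S t a * outer n (C t a) \<alpha> +
            (if a = i then \<tau> * (S t i * outer n ((C t i)(l := Q l j)) \<alpha>) else 0)" for a
          using e by (cases "a = i") (simp_all add: distrib_left del: fun_upd_apply)
        then show "y t \<alpha> + \<tau> * V t p \<alpha> = (\<Sum>a<r. S t a * outer n (B \<tau> a) \<alpha>)"
          unfolding pp V_def using ij by (auto simp add: y_def iter simp del: fun_upd_apply)
      qed
    qed
  qed
qed

text \<open>At \<open>t = 1\<close> the tensors \<open>E \<alpha>\<close> are orthonormal and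
  adapted to the decomposition. The family \<open>E (e p)\<close> is dual to \<open>V 1 p\<close>,
  so pairing a relation with \<open>E (e p)\<close> isolates one coefficient.\<close>

lemma V_1_independent: "indep_on (idx n) (tangent_idx n s r) (V 1)"
proof -
  define k' where "k' = length n"
  define E where "E \<alpha> = outer n (\<lambda>l. Q l (\<alpha> ! l))" for \<alpha>
  define e where "e = (\<lambda>(i, l, j). (replicate k' i)[l := j :: nat])"
  have EE: "tinner n (E \<alpha>) (E \<beta>) = (if \<alpha> = \<beta> then 1 else 0)" if "\<alpha> \<in> idx n" "\<beta> \<in> idx n" for \<alpha> \<beta>
  proof -
    have *: "vinner (n ! l) (Q l (\<alpha> ! l)) (Q l (\<beta> ! l)) = (if \<alpha> ! l = \<beta> ! l then 1 else 0)" if "l < length n" for l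
      using Qorth that \<open>\<alpha> \<in> idx n\<close> \<open>\<beta> \<in> idx n\<close> by (auto simp: idx_def)
    have "tinner n (E \<alpha>) (E \<beta>) = (\<Prod>l<length n. if \<alpha> ! l = \<beta> ! l then 1 else 0)"
      unfolding E_def tinner_outer by (rule prod.cong) (auto simp: *)
    also have "\<dots> = (if \<alpha> = \<beta> then 1 else 0)"
    proof (cases "\<alpha> = \<beta>")
      case False
      have "length \<alpha> = length n" "length \<beta> = length n" using that by (auto simp: idx_def)
      then have "\<exists>l<length n. \<alpha> ! l \<noteq> \<beta> ! l" using False nth_equalityI[of \<alpha> \<beta>] by auto
      then have "(\<Prod>l<length n. if \<alpha> ! l = \<beta> ! l then 1 else 0 :: real) = 0" by (intro prod_zero) auto
      then show ?thesis using False by simp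
    qed simp
    finally show ?thesis .
  qed
  have e_idx: "e (i, l, j) \<in> idx n" if "i < r" "l < length n" "j < n ! l" for i l j
  proof -
    have "(replicate (length n) i)[l := j] ! m < n ! m" if "m < length n" for m
      using \<open>i < r\<close> \<open>j < n ! l\<close> that r[OF that] by (cases "m = l") auto
    then show ?thesis by (simp add: e_def idx_def k'_def)
  qed
  have C1: "outer n ((C 1 i)(l := Q l j)) = E (e (i, l, j))" if "l < length n" for i l j
    unfolding E_def using that by (intro outer_cong) (auto simp: C_def e_def k'_def nth_list_update)
  have C1': "outer n (C 1 i) = E (e (i, 0, i))" for i
  proof -
    have "e (i, 0, i) = replicate k' i" unfolding e_def by (cases k') simp_all
    then show ?thesis unfolding E_def by (intro outer_cong) (auto simp: C_def k'_def)
  qed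
  have dual: "tinner n (E (e p)) (V 1 q) = (if q = p then 1 else 0)" if pq: "p \<in> tangent_idx n s r" "q \<in> tangent_idx n s r" for p q
  proof -
    obtain i l j where p: "p = (i, l, j)" by (cases p)
    obtain i' l' j' where q: "q = (i', l', j')" by (cases q)
    have pc: "i < r" "l < length n" "j < n ! l" "l = 0 \<and> j = i \<or> l < s \<and> i < j \<or> s \<le> l \<and> j \<noteq> i"
      and qc: "i' < r" "l' < length n" "j' < n ! l'" "l' = 0 \<and> j' = i' \<or> l' < s \<and> i' < j' \<or> s \<le> l' \<and> j' \<noteq> i'"
      using pq by (auto simp: p q tangent_idx_def)
    have main: "tinner n (E (e p)) (E (e q)) = (if q = p then 1 else 0)"
    proof -
      have "e p = e q \<longleftrightarrow> q = p"
      proof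
        assume "e p = e q"
        then have "i = i' \<and> j = j' \<and> (l = l' \<or> j = i)"
          using replicate_update_inj[of k' i l j i' l' j'] k pc qc by (auto simp: p q e_def k'_def)
        then show "q = p" using pc(4) qc(4) s by (auto simp: p q)
      qed simp
      then show ?thesis using EE[of "e p" "e q"] e_idx pc qc by (auto simp: p q)
    qed
    show ?thesis
    proof (cases "j' = i'")
      case True
      then have "l' = 0" using qc by auto
      then have "V 1 q = E (e q)" using True by (simp add: q V_def C1' fun_eq_iff)
      then show ?thesis using main by simp
    next
      case False
      show ?thesis
      proof (cases "l' < s \<and> j' < r")
        case True
        then have lt: "i' < j'" using qc False by auto
        \<comment> \<open>The second term of a rotation carries the triple
          \<open>(j', l', i')\<close> with \<open>i' < j'\<close> and \<open>l' < s\<close>. The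
          order \<open>i < j\<close> that \<open>tangent_idx\<close> demands in orthogonal modes
          excludes it as a label.\<close>
        have "e p \<noteq> e (j', l', i')"
        proof
          assume "e p = e (j', l', i')"
          then have "i = j' \<and> j = i' \<and> (l = l' \<or> j = i)"
            using replicate_update_inj[of k' i l j j' l' i'] k pc qc by (auto simp: p e_def k'_def)
          then show False using pc(4) lt True s by auto
        qed
        moreover have "e (j', l', i') \<in> idx n" using True qc r[of l'] by (intro e_idx) auto
        ultimately have 0: "tinner n (E (e p)) (E (e (j', l', i'))) = 0"
          using EE[of "e p" "e (j', l', i')"] e_idx pc by (auto simp: p)
        have "V 1 q = (\<lambda>\<alpha>. E (e q) \<alpha> - E (e (j', l', i')) \<alpha>)"
          using False True qc(2) by (simp add: q V_def S_def C1 fun_eq_iff)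
        then have "tinner n (E (e p)) (V 1 q) = tinner n (E (e p)) (E (e q)) - tinner n (E (e p)) (E (e (j', l', i')))"
          by (simp add: tinner_def right_diff_distrib sum_subtractf)
        then show ?thesis using main 0 by simp
      next
        case f: False
        then have "V 1 q = E (e q)" using False qc(2) by (auto simp: q V_def S_def C1 fun_eq_iff)
        then show ?thesis using main by simp
      qed
    qed
  qed
  show ?thesis unfolding indep_on_def
  proof (intro allI impI ballI)
    fix c p assume c: "\<forall>\<alpha>\<in>idx n. (\<Sum>q\<in>tangent_idx n s r. c q * V 1 q \<alpha>) = 0" and p: "p \<in> tangent_idx n s r"
    have "0 = (\<Sum>\<alpha>\<in>idx n. E (e p) \<alpha> * (\<Sum>q\<in>tangent_idx n s r. c q * V 1 q \<alpha>))" using c by simp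
    also have "\<dots> = (\<Sum>q\<in>tangent_idx n s r. c q * tinner n (E (e p)) (V 1 q))"
      unfolding tinner_def sum_distrib_left by (subst sum.swap) (simp add: mult_ac)
    also have "\<dots> = (\<Sum>q\<in>tangent_idx n s r. if q = p then c q else 0)"
      by (intro sum.cong) (auto simp: dual[OF p])
    also have "\<dots> = c p" using p finite_tangent_idx by simp
    finally show "c p = 0" by simp
  qed
qed

lemma gradient_rank_bound:
  assumes F: "finite F" "F \<subseteq> vanishing_ideal n (Ps n s r)"
    and indep: "indep_on (idx n) F (\<lambda>f \<alpha>. grad (idx n) f \<alpha> (y 0))"
  shows "card F + card (tangent_idx n s r) \<le> card (idx n)"
proof -
  have Fpf: "f \<in> pf (idx n)" if "f \<in> F" for f
    using F that by (auto simp: vanishing_ideal_def polyfun_eq_pf)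
  have "finite {t. \<not> indep_on (idx n) F (\<lambda>f \<alpha>. grad (idx n) f \<alpha> (y t))}"
    by (rule indep_on_cofinite[where V = "\<lambda>t f \<alpha>. grad (idx n) f \<alpha> (y t)", OF F(1) _ indep])
      (rule real_polynomial_function_pf[OF grad_in_pf[OF finite_idx Fpf] polynomial_y])
  moreover have "finite {t. \<not> indep_on (idx n) (tangent_idx n s r) (V t)}"
    by (rule indep_on_cofinite[OF finite_tangent_idx polynomial_V V_1_independent])
  moreover note finite_degenerate
  ultimately have "finite ({t. \<not> indep_on (idx n) F (\<lambda>f \<alpha>. grad (idx n) f \<alpha> (y t))} \<union>
      {t. \<not> indep_on (idx n) (tangent_idx n s r) (V t)} \<union>
      {t. \<exists>i<r. \<exists>l<length n. vinner (n ! l) (C t i l) (C t i l) = 0})" (is "finite ?bad") by simp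
  \<comment> \<open>At \<open>t = 0\<close> the tangent vectors may be dependent, at
    \<open>t = 1\<close> the gradients may be. Orthogonality relates the two families only at the
    same point, so one common \<open>t\<close> is needed.\<close>
  from ex_new_if_finite[OF infinite_UNIV_char_0 this] obtain t where "t \<notin> ?bad" ..
  then have t: "indep_on (idx n) F (\<lambda>f \<alpha>. grad (idx n) f \<alpha> (y t))"
      "indep_on (idx n) (tangent_idx n s r) (V t)"
      "\<forall>i<r. \<forall>l<length n. vinner (n ! l) (C t i l) (C t i l) \<noteq> 0"
    by simp_all
  show ?thesis
  proof (rule orthogonal_indep_card_le[OF finite_idx F(1) finite_tangent_idx t(1,2)])
    fix f p assume "f \<in> F" "p \<in> tangent_idx n s r"
    then show "(\<Sum>\<alpha>\<in>idx n. grad (idx n) f \<alpha> (y t) * V t p \<alpha>) = 0"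
      using F(2) by (intro grad_orthogonal_to_line[OF _ tangent_line[OF t(3)]]) auto
  qed
qed

end

text \<open>What remains is to supply \<open>Q\<close>: an orthonormal completion of the given
  vectors in the orthogonal modes and the standard basis in the others, where any orthonormal end
  point will do.\<close>

theorem gradient_rank_bound_Ps:
  assumes k: "length n \<ge> 3" and s: "1 \<le> s" "s \<le> length n"
    and r: "\<And>l. l < length n \<Longrightarrow> r \<le> n ! l"
    and Y: "Y \<in> Ps n s r"
    and F: "finite F" "F \<subseteq> vanishing_ideal n (Ps n s r)"
    and indep: "indep_on (idx n) F (\<lambda>f \<alpha>. grad (idx n) f \<alpha> Y)"
  shows "card F + card (tangent_idx n s r) \<le> card (idx n)"
proof -
  obtain \<sigma> A where dA: "orth_decomp n s r \<sigma> A" "Y = decomp_tensor n r \<sigma> A"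
    using Y unfolding Ps_def by blast
  have Avec: "is_vec (n ! l) (A i l)" "vinner (n ! l) (A i l) (A i l) = 1" if "i < r" "l < length n" for i l
    using dA(1) that by (auto simp: orth_decomp_def unit_vec_def)
  have "\<exists>q. (l < s \<longrightarrow> (\<forall>i<r. q i = A i l)) \<and> (\<forall>i<n ! l. is_vec (n ! l) (q i)) \<and>
      (\<forall>i<n ! l. \<forall>j<n ! l. vinner (n ! l) (q i) (q j) = (if i = j then 1 else 0))" if l: "l < length n" for l
  proof (cases "l < s")
    case True
    have "vinner (n ! l) (A i l) (A j l) = (if i = j then 1 else 0)" if "i < r" "j < r" for i j
      using dA(1) that True l Avec(2)[of i l] by (auto simp: orth_decomp_def)
    then show ?thesis using extend_orthonormal[OF r[OF l], of "\<lambda>i. A i l"] Avec(1)[OF _ l] True by simp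
  next
    case False
    then show ?thesis using standard_basis[of _ "n ! l"]
      by (intro exI[of _ "\<lambda>i x. if x = i then 1 else 0"]) simp
  qed
  then have "\<forall>l\<in>{..<length n}. \<exists>q. (l < s \<longrightarrow> (\<forall>i<r. q i = A i l)) \<and> (\<forall>i<n ! l. is_vec (n ! l) (q i)) \<and>
      (\<forall>i<n ! l. \<forall>j<n ! l. vinner (n ! l) (q i) (q j) = (if i = j then 1 else 0))" by blast
  from bchoice[OF this] obtain Q where Q: "\<forall>l\<in>{..<length n}. (l < s \<longrightarrow> (\<forall>i<r. Q l i = A i l)) \<and>
      (\<forall>i<n ! l. is_vec (n ! l) (Q l i)) \<and>
      (\<forall>i<n ! l. \<forall>j<n ! l. vinner (n ! l) (Q l i) (Q l j) = (if i = j then 1 else 0))" by blast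
  interpret decomposition_path n s r \<sigma> A Q
    using k s r Avec(1) Q by unfold_locales auto
  show ?thesis using gradient_rank_bound[OF F] indep unfolding y_0 dA(2) by simp
qed

section \<open>Polynomial charts for frames\<close>

text \<open>Up to the factor \<open>\<langle>w, w\<rangle>\<close> this is the reflection in the hyperplane orthogonal to \<open>w\<close>; leaving out
  the division keeps it polynomial in \<open>w\<close>.\<close>

definition reflect :: "nat \<Rightarrow> (nat \<Rightarrow> real) \<Rightarrow> (nat \<Rightarrow> real) \<Rightarrow> nat \<Rightarrow> real" where
  "reflect m w v = (\<lambda>j. vinner m w w * v j + (- 2 * vinner m w v) * w j)"

lemma vinner_reflect_left:
  "vinner m (reflect m w v) u = vinner m w w * vinner m v u + (- 2 * vinner m w v) * vinner m w u"
  unfolding reflect_def vinner_linear_left vinner_scale_left by simp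

lemma reflect_selfadjoint: "vinner m (reflect m w v) u = vinner m v (reflect m w u)"
  unfolding vinner_reflect_left vinner_commute[of m v "reflect m w u"]
  by (simp add: vinner_commute[of m u v])

text \<open>A reflection is an involution; the omitted division leaves the factor
  \<open>(vinner m w w)\<^sup>2\<close>. With self-adjointness it follows that inner products change
  only by this common factor.\<close>

lemma reflect_reflect: "reflect m w (reflect m w v) = (\<lambda>j. (vinner m w w)\<^sup>2 * v j)"
proof
  fix j
  have "vinner m w (reflect m w v) = - vinner m w w * vinner m w v"
    unfolding vinner_commute[of m w "reflect m w v"] vinner_reflect_left
    by (simp add: vinner_commute[of m v w])
  then have "reflect m w (reflect m w v) j =
      vinner m w w * reflect m w v j + (- 2 * (- vinner m w w * vinner m w v)) * w j"
    by (simp only: reflect_def[of m w "reflect m w v"])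
  also have "\<dots> = (vinner m w w)\<^sup>2 * v j"
    unfolding reflect_def by (simp add: power2_eq_square algebra_simps)
  finally show "reflect m w (reflect m w v) j = (vinner m w w)\<^sup>2 * v j" .
qed

lemma vinner_reflect_reflect:
  "vinner m (reflect m w v) (reflect m w u) = (vinner m w w)\<^sup>2 * vinner m v u"
  unfolding reflect_selfadjoint reflect_reflect vinner_scale_right ..

lemma reflect_scale: "reflect m w (\<lambda>j. c * v j) = (\<lambda>j. c * reflect m w v j)"
  unfolding reflect_def vinner_scale_right by (simp add: algebra_simps)

definition orthonormal_frame :: "nat \<Rightarrow> nat \<Rightarrow> (nat \<Rightarrow> nat \<Rightarrow> real) \<Rightarrow> bool" where
  "orthonormal_frame m q a \<longleftrightarrow> (\<forall>i<q. is_vec m (a i)) \<and>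
     (\<forall>i<q. \<forall>j<q. vinner m (a i) (a j) = (if i = j then 1 else 0))"

text \<open>The free factors \<open>\<mu> i\<close> absorb the denominators of stereographic
  projection and of the reflections. In a decomposition they are in turn absorbed by the
  coefficients of the terms.\<close>

definition covers_up_to_scale :: "nat \<Rightarrow> (nat \<times> nat \<Rightarrow> real) set \<Rightarrow> (nat \<Rightarrow> nat \<Rightarrow> real) \<Rightarrow> bool" where
  "covers_up_to_scale q X a \<longleftrightarrow> (\<exists>x\<in>X. \<exists>\<mu>. \<forall>i<q. \<forall>j. a i j = \<mu> i * x (i, j))"

lemma vinner_Suc: "vinner (Suc m) v w = v 0 * w 0 + vinner m (\<lambda>j. v (Suc j)) (\<lambda>j. w (Suc j))"
  unfolding vinner_def by (simp add: sum.lessThan_Suc_shift del: sum.lessThan_Suc)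

lemma orthonormal_frame_tail:
  assumes b: "orthonormal_frame (Suc m) q b" and 0: "\<And>i. i < q \<Longrightarrow> b i 0 = 0"
  shows "orthonormal_frame m q (\<lambda>i j. b i (Suc j))"
  unfolding orthonormal_frame_def
proof (intro conjI allI impI)
  fix i assume "i < q"
  then show "is_vec m (\<lambda>j. b i (Suc j))" using b by (simp add: orthonormal_frame_def is_vec_def)
next
  fix i j assume "i < q" "j < q"
  then show "vinner m (\<lambda>x. b i (Suc x)) (\<lambda>x. b j (Suc x)) = (if i = j then 1 else 0)"
    using b 0 vinner_Suc[of m "b i" "b j"] by (simp add: orthonormal_frame_def)
qed

definition first_vec :: "nat \<Rightarrow> real" where
  "first_vec = (\<lambda>j. if j = 0 then 1 else 0)"

text \<open>Reverses the reduction of dimension: \<open>first_vec\<close> is put in front and the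
  smaller frame is placed in its orthogonal complement.\<close>

definition embed_frame :: "(nat \<times> nat \<Rightarrow> real) \<Rightarrow> nat \<Rightarrow> nat \<Rightarrow> real" where
  "embed_frame x i = (case i of 0 \<Rightarrow> first_vec | Suc i' \<Rightarrow> (\<lambda>j. case j of 0 \<Rightarrow> 0 | Suc j' \<Rightarrow> x (i', j')))"

lemma vinner_first_vec: "vinner (Suc m) v first_vec = v 0"
  unfolding vinner_Suc by (simp add: first_vec_def vinner_def)

text \<open>Stereographic projection identifies the first vector \<open>a\<^sub>0 \<noteq> e\<^sub>0\<close> of a frame with a mirror
  vector \<open>w = (1, -u)\<close>; reflecting turns the other vectors into a frame of one dimension less.\<close>

lemma orthonormal_frame_cover:
  "q \<le> m \<Longrightarrow> \<exists>X. poly_cover (\<Sum>i<q. m - 1 - i) X \<and> (\<forall>a. orthonormal_frame m q a \<longrightarrow> covers_up_to_scale q X a)"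
proof (induction q arbitrary: m)
  case 0
  then show ?case
    using poly_cover_singleton[of "\<lambda>_. 0"] by (intro exI[of _ "{\<lambda>_. 0}"]) (auto simp: covers_up_to_scale_def)
next
  case (Suc q)
  then obtain m' where m: "m = Suc m'" "q \<le> m'" by (cases m) auto
  obtain X where X: "poly_cover (\<Sum>i<q. m' - 1 - i) X"
    "\<And>a. orthonormal_frame m' q a \<Longrightarrow> covers_up_to_scale q X a"
    using Suc.IH[OF m(2)] by blast
  \<comment> \<open>\<open>m'\<close> parameters for the first vector on its sphere, the rest for
    the smaller frame: the dimension of the manifold of frames of length
    \<open>Suc q\<close>.\<close>
  have dim: "(\<Sum>i<Suc q. m - 1 - i) = m' + (\<Sum>i<q. m' - 1 - i)"
    unfolding m(1) by (simp add: sum.lessThan_Suc_shift del: sum.lessThan_Suc)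
  \<comment> \<open>Chart for the frames whose first vector is \<open>first_vec\<close>, the one
    point that stereographic projection misses.\<close>
  define G1 :: "(nat \<times> nat \<Rightarrow> real) \<Rightarrow> nat \<times> nat \<Rightarrow> real" where
    "G1 x = (\<lambda>(i, j). embed_frame x i j)" for x
  have embed_pf: "(\<lambda>z. embed_frame (g z) i j) \<in> pf UNIV"
    if "\<And>p. (\<lambda>z. g z p) \<in> pf UNIV" for g :: "('c \<Rightarrow> real) \<Rightarrow> nat \<times> nat \<Rightarrow> real" and i j
    using that by (cases i; cases j) (auto simp: embed_frame_def first_vec_def intro: pf_const)
  have "poly_cover (\<Sum>i<q. m' - 1 - i) (G1 ` X)"
  proof (rule poly_cover_image[OF X(1)])
    fix p :: "nat \<times> nat"
    obtain i j where "p = (i, j)" by (cases p)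
    then show "(\<lambda>x. G1 x p) \<in> pf UNIV" unfolding G1_def by (simp add: embed_pf pf_coord)
  qed
  then have C1: "poly_cover (\<Sum>i<Suc q. m - 1 - i) (G1 ` X)"
    unfolding dim by (rule poly_cover_mono) auto
  define w :: "(nat + nat \<times> nat \<Rightarrow> real) \<Rightarrow> nat \<Rightarrow> real" where
    "w z j = (case j of 0 \<Rightarrow> 1 | Suc j' \<Rightarrow> - z (Inl j'))" for z j
  define G2 :: "(nat + nat \<times> nat \<Rightarrow> real) \<Rightarrow> nat \<times> nat \<Rightarrow> real" where
    "G2 z = (\<lambda>(i, j). reflect m (w z) (embed_frame (\<lambda>p. z (Inr p)) i) j)" for z
  define Z where "Z = {z :: nat + nat \<times> nat \<Rightarrow> real. (\<lambda>i. z (Inl i)) \<in> {x. \<forall>i\<ge>m'. x i = 0} \<and> (\<lambda>p. z (Inr p)) \<in> X}"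
  have C2: "poly_cover (\<Sum>i<Suc q. m - 1 - i) (G2 ` Z)"
    unfolding dim
  proof (rule poly_cover_image)
    show "poly_cover (m' + (\<Sum>i<q. m' - 1 - i)) Z"
      unfolding Z_def by (rule poly_cover_prod[OF poly_cover_coordinates X(1)])
    fix p :: "nat \<times> nat"
    obtain i j where p: "p = (i, j)" by (cases p)
    have wpf: "(\<lambda>z. w z j) \<in> pf UNIV" for j
      by (cases j) (auto simp: w_def intro!: pf_const pf_uminus pf_coord)
    have epf: "(\<lambda>z. embed_frame (\<lambda>p. z (Inr p)) i j) \<in> pf (UNIV :: (nat + nat \<times> nat) set)" for i j
      by (rule embed_pf) (auto intro: pf_coord)
    show "(\<lambda>z. G2 z p) \<in> pf UNIV"
      unfolding G2_def p prod.case reflect_def vinner_def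
      by (intro pf_add pf_mult pf_sum pf_const wpf epf)
  qed
  have "covers_up_to_scale (Suc q) (G1 ` X \<union> G2 ` Z) a" if a: "orthonormal_frame m (Suc q) a" for a
  proof -
    have avec: "is_vec m (a i)" if "i < Suc q" for i using a that by (simp add: orthonormal_frame_def)
    have aa: "vinner m (a i) (a j) = (if i = j then 1 else 0)" if "i < Suc q" "j < Suc q" for i j
      using a that by (simp add: orthonormal_frame_def)
    have rest: "\<exists>x\<in>X. \<exists>\<mu>. \<forall>i<q. \<forall>j. b i j = \<mu> i * embed_frame x (Suc i) j"
      if b: "orthonormal_frame m q b" and 0: "\<And>i. i < q \<Longrightarrow> b i 0 = 0" for b
    proof -
      have "covers_up_to_scale q X (\<lambda>i j. b i (Suc j))"
        using orthonormal_frame_tail[of m' q b] b 0 m by (intro X(2)) auto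
      then obtain x \<mu> where x: "x \<in> X" "\<And>i j. i < q \<Longrightarrow> b i (Suc j) = \<mu> i * x (i, j)"
        unfolding covers_up_to_scale_def by blast
      have "b i j = \<mu> i * embed_frame x (Suc i) j" if "i < q" for i j
        using x(2) 0 that by (cases j) (auto simp: embed_frame_def)
      then show ?thesis using x(1) by blast
    qed
    have sq: "a 0 0 * a 0 0 + (\<Sum>j<m'. a 0 (Suc j) * a 0 (Suc j)) = 1"
      using aa[of 0 0] unfolding m(1) vinner_Suc by (simp add: vinner_def)
    show ?thesis
    proof (cases "a 0 0 = 1")
      case True
      then have "\<forall>j<m'. a 0 (Suc j) = 0" using sq by (simp add: sum_nonneg_eq_0_iff)
      then have "a 0 j = first_vec j" for j
        using True avec[of 0] m by (cases j) (auto simp: first_vec_def is_vec_def not_less[symmetric])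
      then have a0: "a 0 = first_vec" by auto
      have "a (Suc i) 0 = 0" if "i < q" for i
        using aa[of "Suc i" 0] that unfolding a0 m(1) vinner_first_vec by simp
      moreover have "orthonormal_frame m q (\<lambda>i. a (Suc i))"
        using avec aa by (simp add: orthonormal_frame_def)
      ultimately obtain x \<mu> where x: "x \<in> X" "\<forall>i<q. \<forall>j. a (Suc i) j = \<mu> i * embed_frame x (Suc i) j"
        using rest[of "\<lambda>i. a (Suc i)"] by blast
      have "a i j = (case i of 0 \<Rightarrow> 1 | Suc i' \<Rightarrow> \<mu> i') * G1 x (i, j)" if "i < Suc q" for i j
        using x(2) that a0 by (cases i) (auto simp: G1_def embed_frame_def)
      then show ?thesis using x(1) unfolding covers_up_to_scale_def
        by (intro bexI[of _ "G1 x"] exI[of _ "\<lambda>i. case i of 0 \<Rightarrow> 1 | Suc i' \<Rightarrow> \<mu> i'"]) auto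
    next
      case False
      \<comment> \<open>Dividing \<open>first_vec - a 0\<close> by its zeroth entry \<open>d\<close>
        brings the mirror vector into the form \<open>(1, -u)\<close> used by the chart; its squared
        length \<open>N\<close> then satisfies \<open>d * N = 2\<close>.\<close>
      define d where "d = 1 - a 0 0"
      have d: "d \<noteq> 0" using False by (simp add: d_def)
      define v where "v j = (first_vec j - a 0 j) / d" for j
      define N where "N = vinner m v v"
      have "d * d * N = 2 * d"
      proof -
        have "d * d * N = vinner m (\<lambda>j. d * v j) (\<lambda>j. d * v j)"
          by (simp add: N_def vinner_scale_left vinner_scale_right)
        also have "(\<lambda>j. d * v j) = (\<lambda>j. first_vec j + (- 1) * a 0 j)" using d by (auto simp: v_def)
        also have "vinner m (\<lambda>j. first_vec j + (- 1) * a 0 j) (\<lambda>j. first_vec j + (- 1) * a 0 j) = 2 * d"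
        proof -
          have "vinner m first_vec first_vec = 1" "vinner m (a 0) first_vec = a 0 0"
            unfolding m(1) vinner_first_vec by (simp_all add: first_vec_def)
          then show ?thesis
            unfolding vinner_linear_left vinner_linear_right vinner_commute[of m first_vec "a 0"]
            using aa[of 0 0] by (simp add: d_def)
        qed
        finally show ?thesis .
      qed
      then have Nd: "d * N = 2" using d by simp
      then have N: "N \<noteq> 0" by auto
      have v1: "vinner m v first_vec = 1"
        unfolding m(1) vinner_first_vec using d by (simp add: v_def first_vec_def d_def)
      \<comment> \<open>The mirror is the bisector of \<open>first_vec\<close> and
        \<open>a 0\<close>, so the reflection exchanges the two up to the factor
        \<open>N\<close>.\<close>
      have r0: "reflect m v first_vec = (\<lambda>j. N * a 0 j)"
      proof
        fix j
        have "reflect m v first_vec j = N * first_vec j - 2 * v j" by (simp add: reflect_def v1 N_def)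
        also have "2 * v j = N * (first_vec j - a 0 j)"
        proof -
          have "2 * v j = N * (d * v j)" unfolding Nd[symmetric] by (simp add: mult_ac)
          also have "d * v j = first_vec j - a 0 j" using d by (simp add: v_def)
          finally show ?thesis .
        qed
        finally show "reflect m v first_vec j = N * a 0 j" by (simp add: right_diff_distrib)
      qed
      define b where "b i = (\<lambda>j. inverse N * reflect m v (a (Suc i)) j)" for i
      have vvec: "is_vec m v" using avec[of 0] m by (auto simp: v_def is_vec_def first_vec_def)
      have "orthonormal_frame m q b"
        unfolding orthonormal_frame_def
      proof (intro conjI allI impI)
        fix i assume "i < q"
        then show "is_vec m (b i)" using avec[of "Suc i"] vvec by (simp add: b_def reflect_def is_vec_def)
      next
        fix i j assume "i < q" "j < q"
        then show "vinner m (b i) (b j) = (if i = j then 1 else 0)"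
          unfolding b_def vinner_scale_left vinner_scale_right vinner_reflect_reflect N_def[symmetric]
          using N aa[of "Suc i" "Suc j"] by (simp add: power2_eq_square field_simps)
      qed
      \<comment> \<open>Self-adjointness moves the reflection onto \<open>first_vec\<close>, which
        turns the entry into a multiple of the inner product of \<open>a (Suc i)\<close> with
        \<open>a 0\<close>.\<close>
      moreover have "b i 0 = 0" if "i < q" for i
      proof -
        have "b i 0 = vinner m (b i) first_vec" unfolding m(1) vinner_first_vec ..
        also have "\<dots> = inverse N * (N * vinner m (a (Suc i)) (a 0))"
          unfolding b_def vinner_scale_left reflect_selfadjoint r0 vinner_scale_right ..
        also have "\<dots> = 0" using aa[of "Suc i" 0] that by simp
        finally show ?thesis .
      qed
      ultimately obtain x \<mu> where x: "x \<in> X" "\<forall>i<q. \<forall>j. b i j = \<mu> i * embed_frame x (Suc i) j"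
        using rest[of b] by blast
      define z where "z = case_sum (\<lambda>j. - v (Suc j)) x"
      have wz: "w z = v"
      proof
        show "w z j = v j" for j
          using d by (cases j) (auto simp: w_def z_def v_def first_vec_def d_def)
      qed
      have zZ: "z \<in> Z" using x(1) vvec m by (auto simp: Z_def z_def is_vec_def)
      have zx: "(\<lambda>p. z (Inr p)) = x" by (simp add: z_def)
      have "a i j = (case i of 0 \<Rightarrow> inverse N | Suc i' \<Rightarrow> \<mu> i' / N) * G2 z (i, j)" if i: "i < Suc q" for i j
      proof (cases i)
        case 0
        have "G2 z (i, j) = N * a 0 j" using r0 0 by (simp add: G2_def wz zx embed_frame_def)
        then show ?thesis using 0 N by simp
      next
        case (Suc i')
        have bi: "b i' = (\<lambda>j. \<mu> i' * embed_frame x i j)" using x(2) Suc i by auto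
        have "N * b i' j' = reflect m v (a i) j'" for j' using N Suc by (simp add: b_def)
        then have "reflect m v (a i) = (\<lambda>j. N * b i' j)" by auto
        \<comment> \<open>Reflecting twice recovers \<open>a i\<close> up to
          \<open>N\<^sup>2\<close>; one factor \<open>N\<close> cancels and the other goes into the
          scale.\<close>
        then have "reflect m v (reflect m v (a i)) = (\<lambda>j. N * (\<mu> i' * reflect m v (embed_frame x i) j))"
          by (simp only: bi reflect_scale)
        then have "N\<^sup>2 * a i j = N * (\<mu> i' * reflect m v (embed_frame x i) j)"
          unfolding reflect_reflect N_def[symmetric] by meson
        then have "a i j = \<mu> i' / N * reflect m v (embed_frame x i) j"
          using N by (simp add: power2_eq_square field_simps)
        then show ?thesis using Suc by (simp add: G2_def wz zx)
      qed
      then show ?thesis using zZ unfolding covers_up_to_scale_def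
        by (intro bexI[of _ "G2 z"] exI[of _ "\<lambda>i. case i of 0 \<Rightarrow> inverse N | Suc i' \<Rightarrow> \<mu> i' / N"]) auto
    qed
  qed
  then show ?case using poly_cover_Un[OF C1 C2] by blast
qed

text \<open>A unit vector is an orthonormal frame of length one, and without orthogonality the
  \<open>q\<close> vectors are charted independently of each other.\<close>

lemma unit_family_cover:
  assumes "0 < m"
  shows "\<exists>X. poly_cover (q * (m - 1)) X \<and> (\<forall>a. (\<forall>i<q. unit_vec m (a i)) \<longrightarrow> covers_up_to_scale q X a)"
proof -
  obtain X where X: "poly_cover (m - 1) X" "\<And>a. orthonormal_frame m 1 a \<Longrightarrow> covers_up_to_scale 1 X a"
    using orthonormal_frame_cover[of 1 m] assms by auto
  define X' where "X' = (\<lambda>x j. x (0::nat, j::nat) :: real) ` X"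
  have "poly_cover (m - 1) X'" unfolding X'_def by (rule poly_cover_image[OF X(1)]) (rule pf_coord, simp)
  then have "poly_cover (\<Sum>i<q. m - 1) {z. (\<forall>i\<in>{..<q}. (\<lambda>j. z (i, j)) \<in> X') \<and> (\<forall>i j. i \<notin> {..<q} \<longrightarrow> z (i, j) = 0)}"
    (is "poly_cover _ ?Z") by (intro poly_cover_family) auto
  moreover have "covers_up_to_scale q ?Z a" if a: "\<forall>i<q. unit_vec m (a i)" for a
  proof -
    have "\<exists>x \<mu>. x \<in> X' \<and> (\<forall>j. a i j = \<mu> * x j)" if "i < q" for i
    proof -
      have "orthonormal_frame m 1 (\<lambda>_. a i)" using a that by (simp add: orthonormal_frame_def unit_vec_def)
      then obtain x \<mu> where "x \<in> X" "\<forall>i'<1. \<forall>j. a i j = \<mu> i' * x (i', j)"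
        using X(2) unfolding covers_up_to_scale_def by blast
      then show ?thesis unfolding X'_def by (intro exI[of _ "\<lambda>j. x (0, j)"] exI[of _ "\<mu> 0"]) auto
    qed
    then obtain x \<mu> where x: "\<And>i. i < q \<Longrightarrow> x i \<in> X' \<and> (\<forall>j. a i j = \<mu> i * x i j)" by metis
    define z where "z = (\<lambda>(i, j). if i < q then x i j else 0)"
    have "z \<in> ?Z" using x by (auto simp: z_def)
    moreover have "\<forall>i<q. \<forall>j. a i j = \<mu> i * z (i, j)" using x by (auto simp: z_def)
    ultimately show ?thesis unfolding covers_up_to_scale_def by blast
  qed
  ultimately show ?thesis by (intro exI[of _ ?Z]) simp
qed

section \<open>Parameter counts and simultaneous charts for all modes\<close>

definition mode_dim :: "nat list \<Rightarrow> nat \<Rightarrow> nat \<Rightarrow> nat \<Rightarrow> nat" where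
  "mode_dim n s l q = (if l < s then \<Sum>i<q. n ! l - 1 - i else q * (n ! l - 1))"

lemma mode_dim_Suc: "mode_dim n s l (Suc q) = mode_dim n s l q + (if l < s then n ! l - 1 - q else n ! l - 1)"
  by (simp add: mode_dim_def)

text \<open>The triples \<open>(i, 0, i)\<close> account for the \<open>r\<close> coefficients. The
  others, sorted by mode, give the dimension of a frame manifold or of a product of spheres, so
  tangent directions and chart parameters have the same count.\<close>

lemma card_tangent_idx:
  assumes "1 \<le> s" "s \<le> length n" "\<And>l. l < length n \<Longrightarrow> r \<le> n ! l"
  shows "card (tangent_idx n s r) = r + (\<Sum>l<length n. mode_dim n s l r)"
proof -
  define J where "J l i = (if l < s then {i<..<n ! l} else {..<n ! l} - {i})" for l i
  define U where "U = (SIGMA l:{..<length n}. SIGMA i:{..<r}. J l i)"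
  let ?f = "\<lambda>(l :: nat, i :: nat, j :: nat). (i, l, j)"
  let ?g = "\<lambda>i. (i :: nat, 0 :: nat, i)"
  have n0: "0 < length n" using assms by linarith
  have eq: "tangent_idx n s r = ?g ` {..<r} \<union> ?f ` U"
  proof (intro equalityI subsetI)
    fix p assume p: "p \<in> tangent_idx n s r"
    obtain i l j where pp: "p = (i, l, j)" by (cases p)
    have c: "i < r" "l < length n" "j < n ! l" "l = 0 \<and> j = i \<or> l < s \<and> i < j \<or> s \<le> l \<and> j \<noteq> i"
      using p by (auto simp: pp tangent_idx_def)
    show "p \<in> ?g ` {..<r} \<union> ?f ` U"
    proof (cases "j = i")
      case True then show ?thesis using c assms by (auto simp: pp)
    next
      case False
      then have "(l, i, j) \<in> U" using c by (auto simp: U_def J_def)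
      then show ?thesis by (force simp: pp)
    qed
  next
    fix p assume "p \<in> ?g ` {..<r} \<union> ?f ` U"
    then show "p \<in> tangent_idx n s r" using n0 assms(3)[of 0]
      by (auto simp: tangent_idx_def U_def J_def split: if_splits)
  qed
  have "?g ` {..<r} \<inter> ?f ` U = {}" by (auto simp: U_def J_def split: if_splits)
  moreover have finU: "finite U" by (auto simp: U_def J_def)
  ultimately have "card (tangent_idx n s r) = card (?g ` {..<r}) + card (?f ` U)"
    unfolding eq by (intro card_Un_disjoint) auto
  also have "card (?g ` {..<r}) = r" by (subst card_image) (auto simp: inj_on_def)
  also have "card (?f ` U) = card U" by (rule card_image) (auto simp: inj_on_def)
  also have "card U = (\<Sum>l<length n. \<Sum>i<r. card (J l i))"
    unfolding U_def by (subst card_SigmaI) (auto simp: J_def)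
  also have "\<dots> = (\<Sum>l<length n. mode_dim n s l r)"
  proof (rule sum.cong[OF refl])
    fix l assume l: "l \<in> {..<length n}"
    have "card (J l i) = (if l < s then n ! l - 1 - i else n ! l - 1)" if "i < r" for i
      using that assms(3)[of l] l by (auto simp: J_def)
    then have "(\<Sum>i<r. card (J l i)) = (\<Sum>i<r. if l < s then n ! l - 1 - i else n ! l - 1)" by simp
    then show "(\<Sum>i<r. card (J l i)) = mode_dim n s l r" by (simp add: mode_dim_def)
  qed
  finally show ?thesis .
qed

text \<open>The number \<open>q l\<close> of vectors may vary with the mode because
  \<open>dependent_mode_cover\<close> drops one vector in a single mode.\<close>

lemma all_modes_cover:
  assumes pos: "\<And>l. l < length n \<Longrightarrow> 0 < n ! l" and q: "\<And>l. l < length n \<Longrightarrow> q l \<le> n ! l"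
  shows "\<exists>X. poly_cover (\<Sum>l<length n. mode_dim n s l (q l)) X \<and>
    (\<forall>A. (\<forall>l<length n. \<forall>i<q l. unit_vec (n ! l) (A i l)) \<longrightarrow>
      (\<forall>l<length n. l < s \<longrightarrow> (\<forall>i<q l. \<forall>i'<q l. i \<noteq> i' \<longrightarrow> vinner (n ! l) (A i l) (A i' l) = 0)) \<longrightarrow>
      (\<exists>x\<in>X. \<exists>\<mu>. \<forall>l<length n. \<forall>i<q l. \<forall>j. A i l j = \<mu> i l * x (l, i, j)))"
proof -
  have "\<exists>X. poly_cover (mode_dim n s l (q l)) X \<and> (\<forall>a. (\<forall>i<q l. unit_vec (n ! l) (a i)) \<longrightarrow>
      (l < s \<longrightarrow> (\<forall>i<q l. \<forall>i'<q l. i \<noteq> i' \<longrightarrow> vinner (n ! l) (a i) (a i') = 0)) \<longrightarrow> covers_up_to_scale (q l) X a)"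
    if l: "l < length n" for l
  proof (cases "l < s")
    case True
    have "orthonormal_frame (n ! l) (q l) a" if "\<forall>i<q l. unit_vec (n ! l) (a i)"
      "\<forall>i<q l. \<forall>i'<q l. i \<noteq> i' \<longrightarrow> vinner (n ! l) (a i) (a i') = 0" for a
      using that by (simp add: orthonormal_frame_def unit_vec_def)
    then show ?thesis using orthonormal_frame_cover[OF q[OF l]] True unfolding mode_dim_def by simp meson
  next
    case False
    then show ?thesis using unit_family_cover[OF pos[OF l], of "q l"] unfolding mode_dim_def by simp
  qed
  then have "\<forall>l\<in>{..<length n}. \<exists>X. poly_cover (mode_dim n s l (q l)) X \<and> (\<forall>a. (\<forall>i<q l. unit_vec (n ! l) (a i)) \<longrightarrow>
      (l < s \<longrightarrow> (\<forall>i<q l. \<forall>i'<q l. i \<noteq> i' \<longrightarrow> vinner (n ! l) (a i) (a i') = 0)) \<longrightarrow> covers_up_to_scale (q l) X a)"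
    by blast
  from bchoice[OF this] obtain X where X: "\<forall>l\<in>{..<length n}. poly_cover (mode_dim n s l (q l)) (X l) \<and>
      (\<forall>a. (\<forall>i<q l. unit_vec (n ! l) (a i)) \<longrightarrow>
      (l < s \<longrightarrow> (\<forall>i<q l. \<forall>i'<q l. i \<noteq> i' \<longrightarrow> vinner (n ! l) (a i) (a i') = 0)) \<longrightarrow> covers_up_to_scale (q l) (X l) a)"
    by blast
  let ?Z = "{z. (\<forall>l\<in>{..<length n}. (\<lambda>p. z (l, p)) \<in> X l) \<and> (\<forall>l p. l \<notin> {..<length n} \<longrightarrow> z (l, p) = 0)}"
  have "poly_cover (\<Sum>l<length n. mode_dim n s l (q l)) ?Z"
    using X by (intro poly_cover_family) auto
  moreover have "\<exists>x\<in>?Z. \<exists>\<mu>. \<forall>l<length n. \<forall>i<q l. \<forall>j. A i l j = \<mu> i l * x (l, i, j)"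
    if A: "\<forall>l<length n. \<forall>i<q l. unit_vec (n ! l) (A i l)"
      "\<forall>l<length n. l < s \<longrightarrow> (\<forall>i<q l. \<forall>i'<q l. i \<noteq> i' \<longrightarrow> vinner (n ! l) (A i l) (A i' l) = 0)" for A
  proof -
    have "\<exists>x \<mu>. x \<in> X l \<and> (\<forall>i<q l. \<forall>j. A i l j = \<mu> i * x (i, j))" if "l < length n" for l
    proof -
      have "covers_up_to_scale (q l) (X l) (\<lambda>i. A i l)" using X A that by simp
      then show ?thesis unfolding covers_up_to_scale_def by blast
    qed
    then obtain x \<mu> where x: "\<And>l. l < length n \<Longrightarrow> x l \<in> X l \<and> (\<forall>i<q l. \<forall>j. A i l j = \<mu> l i * x l (i, j))"
      by metis
    define z where "z = (\<lambda>(l, p). if l < length n then x l p else 0)"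
    have "z \<in> ?Z" using x by (auto simp: z_def)
    then show ?thesis using x by (intro bexI[of _ z] exI[of _ "\<lambda>i l. \<mu> l i"]) (auto simp: z_def)
  qed
  ultimately show ?thesis by blast
qed

section \<open>Degenerate decompositions\<close>

text \<open>Lets an offending term be moved to the last position, where it can be split off the
  sum.\<close>

lemma orth_decomp_permute:
  assumes "orth_decomp n s r \<sigma> A" "bij_betw \<pi> {..<r} {..<r}"
  shows "orth_decomp n s r (\<sigma> \<circ> \<pi>) (A \<circ> \<pi>)"
    and "decomp_tensor n r (\<sigma> \<circ> \<pi>) (A \<circ> \<pi>) = decomp_tensor n r \<sigma> A"
proof -
  have less: "\<pi> i < r" if "i < r" for i using assms(2) that by (auto simp: bij_betw_def)
  have inj: "\<pi> i \<noteq> \<pi> j" if "i < r" "j < r" "i \<noteq> j" for i j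
    using assms(2) that unfolding bij_betw_def inj_on_def by blast
  show "orth_decomp n s r (\<sigma> \<circ> \<pi>) (A \<circ> \<pi>)"
    using assms(1) less inj unfolding orth_decomp_def by simp
  show "decomp_tensor n r (\<sigma> \<circ> \<pi>) (A \<circ> \<pi>) = decomp_tensor n r \<sigma> A"
  proof
    fix \<alpha>
    show "decomp_tensor n r (\<sigma> \<circ> \<pi>) (A \<circ> \<pi>) \<alpha> = decomp_tensor n r \<sigma> A \<alpha>"
      unfolding decomp_tensor_def using sum.reindex_bij_betw[OF assms(2), of "\<lambda>i. \<sigma> i * outer n (A i) \<alpha>"] by simp
  qed
qed

definition swap_idx :: "nat \<Rightarrow> nat \<Rightarrow> nat \<Rightarrow> nat" where
  "swap_idx p q i = (if i = p then q else if i = q then p else i)"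

lemma bij_betw_swap_idx: "p < r \<Longrightarrow> q < r \<Longrightarrow> bij_betw (swap_idx p q) {..<r} {..<r}"
  by (rule bij_betw_byWitness[of _ "swap_idx p q"]) (auto simp: swap_idx_def)

lemma pf_outer:
  "(\<And>l j. (\<lambda>z. g z l j) \<in> pf I) \<Longrightarrow> (\<lambda>z. outer n (g z) \<alpha>) \<in> pf I"
  by (cases "\<alpha> \<in> idx n") (auto simp: outer_def intro!: pf_const pf_prod)

lemma outer_scaled:
  assumes "\<And>l j. l < length n \<Longrightarrow> a l j = c l * b l j"
  shows "outer n a \<alpha> = (\<Prod>l<length n. c l) * outer n b \<alpha>"
proof -
  have "outer n a = outer n (\<lambda>l j. c l * b l j)" by (rule outer_cong) (use assms in auto)
  then show ?thesis by (simp add: outer_scale)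
qed

text \<open>A decomposition with \<open>q\<close> terms remains. Its charts use \<open>q\<close>
  coefficients instead of \<open>Suc q\<close>, and this loss of one parameter already
  suffices.\<close>

lemma vanishing_coefficient_cover:
  assumes pos: "\<And>l. l < length n \<Longrightarrow> 0 < n ! l" and r: "\<And>l. l < length n \<Longrightarrow> Suc q \<le> n ! l"
    and s: "1 \<le> s" "s \<le> length n"
  shows "poly_cover (card (tangent_idx n s (Suc q)) - 1)
    {decomp_tensor n (Suc q) \<sigma> A | \<sigma> A. orth_decomp n s (Suc q) \<sigma> A \<and> \<sigma> q = 0}"
proof -
  have q: "q \<le> n ! l" if "l < length n" for l using r[OF that] by simp
  obtain X where X: "poly_cover (\<Sum>l<length n. mode_dim n s l q) X"
    and XA: "\<And>A. \<forall>l<length n. \<forall>i<q. unit_vec (n ! l) (A i l) \<Longrightarrow>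
      \<forall>l<length n. l < s \<longrightarrow> (\<forall>i<q. \<forall>i'<q. i \<noteq> i' \<longrightarrow> vinner (n ! l) (A i l) (A i' l) = 0) \<Longrightarrow>
      \<exists>x\<in>X. \<exists>\<mu>. \<forall>l<length n. \<forall>i<q. \<forall>j. A i l j = \<mu> i l * x (l, i, j)"
    using all_modes_cover[of n "\<lambda>_. q" s, OF pos q] by blast
  define G :: "(nat + nat \<times> nat \<times> nat \<Rightarrow> real) \<Rightarrow> nat list \<Rightarrow> real" where
    "G z \<alpha> = (\<Sum>i<q. z (Inl i) * outer n (\<lambda>l j. z (Inr (l, i, j))) \<alpha>)" for z \<alpha>
  let ?Z = "{z :: nat + nat \<times> nat \<times> nat \<Rightarrow> real. (\<lambda>i. z (Inl i)) \<in> {x. \<forall>i\<ge>q. x i = 0} \<and> (\<lambda>p. z (Inr p)) \<in> X}"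
  have "poly_cover (q + (\<Sum>l<length n. mode_dim n s l q)) (G ` ?Z)"
  proof (rule poly_cover_image[OF poly_cover_prod[OF poly_cover_coordinates X]])
    show "(\<lambda>z. G z \<alpha>) \<in> pf UNIV" for \<alpha>
      unfolding G_def by (intro pf_sum pf_mult pf_outer pf_coord UNIV_I)
  qed
  moreover have "q + (\<Sum>l<length n. mode_dim n s l q) \<le> card (tangent_idx n s (Suc q)) - 1"
  proof -
    have "(\<Sum>l<length n. mode_dim n s l q) \<le> (\<Sum>l<length n. mode_dim n s l (Suc q))"
      by (rule sum_mono) (simp add: mode_dim_Suc)
    then show ?thesis using card_tangent_idx[OF s r] by simp
  qed
  moreover have "{decomp_tensor n (Suc q) \<sigma> A | \<sigma> A. orth_decomp n s (Suc q) \<sigma> A \<and> \<sigma> q = 0} \<subseteq> G ` ?Z"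
  proof clarify
    fix \<sigma> A assume A: "orth_decomp n s (Suc q) \<sigma> A" and 0: "\<sigma> q = 0"
    have "\<exists>x\<in>X. \<exists>\<mu>. \<forall>l<length n. \<forall>i<q. \<forall>j. A i l j = \<mu> i l * x (l, i, j)"
      by (rule XA) (use A in \<open>auto simp: orth_decomp_def\<close>)
    then obtain x \<mu> where x: "x \<in> X" "\<And>l i j. l < length n \<Longrightarrow> i < q \<Longrightarrow> A i l j = \<mu> i l * x (l, i, j)" by blast
    \<comment> \<open>The charts give the vectors only up to scale; the product of the scales over
      all modes is put into the coefficient.\<close>
    define z where "z = case_sum (\<lambda>i. if i < q then \<sigma> i * (\<Prod>l<length n. \<mu> i l) else 0) x"
    have "z \<in> ?Z" using x(1) by (simp add: z_def)
    moreover have "decomp_tensor n (Suc q) \<sigma> A = G z"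
    proof
      fix \<alpha>
      have "outer n (A i) \<alpha> = (\<Prod>l<length n. \<mu> i l) * outer n (\<lambda>l j. x (l, i, j)) \<alpha>" if "i < q" for i
        using x(2) that by (intro outer_scaled) auto
      then show "decomp_tensor n (Suc q) \<sigma> A \<alpha> = G z \<alpha>"
        unfolding decomp_tensor_def G_def z_def using 0 by (simp add: mult.assoc)
    qed
    ultimately show "decomp_tensor n (Suc q) \<sigma> A \<in> G ` ?Z" by blast
  qed
  ultimately show ?thesis by (rule poly_cover_mono)
qed

text \<open>The coefficient of the last term is absorbed into the coefficients \<open>c\<close>; without this the count
  would be one too large when \<open>n\<^sub>l = r\<close>.\<close>

lemma dependent_mode_cover:
  assumes pos: "\<And>l. l < length n \<Longrightarrow> 0 < n ! l" and r: "\<And>l. l < length n \<Longrightarrow> Suc q \<le> n ! l"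
    and s: "1 \<le> s" "s \<le> length n" and l0: "s \<le> l0" "l0 < length n"
  shows "poly_cover (card (tangent_idx n s (Suc q)) - 1)
    {decomp_tensor n (Suc q) \<sigma> A | \<sigma> A. orth_decomp n s (Suc q) \<sigma> A \<and> (\<exists>c. \<forall>j. A q l0 j = (\<Sum>i<q. c i * A i l0 j))}"
proof -
  define w where "w l = (if l = l0 then q else Suc q)" for l
  have w: "w l \<le> n ! l" if "l < length n" for l using r[OF that] by (auto simp: w_def)
  obtain X where X: "poly_cover (\<Sum>l<length n. mode_dim n s l (w l)) X"
    and XA: "\<And>A. \<forall>l<length n. \<forall>i<w l. unit_vec (n ! l) (A i l) \<Longrightarrow>
      \<forall>l<length n. l < s \<longrightarrow> (\<forall>i<w l. \<forall>i'<w l. i \<noteq> i' \<longrightarrow> vinner (n ! l) (A i l) (A i' l) = 0) \<Longrightarrow>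
      \<exists>x\<in>X. \<exists>\<mu>. \<forall>l<length n. \<forall>i<w l. \<forall>j. A i l j = \<mu> i l * x (l, i, j)"
    using all_modes_cover[of n w s, OF pos w] by blast
  define last_vec :: "(nat + nat + nat \<times> nat \<times> nat \<Rightarrow> real) \<Rightarrow> nat \<Rightarrow> nat \<Rightarrow> real" where
    "last_vec z l j = (if l = l0 then \<Sum>i<q. z (Inr (Inl i)) * z (Inr (Inr (l0, i, j))) else z (Inr (Inr (l, q, j))))" for z l j
  define G :: "(nat + nat + nat \<times> nat \<times> nat \<Rightarrow> real) \<Rightarrow> nat list \<Rightarrow> real" where
    "G z \<alpha> = (\<Sum>i<q. z (Inl i) * outer n (\<lambda>l j. z (Inr (Inr (l, i, j)))) \<alpha>) + outer n (last_vec z) \<alpha>" for z \<alpha>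
  let ?C = "{x :: nat \<Rightarrow> real. \<forall>i\<ge>q. x i = 0}"
  let ?Z' = "{z :: nat + nat \<times> nat \<times> nat \<Rightarrow> real. (\<lambda>i. z (Inl i)) \<in> ?C \<and> (\<lambda>p. z (Inr p)) \<in> X}"
  let ?Z = "{z :: nat + nat + nat \<times> nat \<times> nat \<Rightarrow> real. (\<lambda>i. z (Inl i)) \<in> ?C \<and> (\<lambda>p. z (Inr p)) \<in> ?Z'}"
  have "poly_cover (q + (q + (\<Sum>l<length n. mode_dim n s l (w l)))) (G ` ?Z)"
  proof (rule poly_cover_image[OF poly_cover_prod[OF poly_cover_coordinates poly_cover_prod[OF poly_cover_coordinates X]]])
    have "(\<lambda>z. last_vec z l j) \<in> pf UNIV" for l j
      by (cases "l = l0") (auto simp: last_vec_def intro!: pf_sum pf_mult pf_coord)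
    then show "(\<lambda>z. G z \<alpha>) \<in> pf UNIV" for \<alpha>
      unfolding G_def by (intro pf_add pf_sum pf_mult pf_outer pf_coord UNIV_I)
  qed
  \<comment> \<open>Mode \<open>l0\<close> loses \<open>n ! l0 - 1 \<ge> q\<close> parameters, which
    pays for the \<open>q\<close> coefficients of the dependence. The one parameter saved is the
    coefficient of the last term.\<close>
  moreover have "q + (q + (\<Sum>l<length n. mode_dim n s l (w l))) \<le> card (tangent_idx n s (Suc q)) - 1"
  proof -
    have "(\<Sum>l<length n. mode_dim n s l (w l)) = mode_dim n s l0 q + (\<Sum>l\<in>{..<length n} - {l0}. mode_dim n s l (Suc q))"
      using l0 by (subst sum.remove[of _ l0]) (auto simp: w_def)
    moreover have "(\<Sum>l<length n. mode_dim n s l (Suc q)) = mode_dim n s l0 (Suc q) + (\<Sum>l\<in>{..<length n} - {l0}. mode_dim n s l (Suc q))"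
      using l0 by (subst sum.remove[of _ l0]) auto
    moreover have "mode_dim n s l0 q + q \<le> mode_dim n s l0 (Suc q)"
      using l0 r[OF l0(2)] by (simp add: mode_dim_Suc)
    ultimately show ?thesis using card_tangent_idx[OF s r] by simp
  qed
  moreover have "{decomp_tensor n (Suc q) \<sigma> A | \<sigma> A. orth_decomp n s (Suc q) \<sigma> A \<and>
      (\<exists>c. \<forall>j. A q l0 j = (\<Sum>i<q. c i * A i l0 j))} \<subseteq> G ` ?Z"
  proof clarify
    fix \<sigma> A c assume A: "orth_decomp n s (Suc q) \<sigma> A" and c: "\<forall>j. A q l0 j = (\<Sum>i<q. c i * A i l0 j)"
    have "\<exists>x\<in>X. \<exists>\<mu>. \<forall>l<length n. \<forall>i<w l. \<forall>j. A i l j = \<mu> i l * x (l, i, j)"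
      by (rule XA) (use A in \<open>auto simp: orth_decomp_def w_def split: if_splits\<close>)
    then obtain x \<mu> where x: "x \<in> X" "\<And>l i j. l < length n \<Longrightarrow> i < w l \<Longrightarrow> A i l j = \<mu> i l * x (l, i, j)" by blast
    \<comment> \<open>\<open>K\<close> gathers \<open>\<sigma> q\<close> and the scales of the last
      term in the modes other than \<open>l0\<close>. It is carried by mode \<open>l0\<close>, where
      the coefficients of the linear combination are free.\<close>
    define K where "K = \<sigma> q * (\<Prod>l<length n. if l = l0 then 1 else \<mu> q l)"
    define z where "z = case_sum (\<lambda>i. if i < q then \<sigma> i * (\<Prod>l<length n. \<mu> i l) else 0)
      (case_sum (\<lambda>i. if i < q then K * (c i * \<mu> i l0) else 0) x)"
    have "z \<in> ?Z" using x(1) by (simp add: z_def)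
    moreover have "decomp_tensor n (Suc q) \<sigma> A = G z"
    proof
      fix \<alpha>
      have 1: "outer n (A i) \<alpha> = (\<Prod>l<length n. \<mu> i l) * outer n (\<lambda>l j. x (l, i, j)) \<alpha>" if "i < q" for i
        using x(2) that by (intro outer_scaled) (auto simp: w_def)
      define b where "b l j = (if l = l0 then \<Sum>i<q. c i * \<mu> i l0 * x (l0, i, j) else x (l, q, j))" for l j
      have "A q l j = (if l = l0 then 1 else \<mu> q l) * b l j" if "l < length n" for l j
      proof (cases "l = l0")
        case True
        have "(\<Sum>i<q. c i * A i l0 j) = (\<Sum>i<q. c i * \<mu> i l0 * x (l0, i, j))"
          by (rule sum.cong) (auto simp: x(2)[OF l0(2)] w_def)
        then show ?thesis using c True by (simp add: b_def)
      next
        case False then show ?thesis using x(2)[OF that, of q j] by (simp add: b_def w_def)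
      qed
      then have "outer n (A q) \<alpha> = (\<Prod>l<length n. if l = l0 then 1 else \<mu> q l) * outer n b \<alpha>"
        by (rule outer_scaled)
      then have "\<sigma> q * outer n (A q) \<alpha> = K * outer n b \<alpha>" by (simp add: K_def)
      also have "K * outer n b \<alpha> = (\<Prod>l<length n. if l = l0 then K else 1) * outer n b \<alpha>" using l0 by simp
      also have "\<dots> = outer n (last_vec z) \<alpha>"
        by (rule outer_scaled[symmetric]) (auto simp: last_vec_def z_def b_def sum_distrib_left mult.assoc)
      finally have 2: "\<sigma> q * outer n (A q) \<alpha> = outer n (last_vec z) \<alpha>" .
      show "decomp_tensor n (Suc q) \<sigma> A \<alpha> = G z \<alpha>"
        unfolding decomp_tensor_def G_def using 1 2 by (simp add: z_def mult.assoc)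
    qed
    ultimately show "decomp_tensor n (Suc q) \<sigma> A \<in> G ` ?Z" by blast
  qed
  ultimately show ?thesis by (rule poly_cover_mono)
qed

text \<open>Outside \<open>Rs\<close> every decomposition violates one of the extra conditions, so
  any decomposition may be picked. A swap makes the vanishing coefficient, or a vector depending on
  the others, the last one.\<close>

lemma degenerate_tensors_cover:
  assumes pos: "\<And>l. l < length n \<Longrightarrow> 0 < n ! l" and r: "\<And>l. l < length n \<Longrightarrow> Suc q \<le> n ! l"
    and s: "1 \<le> s" "s \<le> length n"
  shows "poly_cover (card (tangent_idx n s (Suc q)) - 1) (Ps n s (Suc q) - Rs n s (Suc q))"
proof -
  let ?S1 = "{decomp_tensor n (Suc q) \<sigma> A | \<sigma> A. orth_decomp n s (Suc q) \<sigma> A \<and> \<sigma> q = 0}"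
  let ?S2 = "\<lambda>l0. {decomp_tensor n (Suc q) \<sigma> A | \<sigma> A. orth_decomp n s (Suc q) \<sigma> A \<and>
      (\<exists>c. \<forall>j. A q l0 j = (\<Sum>i<q. c i * A i l0 j))}"
  have "poly_cover (card (tangent_idx n s (Suc q)) - 1) (?S1 \<union> (\<Union>l0\<in>{s..<length n}. ?S2 l0))"
    by (intro poly_cover_Un poly_cover_UN vanishing_coefficient_cover dependent_mode_cover pos r s) auto
  moreover have "Ps n s (Suc q) - Rs n s (Suc q) \<subseteq> ?S1 \<union> (\<Union>l0\<in>{s..<length n}. ?S2 l0)"
  proof
    fix Y assume Y: "Y \<in> Ps n s (Suc q) - Rs n s (Suc q)"
    then obtain \<sigma> A where A: "orth_decomp n s (Suc q) \<sigma> A" "Y = decomp_tensor n (Suc q) \<sigma> A"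
      unfolding Ps_def by blast
    then consider p where "p < Suc q" "\<sigma> p = 0"
      | l0 where "s \<le> l0" "l0 < length n" "\<not> full_col_rank (n ! l0) (Suc q) (\<lambda>i. A i l0)"
      using Y unfolding Rs_def by blast
    then show "Y \<in> ?S1 \<union> (\<Union>l0\<in>{s..<length n}. ?S2 l0)"
    proof cases
      case (1 p)
      note perm = orth_decomp_permute[OF A(1) bij_betw_swap_idx[OF 1(1) lessI]]
      have "(\<sigma> \<circ> swap_idx p q) q = 0" using 1 by (simp add: swap_idx_def)
      then have "Y \<in> ?S1" using perm A(2) by (intro CollectI exI[of _ "\<sigma> \<circ> swap_idx p q"] exI[of _ "A \<circ> swap_idx p q"]) simp
      then show ?thesis by blast
    next
      case (2 l0)
      then obtain c p where c: "\<forall>j<n ! l0. (\<Sum>i<Suc q. c i * A i l0 j) = 0" and p: "p < Suc q" "c p \<noteq> 0"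
        unfolding full_col_rank_def by blast
      have bij: "bij_betw (swap_idx p q) {..<Suc q} {..<Suc q}" by (rule bij_betw_swap_idx[OF p(1) lessI])
      note perm = orth_decomp_permute[OF A(1) bij]
      define B where "B = A \<circ> swap_idx p q"
      define d where "d = c \<circ> swap_idx p q"
      have dq: "d q \<noteq> 0" using p by (simp add: d_def swap_idx_def)
      have Bvec: "is_vec (n ! l0) (B i l0)" if "i < Suc q" for i
        using perm(1) that 2 by (simp add: orth_decomp_def unit_vec_def B_def)
      have "B q l0 j = (\<Sum>i<q. (- d i / d q) * B i l0 j)" for j
      proof (cases "j < n ! l0")
        case True
        have "(\<Sum>i<Suc q. d i * B i l0 j) = (\<Sum>i<Suc q. c i * A i l0 j)"
          using sum.reindex_bij_betw[OF bij, of "\<lambda>i. c i * A i l0 j"] by (simp add: d_def B_def del: sum.lessThan_Suc)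
        then have "(\<Sum>i<q. d i * B i l0 j) + d q * B q l0 j = 0" using c True by simp
        then have "B q l0 j = - (\<Sum>i<q. d i * B i l0 j) / d q"
          using dq by (simp add: field_simps eq_neg_iff_add_eq_0)
        then show ?thesis by (simp add: sum_negf sum_divide_distrib)
      next
        case False
        then have "B i l0 j = 0" if "i < Suc q" for i using Bvec[OF that] by (simp add: is_vec_def)
        then show ?thesis by simp
      qed
      then have "Y \<in> ?S2 l0"
        using perm A(2) unfolding B_def[symmetric]
        by (intro CollectI exI[of _ "\<sigma> \<circ> swap_idx p q"] exI[of _ B] conjI exI[of _ "\<lambda>i. - d i / d q"]) auto
      moreover have "l0 \<in> {s..<length n}" using 2 by simp
      ultimately show ?thesis by blast
    qed
  qed
  ultimately show ?thesis by (rule poly_cover_mono[OF _ order_refl])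
qed

section \<open>Finitely many equations for the tangent space, and the exceptional
  hypersurface\<close>

lemma zariski_tangent_finite_equations:
  "\<exists>F. finite F \<and> F \<subseteq> vanishing_ideal n Y \<and>
    (\<forall>y\<in>Y. \<forall>v\<in>tspace n. (\<forall>f\<in>F. (\<Sum>\<alpha>\<in>idx n. grad (idx n) f \<alpha> y * v \<alpha>) = 0) \<longrightarrow> v \<in> zariski_tangent n Y y)"
proof -
  let ?I = "vanishing_ideal n Y" and ?R = "pf (idx n)"
  have "ideal_on ?R ?I"
    unfolding ideal_on_def vanishing_ideal_def polyfun_eq_pf zero_fun_def plus_fun_def times_fun_def
    by (auto intro: pf_const pf_add pf_mult)
  moreover have "?I \<subseteq> ?R" by (auto simp: vanishing_ideal_def polyfun_eq_pf)
  ultimately obtain F where F: "finite F" "F \<subseteq> ?I" "\<And>K. ideal_on ?R K \<Longrightarrow> F \<subseteq> K \<Longrightarrow> ?I \<subseteq> K"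
    using noetherian_pf[OF finite_idx, of n] unfolding noetherian_on_def by meson
  have "v \<in> zariski_tangent n Y y" if y: "y \<in> Y" and v: "v \<in> tspace n"
    and Fv: "\<forall>f\<in>F. (\<Sum>\<alpha>\<in>idx n. grad (idx n) f \<alpha> y * v \<alpha>) = 0" for y v
  proof -
    define D where "D f d \<longleftrightarrow> ((\<lambda>t. f (\<lambda>i. y i + t * v i)) has_real_derivative d) (at 0)" for f d
    \<comment> \<open>By the product rule these polynomials form an ideal; the condition
      \<open>f y = 0\<close> kills the term with the derivative of the multiplier. Checking the
      generators \<open>F\<close> thus settles the whole vanishing ideal.\<close>
    define K where "K = {f \<in> ?R. f y = 0 \<and> D f 0}"
    have "ideal_on ?R K"
      unfolding ideal_on_def
    proof (intro conjI ballI)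
      show "0 \<in> K" by (simp add: K_def D_def zero_fun_def pf_const)
      fix f g assume "f \<in> K" "g \<in> K"
      then show "f + g \<in> K" unfolding K_def D_def plus_fun_def
        using DERIV_add[of "\<lambda>t. f (\<lambda>i. y i + t * v i)" 0 0 UNIV "\<lambda>t. g (\<lambda>i. y i + t * v i)" 0] by (simp add: pf_add)
    next
      fix a f assume a: "a \<in> ?R" and f: "f \<in> K"
      have "((\<lambda>t. a (\<lambda>i. y i + t * v i)) has_real_derivative (\<Sum>i\<in>idx n. grad (idx n) a i y * v i)) (at 0)"
        by (rule has_derivative_grad[OF finite_idx a])
      from DERIV_mult[OF this, of "\<lambda>t. f (\<lambda>i. y i + t * v i)" 0] have "D (\<lambda>x. a x * f x) 0"
        using f by (simp add: K_def D_def)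
      then show "a * f \<in> K" using a f by (simp add: K_def times_fun_def pf_mult)
    qed
    moreover have "F \<subseteq> K"
    proof
      fix f assume f: "f \<in> F"
      then have "f \<in> ?R" "f y = 0" using F(2) y by (auto simp: vanishing_ideal_def polyfun_eq_pf)
      moreover have "D f 0" unfolding D_def
        using has_derivative_grad[OF finite_idx \<open>f \<in> ?R\<close>, of y v] Fv f by simp
      ultimately show "f \<in> K" by (simp add: K_def)
    qed
    ultimately have "?I \<subseteq> K" by (rule F(3))
    then show ?thesis using v unfolding zariski_tangent_def K_def D_def by blast
  qed
  then show ?thesis using F by blast
qed

theorem theorem3p16:
  fixes n :: "nat list" and s r :: nat
  assumes "length n \<ge> 3"
    and "1 \<le> s" and "s \<le> length n"
    and "\<forall>l<length n. 0 < n ! l"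
    and "\<forall>l<length n. r \<le> n ! l"
  shows "generic n (\<lambda>T. \<forall>Y0. critical_projection n (Ps n s r) T Y0 \<longrightarrow> Y0 \<in> Rs n s r)"
proof (cases r)
  case 0
  \<comment> \<open>For \<open>r = 0\<close> all conditions on terms are vacuous and nothing is
    exceptional. The case is separate because the count \<open>m - 1\<close> presupposes a parameter
    to lose.\<close>
  have "Y0 \<in> Rs n s r" if "Y0 \<in> Ps n s r" for Y0
    using that by (auto simp: Ps_def Rs_def 0 full_col_rank_def)
  moreover have "real_algebraic n {}" unfolding real_algebraic_def
    by (intro exI[of _ "{\<lambda>_. 1}"]) (auto simp: zero_set_def intro: polyfun.const)
  moreover have "{} \<noteq> tspace n" by (auto simp: tspace_def)
  ultimately show ?thesis unfolding generic_def critical_projection_def by blast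
next
  case (Suc q)
  let ?I = "idx n" and ?P = "Ps n s r"
  define m where "m = card (tangent_idx n s r)"
  have r: "r \<le> n ! l" if "l < length n" for l using assms(5) that by simp
  have m: "m > 0" unfolding m_def using card_tangent_idx[OF assms(2,3) r] Suc by simp
  have cover: "poly_cover (m - 1) (?P - Rs n s r)"
    unfolding m_def Suc using assms(4) r Suc by (intro degenerate_tensors_cover assms(2,3)) auto
  obtain F where F: "finite F" "F \<subseteq> vanishing_ideal n ?P"
    "\<And>y v. y \<in> ?P \<Longrightarrow> v \<in> tspace n \<Longrightarrow> (\<forall>f\<in>F. (\<Sum>\<alpha>\<in>?I. grad ?I f \<alpha> y * v \<alpha>) = 0) \<Longrightarrow> v \<in> zariski_tangent n ?P y"
    using zariski_tangent_finite_equations[of n ?P] by blast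
  have Fpf: "F \<subseteq> pf ?I" using F(2) by (auto simp: vanishing_ideal_def polyfun_eq_pf)
  \<comment> \<open>\<open>H\<close> is fixed before \<open>T\<close> and \<open>y\<close> and
    serves all subsets \<open>F'\<close> of admissible size, since the subset that spans the
    gradients depends on \<open>y\<close>.\<close>
  obtain H where H: "H \<in> pf ?I" "\<exists>x. H x \<noteq> 0"
    and H0: "\<forall>y\<in>?P - Rs n s r. \<forall>F'\<subseteq>F. \<forall>c T. card F' + (m - 1) < card ?I \<longrightarrow>
      (\<forall>i\<in>?I. T i = y i + (\<Sum>f\<in>F'. c f * grad ?I f i y)) \<longrightarrow> H T = 0"
    using normal_family_in_hypersurface[OF finite_idx F(1) Fpf cover] by blast
  have "H T = 0" if T: "critical_projection n ?P T y" and y: "y \<notin> Rs n s r" for T y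
  proof -
    have yP: "y \<in> ?P" using T by (simp add: critical_projection_def)
    obtain F' where F': "F' \<subseteq> F" "indep_on ?I F' (\<lambda>f \<alpha>. grad ?I f \<alpha> y)"
      "\<forall>f\<in>F. \<exists>c. \<forall>\<alpha>\<in>?I. grad ?I f \<alpha> y = (\<Sum>k\<in>F'. c k * grad ?I k \<alpha> y)"
      using maximal_indep_subset[OF F(1), of ?I "\<lambda>f \<alpha>. grad ?I f \<alpha> y"] by blast
    have finF': "finite F'" using F'(1) F(1) by (rule finite_subset)
    have "card F' + m \<le> card ?I" unfolding m_def
      using gradient_rank_bound_Ps[OF assms(1-3) r yP finF' _ F'(2)] F'(1) F(2) by blast
    \<comment> \<open>The parameter lost by degenerate points turns the rank bound into the strict
      inequality that elimination requires.\<close>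
    then have small: "card F' + (m - 1) < card ?I" using m by simp
    have "\<exists>c. \<forall>\<alpha>\<in>?I. T \<alpha> - y \<alpha> = (\<Sum>f\<in>F'. c f * grad ?I f \<alpha> y)"
    proof (rule in_span_if_orthogonal[OF finite_idx finF'])
      fix v assume v: "\<And>i. i \<notin> ?I \<Longrightarrow> v i = 0"
        and orth: "\<And>f. f \<in> F' \<Longrightarrow> (\<Sum>\<alpha>\<in>?I. grad ?I f \<alpha> y * v \<alpha>) = 0"
      have "(\<Sum>\<alpha>\<in>?I. grad ?I f \<alpha> y * v \<alpha>) = 0" if "f \<in> F" for f
      proof -
        from bspec[OF F'(3) that] obtain c
          where c: "\<forall>\<alpha>\<in>?I. grad ?I f \<alpha> y = (\<Sum>k\<in>F'. c k * grad ?I k \<alpha> y)" ..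
        have "(\<Sum>\<alpha>\<in>?I. grad ?I f \<alpha> y * v \<alpha>) = (\<Sum>\<alpha>\<in>?I. \<Sum>k\<in>F'. c k * (grad ?I k \<alpha> y * v \<alpha>))"
          using c by (intro sum.cong) (auto simp: sum_distrib_right mult.assoc)
        also have "\<dots> = (\<Sum>k\<in>F'. c k * (\<Sum>\<alpha>\<in>?I. grad ?I k \<alpha> y * v \<alpha>))"
          by (subst sum.swap) (simp add: sum_distrib_left)
        also have "\<dots> = 0" using orth by simp
        finally show ?thesis .
      qed
      moreover have "v \<in> tspace n" using v by (simp add: tspace_def)
      ultimately have "v \<in> zariski_tangent n ?P y" using F(3)[OF yP] by blast
      then show "(\<Sum>\<alpha>\<in>?I. v \<alpha> * (T \<alpha> - y \<alpha>)) = 0"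
        using T by (simp add: critical_projection_def tinner_def)
    qed
    then obtain c where c: "\<forall>\<alpha>\<in>?I. T \<alpha> - y \<alpha> = (\<Sum>f\<in>F'. c f * grad ?I f \<alpha> y)" ..
    have "\<forall>\<alpha>\<in>?I. T \<alpha> = y \<alpha> + (\<Sum>f\<in>F'. c f * grad ?I f \<alpha> y)"
      using c by (simp add: algebra_simps)
    moreover have "y \<in> ?P - Rs n s r" using y yP by simp
    ultimately show ?thesis using H0[rule_format, of y F' T c] F'(1) small by blast
  qed
  moreover have "real_algebraic n (zero_set n {H})"
    unfolding real_algebraic_def using H(1) by (intro exI[of _ "{H}"]) (simp add: polyfun_eq_pf)
  moreover have "zero_set n {H} \<noteq> tspace n"
  proof -
    obtain x where x: "H x \<noteq> 0" using H(2) by blast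
    \<comment> \<open>\<open>H\<close> sees only the entries in the index box, so a point where it
      is nonzero can be moved into \<open>tspace\<close>.\<close>
    define x' where "x' i = (if i \<in> ?I then x i else 0)" for i
    have "H x' = H x" by (rule pf_cong[OF H(1)]) (simp add: x'_def)
    then have "x' \<notin> zero_set n {H}" using x by (simp add: zero_set_def)
    moreover have "x' \<in> tspace n" by (simp add: tspace_def x'_def)
    ultimately show ?thesis by blast
  qed
  moreover have "T \<in> zero_set n {H}" if "T \<in> tspace n" "H T = 0" for T
    using that by (simp add: zero_set_def)
  ultimately show ?thesis unfolding generic_def by (intro exI[of _ "zero_set n {H}"]) blast
qed

end
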